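(* Let $p\in(0,\infty)$ with $p\neq2$, let $\mathfrak N$ be a $\mathrm{II}_1$ factor with tracial state $\tau$, let $U\in\mathscr U(\mathfrak N)$ and $\theta\in(-\pi,\pi]$. Then $$\|U-2P+I\|_p^p=\tau(P)(2-2\cos\theta)^{p/2}+\tau(I-P)(2+2\cos\theta)^{p/2}$$ for every projection $P\in\mathfrak N$ if and only if $U$ equals either $e^{i\theta}I$ or $e^{-i\theta}I$.
   Context: $\mathscr U(\mathfrak N)$ is the unitary group of $\mathfrak N$ and $\|A\|_p:=\tau(|A|^p)^{1/p}$ for $A\in\mathfrak N$. *)

theory Defs
  imports "HOL-Analysis.Analysis" "HOL-Computational_Algebra.Polynomial"
begin

text \<open>Complex Hilbert spaces. The inner product is linear in its first argument, and the
  underlying real Hilbert space structure is the one of the library.\<close>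

class complex_hilbert = real_inner + complete_space +
  fixes scaleC :: "complex \<Rightarrow> 'a \<Rightarrow> 'a" (infixr "*\<^sub>C" 75)
    and cinner :: "'a \<Rightarrow> 'a \<Rightarrow> complex"
  assumes scaleC_of_real: "of_real r *\<^sub>C x = r *\<^sub>R x"
    and scaleC_add_right: "c *\<^sub>C (x + y) = c *\<^sub>C x + c *\<^sub>C y"
    and scaleC_add_left: "(c + d) *\<^sub>C x = c *\<^sub>C x + d *\<^sub>C x"
    and scaleC_scaleC: "c *\<^sub>C d *\<^sub>C x = (c * d) *\<^sub>C x"
    and cinner_commute: "cinner x y = cnj (cinner y x)"
    and cinner_add_left: "cinner (x + y) z = cinner x z + cinner y z"
    and cinner_scaleC_left: "cinner (c *\<^sub>C x) y = c * cinner x y"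
    and inner_eq_Re_cinner: "x \<bullet> y = Re (cinner x y)"

instantiation complex :: complex_hilbert
begin

definition scaleC_complex :: "complex \<Rightarrow> complex \<Rightarrow> complex"
  where "scaleC_complex c x = c * x"

definition cinner_complex :: "complex \<Rightarrow> complex \<Rightarrow> complex"
  where "cinner_complex x y = x * cnj y"

instance
  by standard
    (auto simp: scaleC_complex_def cinner_complex_def algebra_simps scaleR_conv_of_real
      inner_complex_def)

end

lemma norm_scaleC: "norm (c *\<^sub>C x) = cmod c * norm (x :: 'a :: complex_hilbert)"
proof -
  have im: "Im (cinner x x) = 0"
    using arg_cong[OF cinner_commute[of x x], of Im] by simp
  have "cinner (c *\<^sub>C x) (c *\<^sub>C x) = c * cnj (c * cinner x x)"
    using cinner_commute[of x "c *\<^sub>C x"] by (simp add: cinner_scaleC_left)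
  also have "\<dots> = of_real ((cmod c)\<^sup>2) * cinner x x"
    using im by (simp add: complex_eq_iff cmod_def power2_eq_square algebra_simps)
  finally have "(norm (c *\<^sub>C x))\<^sup>2 = (cmod c * norm x)\<^sup>2"
    using im by (simp add: power2_norm_eq_inner inner_eq_Re_cinner power_mult_distrib)
  then show ?thesis
    by (simp add: power2_eq_iff_nonneg)
qed

lemma bounded_linear_scaleC: "bounded_linear (\<lambda>x :: 'a :: complex_hilbert. c *\<^sub>C x)"
proof (rule bounded_linear_intro[where K = "cmod c"])
  show "c *\<^sub>C r *\<^sub>R x = r *\<^sub>R c *\<^sub>C x" for r and x :: 'a
    by (simp add: scaleC_of_real[symmetric] scaleC_scaleC mult.commute)
qed (simp_all add: scaleC_add_right norm_scaleC mult.commute)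

text \<open>The library type of bounded operators consists of the real-linear ones; the bounded
  operators of the Hilbert space are the complex-linear ones among them.\<close>

type_synonym 'a op = "'a \<Rightarrow>\<^sub>L 'a"

definition bounded_ops :: "'a::complex_hilbert op set"
  where "bounded_ops = {T. \<forall>c x. blinfun_apply T (c *\<^sub>C x) = c *\<^sub>C blinfun_apply T x}"

abbreviation id_op :: "'a::complex_hilbert op" ("\<one>\<^sub>o")
  where "\<one>\<^sub>o \<equiv> id_blinfun"

definition op_scaleC :: "complex \<Rightarrow> 'a::complex_hilbert op \<Rightarrow> 'a op"  (infixr "*\<^sub>o" 75)
  where "c *\<^sub>o T = Blinfun (\<lambda>x. c *\<^sub>C blinfun_apply T x)"

lemma op_scaleC_apply [simp]: "blinfun_apply (c *\<^sub>o T) x = c *\<^sub>C blinfun_apply T x"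
  unfolding op_scaleC_def
  by (subst bounded_linear_Blinfun_apply)
    (auto intro: bounded_linear_compose[OF bounded_linear_scaleC] blinfun.bounded_linear_right)

definition adj :: "'a::complex_hilbert op \<Rightarrow> 'a op"
  where "adj T =
    (THE S. \<forall>x y. cinner (blinfun_apply T x) y = cinner x (blinfun_apply S y))"


subsection \<open>Functional calculus\<close>

definition op_spectrum :: "'a::complex_hilbert op \<Rightarrow> complex set"
  where "op_spectrum T =
    {z. \<not> (\<exists>S. S o\<^sub>L (T - z *\<^sub>o \<one>\<^sub>o) = \<one>\<^sub>o \<and> (T - z *\<^sub>o \<one>\<^sub>o) o\<^sub>L S = \<one>\<^sub>o)}"

definition op_poly :: "real poly \<Rightarrow> 'a::complex_hilbert op \<Rightarrow> 'a op"
  where "op_poly q T = (\<Sum>i\<le>degree q. coeff q i *\<^sub>R ((\<lambda>S. T o\<^sub>L S) ^^ i) \<one>\<^sub>o)"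

text \<open>Continuous functional calculus of a self-adjoint operator: the operator-norm limit of
  \<open>q n (T)\<close> for real polynomials \<open>q n\<close> tending to \<open>f\<close> uniformly on the (real) spectrum.\<close>

definition cfc :: "(real \<Rightarrow> real) \<Rightarrow> 'a::complex_hilbert op \<Rightarrow> 'a op"
  where "cfc f T = (THE S. \<forall>q :: nat \<Rightarrow> real poly.
    uniform_limit {x. complex_of_real x \<in> op_spectrum T} (\<lambda>n. poly (q n)) f sequentially
      \<longrightarrow> (\<lambda>n. op_poly (q n) T) \<longlonglongrightarrow> S)"

definition op_abs :: "'a::complex_hilbert op \<Rightarrow> 'a op"
  where "op_abs A = cfc sqrt (adj A o\<^sub>L A)"

definition op_powr :: "'a::complex_hilbert op \<Rightarrow> real \<Rightarrow> 'a op"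
  where "op_powr T p = cfc (\<lambda>t. t powr p) T"


subsection \<open>Factors of type \<open>II\<^sub>1\<close>\<close>

definition commutant :: "'a::complex_hilbert op set \<Rightarrow> 'a op set"
  where "commutant S = {T \<in> bounded_ops. \<forall>A\<in>S. A o\<^sub>L T = T o\<^sub>L A}"

definition von_neumann_algebra :: "'a::complex_hilbert op set \<Rightarrow> bool"
  where "von_neumann_algebra N \<longleftrightarrow>
    N \<subseteq> bounded_ops \<and> (\<forall>A\<in>N. adj A \<in> N) \<and> commutant (commutant N) = N"

definition factor :: "'a::complex_hilbert op set \<Rightarrow> bool"
  where "factor N \<longleftrightarrow> von_neumann_algebra N \<and> (\<one>\<^sub>o :: 'a op) \<noteq> 0 \<and>
    N \<inter> commutant N = range (\<lambda>c. c *\<^sub>o \<one>\<^sub>o)"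

definition projections :: "'a::complex_hilbert op set \<Rightarrow> 'a op set"
  where "projections N = {P \<in> N. adj P = P \<and> P o\<^sub>L P = P}"

definition unitaries :: "'a::complex_hilbert op set \<Rightarrow> 'a op set"
  where "unitaries N = {U \<in> N. adj U o\<^sub>L U = \<one>\<^sub>o \<and> U o\<^sub>L adj U = \<one>\<^sub>o}"

definition subprojection :: "'a::complex_hilbert op \<Rightarrow> 'a op \<Rightarrow> bool"
  where "subprojection Q P \<longleftrightarrow> P o\<^sub>L Q = Q"

text \<open>Murray--von Neumann equivalence.\<close>

definition mvn_equiv :: "'a::complex_hilbert op set \<Rightarrow> 'a op \<Rightarrow> 'a op \<Rightarrow> bool"
  where "mvn_equiv N P Q \<longleftrightarrow> (\<exists>V\<in>N. adj V o\<^sub>L V = P \<and> V o\<^sub>L adj V = Q)"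

definition finite_projection :: "'a::complex_hilbert op set \<Rightarrow> 'a op \<Rightarrow> bool"
  where "finite_projection N P \<longleftrightarrow> P \<in> projections N \<and>
    (\<forall>Q\<in>projections N. subprojection Q P \<and> mvn_equiv N P Q \<longrightarrow> Q = P)"

definition minimal_projection :: "'a::complex_hilbert op set \<Rightarrow> 'a op \<Rightarrow> bool"
  where "minimal_projection N P \<longleftrightarrow> P \<in> projections N \<and> P \<noteq> 0 \<and>
    (\<forall>Q\<in>projections N. subprojection Q P \<longrightarrow> Q = 0 \<or> Q = P)"

definition II1_factor :: "'a::complex_hilbert op set \<Rightarrow> bool"
  where "II1_factor N \<longleftrightarrow>
    factor N \<and> finite_projection N \<one>\<^sub>o \<and> (\<nexists>P. minimal_projection N P)"

text \<open>Only the values of \<open>\<tau>\<close> on \<open>N\<close> are constrained. Normality and faithfulness are not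
  required; on a \<open>II\<^sub>1\<close> factor they follow from the uniqueness of the tracial state.\<close>

definition tracial_state :: "'a::complex_hilbert op set \<Rightarrow> ('a op \<Rightarrow> complex) \<Rightarrow> bool"
  where "tracial_state N \<tau> \<longleftrightarrow>
    (\<forall>A\<in>N. \<forall>B\<in>N. \<tau> (A + B) = \<tau> A + \<tau> B) \<and>
    (\<forall>c. \<forall>A\<in>N. \<tau> (c *\<^sub>o A) = c * \<tau> A) \<and>
    (\<forall>A\<in>N. \<tau> (adj A o\<^sub>L A) \<in> \<real>\<^sub>\<ge>\<^sub>0) \<and>
    \<tau> \<one>\<^sub>o = 1 \<and>
    (\<forall>A\<in>N. \<forall>B\<in>N. \<tau> (A o\<^sub>L B) = \<tau> (B o\<^sub>L A))"

text \<open>The trace of the positive operator \<open>|A|\<^sup>p\<close> is a nonnegative real, so that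
  taking its real part loses nothing.\<close>

definition Lp_norm :: "('a::complex_hilbert op \<Rightarrow> complex) \<Rightarrow> real \<Rightarrow> 'a op \<Rightarrow> real"
  where "Lp_norm \<tau> p A = Re (\<tau> (op_powr (op_abs A) p)) powr (1 / p)"

end

theory Submission
  imports Defs "HOL-Computational_Algebra.Fundamental_Theorem_Algebra"
begin

text \<open>If \<open>P\<close> commutes with \<open>U\<close>, then \<open>|U - 2P + I|\<^sup>2 = (2 - 2C) P + (2 + 2C) (I - P)\<close> with
  \<open>C = (U + U\<^sup>*) / 2\<close>. Subtracting the identities for \<open>P\<close> and \<open>0\<close> gives \<open>\<tau>(g(C) P) = 0\<close> for
  \<open>g(t) = (2 - 2t) powr (p/2) - (2 + 2t) powr (p/2) - const\<close>; support projections of the positive and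
  negative parts of \<open>g(C)\<close> and faithfulness of the trace give \<open>g(C) = 0\<close>, and \<open>g\<close> is strictly
  decreasing on \<open>[-1, 1]\<close> with zero \<open>cos \<theta>\<close>, so \<open>C = cos \<theta>\<close>. Hence
  \<open>U = e\<^bsup>i\<theta>\<^esup> Q + e\<^bsup>-i\<theta>\<^esup> (I - Q)\<close> for a projection \<open>Q\<close>. If \<open>Q\<close> is neither \<open>0\<close> nor \<open>I\<close>, a nonzero
  partial isometry from \<open>Q\<close> to \<open>I - Q\<close> spans a copy of the \<open>2 \<times> 2\<close> matrices, in which the projection
  with all entries \<open>1/2\<close> forces \<open>(2 - 2 cos \<theta>) powr (p/2) + (2 + 2 cos \<theta>) powr (p/2) = 4 powr (p/2)\<close>;
  this is false for \<open>p \<noteq> 2\<close>.\<close>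

text \<open>Commuting test projections cannot finish the proof: once C is the scalar cos \<theta>,
  the identity holds for every P commuting with U, whatever Q is. A projection mixing the two
  eigenspaces of U is unavoidable. The value 4 comes from the entries 1/2: on the 2 x 2 block, U -
  2P + I has diagonal entries e^{i\<theta>}, e^{-i\<theta>} and off-diagonal entries -1, so its
  determinant vanishes and the square of its absolute value has eigenvalues 0 and 4. As 4 is the sum
  of 2 - 2 cos \<theta> and 2 + 2 cos \<theta>, the resulting equation says that t powr (p/2) is
  additive at these two numbers. That is always so for p = 2, and also when one of them is 0; hence
  sin \<theta> = 0 gets a separate argument.

  \<open>tracial_state\<close> demands neither normality nor faithfulness. Faithfulness is extracted
  from finiteness through comparison of projections, and weakly convergent sums of partial
  isometries serve that purpose. Spectral projections are replaced by supports of continuous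
  functions of an operator: a kernel is invariant under the commutant, so the support lies in the
  bicommutant.\<close>

instance complex_hilbert \<subseteq> banach ..

section \<open>Hilbert space operators\<close>

lemma cinner_scaleC_right: "cinner x (c *\<^sub>C y) = cnj c * cinner x (y :: 'a :: complex_hilbert)"
  by (metis cinner_commute cinner_scaleC_left complex_cnj_mult)

lemma inner_scaleC_left: "(c *\<^sub>C x) \<bullet> y = x \<bullet> (cnj c *\<^sub>C (y :: 'a :: complex_hilbert))"
  by (simp add: inner_eq_Re_cinner cinner_scaleC_left cinner_scaleC_right)

text \<open>The real inner product, paired with multiplication by \<open>\<i>\<close>, determines
  the complex one, so later arguments can work with \<open>\<bullet>\<close>.\<close>

lemma cinner_eq_inner: "cinner x y = Complex (x \<bullet> y) (x \<bullet> (\<i> *\<^sub>C (y :: 'a :: complex_hilbert)))"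
  by (simp add: inner_eq_Re_cinner cinner_scaleC_right complex_eq_iff)

lemma scaleC_one [simp]: "1 *\<^sub>C (x :: 'a :: complex_hilbert) = x"
  using scaleC_of_real[of 1 x] by simp

lemma scaleC_zero_left [simp]: "0 *\<^sub>C (x :: 'a :: complex_hilbert) = 0"
  using scaleC_of_real[of 0 x] by simp

lemma scaleC_minus_one [simp]: "(-1) *\<^sub>C (x :: 'a :: complex_hilbert) = - x"
  using scaleC_of_real[of "-1" x] by simp

lemma scaleC_zero_right [simp]: "c *\<^sub>C (0 :: 'a :: complex_hilbert) = 0"
  using norm_scaleC[of c "0 :: 'a"] by simp

lemma scaleC_diff_right: "c *\<^sub>C (x - y) = c *\<^sub>C x - c *\<^sub>C (y :: 'a :: complex_hilbert)"
  using scaleC_add_right[of c "x - y" y] by simp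

lemma scaleC_minus_left: "(- c) *\<^sub>C x = - (c *\<^sub>C (x :: 'a :: complex_hilbert))"
  using scaleC_scaleC[of "-1" c x] by simp

lemma scaleC_diff_left: "(c - d) *\<^sub>C x = c *\<^sub>C x - d *\<^sub>C (x :: 'a :: complex_hilbert)"
  using scaleC_add_left[of c "- d" x] by (simp add: scaleC_minus_left)

lemma scaleC_scaleR: "c *\<^sub>C (r *\<^sub>R x) = r *\<^sub>R (c *\<^sub>C (x :: 'a :: complex_hilbert))"
  by (simp add: scaleC_of_real[symmetric] scaleC_scaleC mult.commute)

text \<open>A minimising sequence in M is Cauchy by the parallelogram law and its limit attains the
  infimum; varying this limit along m forces orthogonality.\<close>

lemma exists_nearest_point:
  fixes M :: "'a::{real_inner,complete_space} set"
  assumes M: "subspace M" "closed M"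
  shows "\<exists>y\<in>M. \<forall>m\<in>M. (x - y) \<bullet> m = 0"
proof -
  define d where "d = Inf ((\<lambda>m. (norm (x - m))\<^sup>2) ` M)"
  have bdd: "bdd_below ((\<lambda>m. (norm (x - m))\<^sup>2) ` M)"
    by (rule bdd_belowI[of _ 0]) auto
  have d_le: "d \<le> (norm (x - m))\<^sup>2" if "m \<in> M" for m
    unfolding d_def using that bdd by (auto intro: cInf_lower)
  have "\<exists>m\<in>M. (norm (x - m))\<^sup>2 < d + inverse (real (Suc n))" for n
  proof -
    have "d < d + inverse (real (Suc n))" by simp
    moreover have "((\<lambda>m. (norm (x - m))\<^sup>2) ` M) \<noteq> {}" using M subspace_0 by auto
    ultimately show ?thesis
      unfolding d_def using bdd by (subst (asm) cInf_less_iff) auto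
  qed
  then obtain y where y: "\<And>n. y n \<in> M" "\<And>n. (norm (x - y n))\<^sup>2 < d + inverse (real (Suc n))"
    by metis
  have par: "(norm (u - v))\<^sup>2 \<le> 2 * (norm (x - u))\<^sup>2 + 2 * (norm (x - v))\<^sup>2 - 4 * d"
    if "u \<in> M" "v \<in> M" for u v
  proof -
    have "(1/2) *\<^sub>R (u + v) \<in> M" using that M by (auto intro: subspace_mul subspace_add)
    then have "d \<le> (norm (x - (1/2) *\<^sub>R (u + v)))\<^sup>2" by (rule d_le)
    also have "4 * \<dots> = 2 * (norm (x - u))\<^sup>2 + 2 * (norm (x - v))\<^sup>2 - (norm (u - v))\<^sup>2"
      by (simp add: power2_norm_eq_inner algebra_simps inner_commute)
    finally show ?thesis by linarith
  qed
  have "Cauchy y"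
  proof (rule metric_CauchyI)
    fix e :: real assume e: "e > 0"
    then obtain k where k: "inverse (real (Suc k)) < e\<^sup>2 / 4"
      by (metis reals_Archimedean zero_less_divide_iff zero_less_numeral zero_less_power)
    have "dist (y m) (y n) < e" if "m \<ge> k" "n \<ge> k" for m n
    proof -
      have i: "inverse (real (Suc m)) \<le> inverse (real (Suc k))"
        "inverse (real (Suc n)) \<le> inverse (real (Suc k))"
        using that by (auto simp: field_simps)
      have "(norm (y m - y n))\<^sup>2 < e\<^sup>2"
        using par[OF y(1)[of m] y(1)[of n]] y(2)[of m] y(2)[of n] i k by linarith
      then show ?thesis using e by (simp add: dist_norm power2_less_imp_less)
    qed
    then show "\<exists>k. \<forall>m\<ge>k. \<forall>n\<ge>k. dist (y m) (y n) < e" by blast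
  qed
  then obtain z where z: "y \<longlonglongrightarrow> z" using Cauchy_convergent convergent_def by blast
  have zM: "z \<in> M" using M(2) y(1) z closed_sequentially by blast
  have "(\<lambda>n. (norm (x - y n))\<^sup>2) \<longlonglongrightarrow> (norm (x - z))\<^sup>2"
    by (intro tendsto_intros z)
  moreover have "(\<lambda>n. d + inverse (real (Suc n))) \<longlonglongrightarrow> d"
    using LIMSEQ_inverse_real_of_nat_add by blast
  ultimately have zd: "(norm (x - z))\<^sup>2 \<le> d"
    using y(2) by (intro LIMSEQ_le) (auto intro: less_imp_le)
  have "(x - z) \<bullet> m = 0" if m: "m \<in> M" for m
  proof (cases "m = 0")
    case False
    \<comment> \<open>The coefficient that minimises the norm of x - z - t m, so a nonzero inner
      product would give a point strictly nearer than z.\<close>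
    define t where "t = ((x - z) \<bullet> m) / (m \<bullet> m)"
    have "z + t *\<^sub>R m \<in> M" using m zM M by (auto intro: subspace_mul subspace_add)
    then have "(norm (x - z))\<^sup>2 \<le> (norm (x - (z + t *\<^sub>R m)))\<^sup>2" using d_le[of "z + t *\<^sub>R m"] zd by linarith
    then have "0 \<le> t * t * (m \<bullet> m) - 2 * t * ((x - z) \<bullet> m)"
      by (simp add: power2_norm_eq_inner algebra_simps inner_commute)
    also have "\<dots> = - ((x - z) \<bullet> m)\<^sup>2 / (m \<bullet> m)"
      using False by (simp add: t_def power2_eq_square field_simps)
    finally have "((x - z) \<bullet> m)\<^sup>2 / (m \<bullet> m) \<le> 0" by simp
    moreover have "0 < m \<bullet> m" using False by simp
    ultimately have "((x - z) \<bullet> m)\<^sup>2 \<le> 0" by (simp add: divide_le_0_iff)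
    then show ?thesis by simp
  qed simp
  with zM show ?thesis by blast
qed

text \<open>For nonzero f, the difference w between a vector outside the kernel and its nearest
  point in the kernel spans the orthogonal complement, so f is a multiple of the inner product with
  w.\<close>

lemma Riesz_representation:
  fixes f :: "'a::{real_inner,complete_space} \<Rightarrow> real"
  assumes f: "bounded_linear f"
  shows "\<exists>z. \<forall>x. f x = x \<bullet> z"
proof (cases "\<forall>x. f x = 0")
  case True
  then show ?thesis by (intro exI[of _ 0]) auto
next
  case False
  then obtain x where x: "f x \<noteq> 0" by blast
  interpret f: bounded_linear f by fact
  have "subspace {x. f x = 0}"
    by (auto simp: subspace_def f.add f.scaleR f.zero)
  moreover have "closed {x. f x = 0}"
    by (intro closed_Collect_eq f.continuous_on continuous_intros)
  ultimately obtain y where y: "f y = 0" "\<And>m. f m = 0 \<Longrightarrow> (x - y) \<bullet> m = 0"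
    using exists_nearest_point[of "{x. f x = 0}" x] by auto
  define w where "w = x - y"
  have fw: "f w \<noteq> 0" using x y by (simp add: w_def f.diff)
  then have w0: "w \<bullet> w \<noteq> 0" by (auto simp: f.zero)
  have "f v = v \<bullet> ((f w / (w \<bullet> w)) *\<^sub>R w)" for v
  proof -
    have "f (v - (f v / f w) *\<^sub>R w) = 0" using fw by (simp add: f.diff f.scaleR)
    then have "w \<bullet> (v - (f v / f w) *\<^sub>R w) = 0" using y(2) w_def by blast
    then have "w \<bullet> v = (f v / f w) * (w \<bullet> w)" by (simp add: inner_diff_right)
    then show ?thesis using fw w0 by (simp add: inner_commute field_simps)
  qed
  then show ?thesis by blast
qed

text \<open>The common source of operators known only by their matrix elements: adjoints and weakly
  convergent sums are both built from it.\<close>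

lemma bounded_bilinear_form_op:
  fixes b :: "'a::{real_inner,complete_space} \<Rightarrow> 'a \<Rightarrow> real"
  assumes b: "bounded_bilinear b"
  shows "\<exists>T :: 'a \<Rightarrow>\<^sub>L 'a. \<forall>x y. b x y = T x \<bullet> y"
proof -
  interpret b: bounded_bilinear b by fact
  have "\<exists>z. \<forall>y. b x y = y \<bullet> z" for x
    by (rule Riesz_representation) (rule b.bounded_linear_right)
  then obtain t where t: "\<And>x y. b x y = t x \<bullet> y" by (metis inner_commute)
  obtain K where K: "0 \<le> K" "\<And>x y. norm (b x y) \<le> norm x * norm y * K"
    using b.nonneg_bounded by blast
  have "bounded_linear t"
  proof (rule bounded_linear_intro[where K = K])
    show "t (x + y) = t x + t y" for x y
      by (rule vector_eq_rdot[THEN iffD1]) (simp add: inner_add_left t[symmetric] b.add_left)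
    show "t (r *\<^sub>R x) = r *\<^sub>R t x" for r x
      by (rule vector_eq_rdot[THEN iffD1]) (simp add: t[symmetric] b.scaleR_left)
    show "norm (t x) \<le> norm x * K" for x
    proof (cases "t x = 0")
      case False
      have "norm (t x) * norm (t x) = b x (t x)" by (simp add: t power2_norm_eq_inner[symmetric] power2_eq_square)
      also have "\<dots> \<le> (norm x * K) * norm (t x)" using K(2)[of x "t x"] by (simp add: mult_ac)
      finally show ?thesis using False by simp
    qed (use K in simp)
  qed
  then show ?thesis using t by (intro exI[of _ "Blinfun t"]) (simp add: bounded_linear_Blinfun_apply)
qed

section \<open>Adjoints and orthogonal projections\<close>

lemma bounded_opsD: "T \<in> bounded_ops \<Longrightarrow> blinfun_apply T (c *\<^sub>C x) = c *\<^sub>C blinfun_apply T x"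
  by (simp add: bounded_ops_def)

text \<open>\<open>adj\<close> is a definite description over the complex inner product, yet testing
  against the real one suffices: S inherits complex linearity from T, and the real inner product
  separates points.\<close>

lemma adj_eqI:
  assumes "T \<in> bounded_ops" and S: "\<And>x y. blinfun_apply T x \<bullet> y = x \<bullet> blinfun_apply S y"
  shows "adj T = S"
proof -
  have Sc: "blinfun_apply S (c *\<^sub>C y) = c *\<^sub>C blinfun_apply S y" for c y
  proof (rule vector_eq_ldot[THEN iffD1], rule allI)
    fix x
    show "x \<bullet> blinfun_apply S (c *\<^sub>C y) = x \<bullet> (c *\<^sub>C blinfun_apply S y)"
      using inner_scaleC_left[of "cnj c" x "blinfun_apply S y"]
        inner_scaleC_left[of "cnj c" "blinfun_apply T x" y]
      by (simp add: S[symmetric] bounded_opsD[OF assms(1)])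
  qed
  show ?thesis
    unfolding adj_def
  proof (rule the_equality)
    show "\<forall>x y. cinner (blinfun_apply T x) y = cinner x (blinfun_apply S y)"
      by (simp add: cinner_eq_inner S Sc)
  next
    fix R assume R: "\<forall>x y. cinner (blinfun_apply T x) y = cinner x (blinfun_apply R y)"
    show "R = S"
    proof (rule blinfun_eqI, rule vector_eq_ldot[THEN iffD1], rule allI)
      show "x \<bullet> blinfun_apply R y = x \<bullet> blinfun_apply S y" for x y
        using R S[of x y] by (simp add: inner_eq_Re_cinner)
    qed
  qed
qed

lemma adj_inner:
  assumes "T \<in> bounded_ops"
  shows "blinfun_apply T x \<bullet> y = x \<bullet> blinfun_apply (adj T) y"
proof -
  have "bounded_bilinear (\<lambda>x y. x \<bullet> blinfun_apply T y)"
    by (rule bounded_bilinear.comp[OF bounded_bilinear_inner bounded_linear_ident])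
      (rule blinfun.bounded_linear_right)
  then obtain S :: "'a op" where "\<forall>x y. x \<bullet> blinfun_apply T y = blinfun_apply S x \<bullet> y"
    using bounded_bilinear_form_op by blast
  then have S: "blinfun_apply T x \<bullet> y = x \<bullet> blinfun_apply S y" for x y
    by (metis inner_commute)
  show ?thesis using adj_eqI[OF assms S] S by simp
qed

lemma adj_bounded_ops:
  assumes "T \<in> bounded_ops"
  shows "adj T \<in> bounded_ops"
  unfolding bounded_ops_def
proof safe
  fix c y
  show "blinfun_apply (adj T) (c *\<^sub>C y) = c *\<^sub>C blinfun_apply (adj T) y"
  proof (rule vector_eq_ldot[THEN iffD1], rule allI)
    fix x
    show "x \<bullet> blinfun_apply (adj T) (c *\<^sub>C y) = x \<bullet> (c *\<^sub>C blinfun_apply (adj T) y)"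
      using inner_scaleC_left[of "cnj c" x "blinfun_apply (adj T) y"]
        inner_scaleC_left[of "cnj c" "blinfun_apply T x" y]
      by (simp add: adj_inner[OF assms, symmetric] bounded_opsD[OF assms(1)])
  qed
qed

lemma adj_inner':
  assumes "T \<in> bounded_ops"
  shows "blinfun_apply (adj T) x \<bullet> y = x \<bullet> blinfun_apply T y"
  using adj_inner[OF assms, of y x] by (simp add: inner_commute)

lemma adj_adj: "T \<in> bounded_ops \<Longrightarrow> adj (adj T) = T"
  by (rule adj_eqI) (simp_all add: adj_bounded_ops adj_inner')

lemma bounded_ops_id [simp]: "\<one>\<^sub>o \<in> bounded_ops"
  and bounded_ops_zero [simp]: "0 \<in> bounded_ops"
  and bounded_ops_add: "A \<in> bounded_ops \<Longrightarrow> B \<in> bounded_ops \<Longrightarrow> A + B \<in> bounded_ops"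
  and bounded_ops_diff: "A \<in> bounded_ops \<Longrightarrow> B \<in> bounded_ops \<Longrightarrow> A - B \<in> bounded_ops"
  and bounded_ops_compose: "A \<in> bounded_ops \<Longrightarrow> B \<in> bounded_ops \<Longrightarrow> A o\<^sub>L B \<in> bounded_ops"
  and bounded_ops_scaleC: "A \<in> bounded_ops \<Longrightarrow> c *\<^sub>o A \<in> bounded_ops"
  and bounded_ops_scaleR: "A \<in> bounded_ops \<Longrightarrow> r *\<^sub>R A \<in> bounded_ops"
  by (auto simp: bounded_ops_def blinfun.bilinear_simps scaleC_add_right scaleC_diff_right
      scaleC_scaleC scaleC_scaleR mult.commute)

lemmas bounded_ops_intros = bounded_ops_id bounded_ops_zero bounded_ops_add bounded_ops_diff
  bounded_ops_compose bounded_ops_scaleC bounded_ops_scaleR adj_bounded_ops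

lemma adj_id [simp]: "adj \<one>\<^sub>o = \<one>\<^sub>o"
  and adj_zero [simp]: "adj 0 = 0"
  and adj_add: "A \<in> bounded_ops \<Longrightarrow> B \<in> bounded_ops \<Longrightarrow> adj (A + B) = adj A + adj B"
  and adj_diff: "A \<in> bounded_ops \<Longrightarrow> B \<in> bounded_ops \<Longrightarrow> adj (A - B) = adj A - adj B"
  and adj_compose: "A \<in> bounded_ops \<Longrightarrow> B \<in> bounded_ops \<Longrightarrow> adj (A o\<^sub>L B) = adj B o\<^sub>L adj A"
  and adj_scaleC: "A \<in> bounded_ops \<Longrightarrow> adj (c *\<^sub>o A) = cnj c *\<^sub>o adj A"
  and adj_scaleR: "A \<in> bounded_ops \<Longrightarrow> adj (r *\<^sub>R A) = r *\<^sub>R adj A"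
  by (rule adj_eqI; simp add: bounded_ops_intros blinfun.bilinear_simps inner_add_left
      inner_add_right inner_diff_left inner_diff_right inner_scaleC_left adj_inner
      bounded_opsD)+

lemmas adj_simps = adj_add adj_diff adj_compose adj_scaleC adj_scaleR adj_adj bounded_ops_intros

lemma adj_compose_self_eq_0:
  assumes T: "T \<in> bounded_ops" and "adj T o\<^sub>L T = 0"
  shows "T = 0"
proof (rule blinfun_eqI)
  fix x
  have "blinfun_apply T x \<bullet> blinfun_apply T x = x \<bullet> blinfun_apply (adj T o\<^sub>L T) x"
    by (simp add: adj_inner[OF T])
  then show "blinfun_apply T x = blinfun_apply 0 x" using assms(2) by simp
qed

text \<open>The last clause is the reducing-subspace criterion: an operator preserving M together
  with its adjoint commutes with the projection. Applied to a commutant, it places the projection in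
  a von Neumann algebra.\<close>

lemma exists_projection_onto:
  fixes M :: "'a::complex_hilbert set"
  assumes M: "subspace M" "closed M" "\<And>c x. x \<in> M \<Longrightarrow> c *\<^sub>C x \<in> M"
  obtains P :: "'a op" where "P \<in> bounded_ops" "adj P = P" "P o\<^sub>L P = P"
    "\<And>x. blinfun_apply P x \<in> M" "\<And>x. x \<in> M \<Longrightarrow> blinfun_apply P x = x"
    "\<And>T. T \<in> bounded_ops \<Longrightarrow> (\<And>x. x \<in> M \<Longrightarrow> blinfun_apply T x \<in> M) \<Longrightarrow>
      (\<And>x. x \<in> M \<Longrightarrow> blinfun_apply (adj T) x \<in> M) \<Longrightarrow> T o\<^sub>L P = P o\<^sub>L T"
proof -
  obtain p where p: "\<And>x. p x \<in> M" "\<And>x m. m \<in> M \<Longrightarrow> (x - p x) \<bullet> m = 0"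
    using exists_nearest_point[OF M(1,2)] by metis
  \<comment> \<open>Orthogonality characterises the nearest point, so linearity, idempotence and
    commutation all reduce to checking a candidate.\<close>
  have uniq: "p x = y" if "y \<in> M" "\<And>m. m \<in> M \<Longrightarrow> (x - y) \<bullet> m = 0" for x y
  proof -
    have d: "p x - y \<in> M" using p(1) that(1) M(1) subspace_diff by blast
    have "(p x - y) \<bullet> (p x - y) = (x - y) \<bullet> (p x - y) - (x - p x) \<bullet> (p x - y)"
      by (simp add: inner_diff_left)
    also have "\<dots> = 0" using p(2) that(2) d by simp
    finally show ?thesis by simp
  qed
  have "bounded_linear p"
  proof (rule bounded_linear_intro[where K = 1])
    show "p (x + y) = p x + p y" for x y
    proof (rule uniq)
      show "p x + p y \<in> M" by (intro subspace_add M(1) p(1))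
      show "(x + y - (p x + p y)) \<bullet> m = 0" if "m \<in> M" for m
        using p(2)[OF that, of x] p(2)[OF that, of y] by (simp add: inner_diff_left inner_add_left)
    qed
    show "p (r *\<^sub>R x) = r *\<^sub>R p x" for r x
    proof (rule uniq)
      show "r *\<^sub>R p x \<in> M" by (intro subspace_mul M(1) p(1))
      show "(r *\<^sub>R x - r *\<^sub>R p x) \<bullet> m = 0" if "m \<in> M" for m
        using p(2)[OF that, of x] by (simp flip: scaleR_diff_right)
    qed
    show "norm (p x) \<le> norm x * 1" for x
    proof -
      have "p x \<bullet> p x = x \<bullet> p x" using p(2)[OF p(1), of x x] by (simp add: inner_diff_left)
      then have "norm (p x) * norm (p x) \<le> norm x * norm (p x)"
        using Cauchy_Schwarz_ineq2[of x "p x"]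
        by (simp add: power2_norm_eq_inner[symmetric] power2_eq_square)
      then show ?thesis by (cases "p x = 0") auto
    qed
  qed
  then have app: "blinfun_apply (Blinfun p) = p" by (simp add: bounded_linear_Blinfun_apply)
  show ?thesis
  proof (rule that[of "Blinfun p"])
    have in_M: "p x = x" if "x \<in> M" for x using that by (intro uniq) auto
    show bo: "Blinfun p \<in> bounded_ops"
      unfolding bounded_ops_def mem_Collect_eq app
    proof safe
      fix c x
      have "(c *\<^sub>C x - c *\<^sub>C p x) \<bullet> m = 0" if "m \<in> M" for m
        using p(2)[OF M(3)[OF that], of x "cnj c"]
        by (simp add: inner_scaleC_left flip: scaleC_diff_right)
      then show "p (c *\<^sub>C x) = c *\<^sub>C p x" using p(1) M(3) by (intro uniq) auto
    qed
    show "adj (Blinfun p) = Blinfun p"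
    proof (rule adj_eqI[OF bo], unfold app)
      fix x y
      show "p x \<bullet> y = x \<bullet> p y"
        using p(2)[OF p(1), of x y] p(2)[OF p(1), of y x]
        by (simp add: inner_diff_left inner_diff_right inner_commute)
    qed
    show "Blinfun p o\<^sub>L Blinfun p = Blinfun p"
      by (rule blinfun_eqI) (simp add: app in_M p)
    show "blinfun_apply (Blinfun p) x \<in> M" for x by (simp add: app p)
    show "blinfun_apply (Blinfun p) x = x" if "x \<in> M" for x by (simp add: app in_M that)
    fix T :: "'a op"
    assume T: "T \<in> bounded_ops" "\<And>x. x \<in> M \<Longrightarrow> blinfun_apply T x \<in> M"
      "\<And>x. x \<in> M \<Longrightarrow> blinfun_apply (adj T) x \<in> M"
    show "T o\<^sub>L Blinfun p = Blinfun p o\<^sub>L T"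
    proof (rule blinfun_eqI)
      fix x
      have "(blinfun_apply T x - blinfun_apply T (p x)) \<bullet> m = 0" if "m \<in> M" for m
        using adj_inner[OF T(1), of "x - p x" m] p(2)[OF T(3)[OF that]]
        by (simp add: blinfun.bilinear_simps)
      then have "p (blinfun_apply T x) = blinfun_apply T (p x)"
        by (intro uniq T p)
      then show "blinfun_apply (T o\<^sub>L Blinfun p) x = blinfun_apply (Blinfun p o\<^sub>L T) x"
        by (simp add: app)
    qed
  qed
qed

section \<open>Continuous functional calculus\<close>

subsection \<open>Invertible operators and the spectrum\<close>

lemma compose_id_op [simp]: "A o\<^sub>L \<one>\<^sub>o = A" "\<one>\<^sub>o o\<^sub>L A = A"
  by (auto intro!: blinfun_eqI)

definition op_invertible :: "'a::complex_hilbert op \<Rightarrow> bool"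
  where "op_invertible T \<longleftrightarrow> (\<exists>S. S o\<^sub>L T = \<one>\<^sub>o \<and> T o\<^sub>L S = \<one>\<^sub>o)"

lemma op_spectrum_iff: "z \<in> op_spectrum T \<longleftrightarrow> \<not> op_invertible (T - z *\<^sub>o \<one>\<^sub>o)"
  by (simp add: op_spectrum_def op_invertible_def)

lemma op_invertible_compose:
  fixes A B :: "'a::complex_hilbert op"
  assumes "op_invertible A" "op_invertible B"
  shows "op_invertible (A o\<^sub>L B)"
proof -
  obtain S R where "S o\<^sub>L A = \<one>\<^sub>o" "A o\<^sub>L S = \<one>\<^sub>o" "R o\<^sub>L B = \<one>\<^sub>o" "B o\<^sub>L R = \<one>\<^sub>o"
    using assms by (auto simp: op_invertible_def)
  then have "\<And>x. S (A x) = x" "\<And>x. A (S x) = x" "\<And>x. R (B x) = x" "\<And>x. B (R x) = x"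
    by (metis blinfun_apply_blinfun_compose blinfun_apply_id_blinfun)+
  then show ?thesis
    unfolding op_invertible_def by (intro exI[of _ "R o\<^sub>L S"]) (auto intro!: blinfun_eqI)
qed

text \<open>If S inverts the product, then A S is a right inverse and S A a left inverse of B; they
  agree because S commutes with A.\<close>

lemma op_invertible_factor:
  fixes A B :: "'a::complex_hilbert op"
  assumes AB: "A o\<^sub>L B = B o\<^sub>L A" and inv: "op_invertible (A o\<^sub>L B)"
  shows "op_invertible B"
proof -
  obtain S where "S o\<^sub>L (A o\<^sub>L B) = \<one>\<^sub>o" "(A o\<^sub>L B) o\<^sub>L S = \<one>\<^sub>o"
    using inv by (auto simp: op_invertible_def)
  then have S: "S (A (B x)) = x" "A (B (S x)) = x" for x
    by (metis blinfun_apply_blinfun_compose blinfun_apply_id_blinfun)+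
  have c: "A (B x) = B (A x)" for x
    using AB by (metis blinfun_apply_blinfun_compose)
  have r: "B (A (S x)) = x" for x using S(2) c by simp
  have "S (A y) = A (S y)" for y
    using S(1)[of "A (S y)"] r[of y] by simp
  then show ?thesis
    unfolding op_invertible_def using S r
    by (intro exI[of _ "S o\<^sub>L A"]) (auto intro!: blinfun_eqI)
qed

lemma op_invertible_scaleC:
  fixes A :: "'a::complex_hilbert op"
  assumes inv: "op_invertible (c *\<^sub>o A)" and A: "A \<in> bounded_ops"
  shows "op_invertible A"
proof -
  have "c *\<^sub>o A = (c *\<^sub>o \<one>\<^sub>o) o\<^sub>L A" by (rule blinfun_eqI) simp
  moreover have "(c *\<^sub>o \<one>\<^sub>o) o\<^sub>L A = A o\<^sub>L (c *\<^sub>o \<one>\<^sub>o)"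
    by (rule blinfun_eqI) (simp add: bounded_opsD[OF A])
  ultimately show ?thesis using op_invertible_factor inv by metis
qed

text \<open>A Lax-Milgram argument: T x = y is a fixed point problem for x - t (T x - y), a
  contraction for small t, and coercivity bounds the inverse by 1/m. The bounds on spectra below
  come from exhibiting a coercive operator.\<close>

lemma coercive_imp_invertible:
  fixes T :: "'a::complex_hilbert op"
  assumes m: "m > 0" and co: "\<And>x. m * (norm x)\<^sup>2 \<le> T x \<bullet> x"
  shows "op_invertible T"
proof -
  define L where "L = norm T + m"
  have L: "L > 0" "norm T \<le> L" "m \<le> L" using m by (auto simp: L_def add_nonneg_pos)
  \<comment> \<open>Minimises 1 - 2 t m + t^2 L^2; the minimum 1 - m^2 / L^2 is the squared
    contraction constant, nonnegative because L is at least m.\<close>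
  define t where "t = m / L\<^sup>2"
  have t: "t > 0" using m L by (simp add: t_def)
  define c where "c = sqrt (1 - m\<^sup>2 / L\<^sup>2)"
  have mL: "m\<^sup>2 / L\<^sup>2 \<le> 1" using L m by (simp add: power_mono)
  have c: "0 \<le> c" "c < 1" using mL m L by (simp_all add: c_def)
  have contr: "norm (x - t *\<^sub>R T x) \<le> c * norm x" for x
  proof (rule power2_le_imp_le)
    have "norm (T x) \<le> L * norm x"
      using norm_blinfun[of T x] L(2) by (meson mult_right_mono norm_ge_zero order_trans)
    then have n: "(norm (T x))\<^sup>2 \<le> L\<^sup>2 * (norm x)\<^sup>2"
      by (metis norm_ge_zero power_mono power_mult_distrib)
    have "(norm (x - t *\<^sub>R T x))\<^sup>2 = (norm x)\<^sup>2 - 2 * t * (T x \<bullet> x) + t * t * (norm (T x))\<^sup>2"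
      by (simp add: power2_norm_eq_inner algebra_simps inner_commute)
    also have "\<dots> \<le> (norm x)\<^sup>2 - 2 * t * (m * (norm x)\<^sup>2) + t * t * (L\<^sup>2 * (norm x)\<^sup>2)"
      using t by (intro add_mono diff_mono mult_left_mono co n) auto
    also have "\<dots> = (1 - m\<^sup>2 / L\<^sup>2) * (norm x)\<^sup>2"
      using L by (simp add: t_def field_simps power2_eq_square)
    also have "\<dots> = (c * norm x)\<^sup>2" using mL by (simp add: c_def power_mult_distrib)
    finally show "(norm (x - t *\<^sub>R T x))\<^sup>2 \<le> (c * norm x)\<^sup>2" .
  qed (use c in simp)
  have "\<exists>x. T x = y" for y
  proof -
    define f where "f = (\<lambda>x. x - t *\<^sub>R (T x - y))"
    have "dist (f u) (f v) \<le> c * dist u v" for u v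
      using contr[of "u - v"] by (simp add: f_def dist_norm blinfun.bilinear_simps algebra_simps)
    then obtain x where "f x = x" using banach_fix_type[of c f] c by blast
    then show ?thesis using t by (auto simp: f_def)
  qed
  then obtain s where s: "\<And>y. T (s y) = y" by metis
  have below: "norm x \<le> norm (T x) * (1 / m)" for x
  proof (cases "x = 0")
    case False
    have "m * norm x * norm x \<le> norm (T x) * norm x"
      using co[of x] norm_cauchy_schwarz[of "T x" x] by (simp add: power2_eq_square mult.assoc)
    then have "m * norm x \<le> norm (T x)" using False by simp
    then show ?thesis using m by (simp add: field_simps)
  qed simp
  have inj: "x = y" if "T x = T y" for x y
    using below[of "x - y"] that by (simp add: blinfun.bilinear_simps)
  have "bounded_linear s"
  proof (rule bounded_linear_intro[where K = "1 / m"])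
    show "s (x + y) = s x + s y" for x y
      by (rule inj) (simp add: s blinfun.bilinear_simps)
    show "s (r *\<^sub>R x) = r *\<^sub>R s x" for r x
      by (rule inj) (simp add: s blinfun.bilinear_simps)
    show "norm (s x) \<le> norm x * (1 / m)" for x using below[of "s x"] s by simp
  qed
  then have "blinfun_apply (Blinfun s) = s" by (simp add: bounded_linear_Blinfun_apply)
  then show ?thesis
    unfolding op_invertible_def using s inj
    by (intro exI[of _ "Blinfun s"]) (auto intro!: blinfun_eqI)
qed

text \<open>If |z| exceeds the norm, multiplying T - z by -cnj z produces the dominating term |z|^2,
  and the product is coercive.\<close>

lemma spectrum_le_norm:
  fixes T :: "'a::complex_hilbert op"
  assumes T: "T \<in> bounded_ops" and z: "z \<in> op_spectrum T"
  shows "cmod z \<le> norm T"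
proof (rule ccontr)
  assume "\<not> ?thesis"
  then have gt: "cmod z > norm T" by simp
  then have z0: "cmod z > 0" by (metis norm_ge_zero order_le_less_trans)
  define m where "m = cmod z * (cmod z - norm T)"
  have "op_invertible ((- cnj z) *\<^sub>o (T - z *\<^sub>o \<one>\<^sub>o))"
  proof (rule coercive_imp_invertible)
    show "m > 0" using gt z0 by (simp add: m_def)
    fix x
    have "(cnj z *\<^sub>C T x) \<bullet> x \<le> cmod z * norm T * (norm x)\<^sup>2"
    proof -
      have "(cnj z *\<^sub>C T x) \<bullet> x \<le> cmod z * norm (T x) * norm x"
        using norm_cauchy_schwarz[of "cnj z *\<^sub>C T x" x] by (simp add: norm_scaleC)
      also have "\<dots> \<le> cmod z * (norm T * norm x) * norm x"
        by (intro mult_right_mono mult_left_mono norm_blinfun) auto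
      finally show ?thesis by (simp add: power2_eq_square mult_ac)
    qed
    moreover have "(cnj z *\<^sub>C z *\<^sub>C x) \<bullet> x = (cmod z)\<^sup>2 * (norm x)\<^sup>2"
      using inner_scaleC_left[of "cnj z" "z *\<^sub>C x" x]
      by (simp add: power2_norm_eq_inner[symmetric] norm_scaleC power_mult_distrib)
    ultimately show "m * (norm x)\<^sup>2 \<le> blinfun_apply ((- cnj z) *\<^sub>o (T - z *\<^sub>o \<one>\<^sub>o)) x \<bullet> x"
      by (simp add: m_def blinfun.bilinear_simps scaleC_minus_left scaleC_diff_right inner_diff_left
          algebra_simps power2_eq_square)
  qed
  then have "op_invertible (T - z *\<^sub>o \<one>\<^sub>o)"
    by (rule op_invertible_scaleC) (intro bounded_ops_intros T)
  with z show False by (simp add: op_spectrum_iff)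
qed

section \<open>Self-adjoint operators and their real spectrum\<close>

definition self_adjoint :: "'a::complex_hilbert op \<Rightarrow> bool"
  where "self_adjoint T \<longleftrightarrow> T \<in> bounded_ops \<and> adj T = T"

lemma self_adjointD:
  assumes "self_adjoint T"
  shows "T \<in> bounded_ops" "adj T = T" "T x \<bullet> y = x \<bullet> T y"
  using assms adj_inner[of T x y] by (auto simp: self_adjoint_def)

lemma self_adjointI:
  assumes "T \<in> bounded_ops" "\<And>x y. blinfun_apply T x \<bullet> y = x \<bullet> blinfun_apply T y"
  shows "self_adjoint T"
  using assms adj_eqI by (auto simp: self_adjoint_def)

lemma self_adjoint_id [simp]: "self_adjoint \<one>\<^sub>o"
  and self_adjoint_zero [simp]: "self_adjoint 0"
  and self_adjoint_add: "self_adjoint A \<Longrightarrow> self_adjoint B \<Longrightarrow> self_adjoint (A + B)"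
  and self_adjoint_diff: "self_adjoint A \<Longrightarrow> self_adjoint B \<Longrightarrow> self_adjoint (A - B)"
  and self_adjoint_scaleR: "self_adjoint A \<Longrightarrow> self_adjoint (r *\<^sub>R A)"
  and self_adjoint_compose:
    "self_adjoint A \<Longrightarrow> self_adjoint B \<Longrightarrow> A o\<^sub>L B = B o\<^sub>L A \<Longrightarrow> self_adjoint (A o\<^sub>L B)"
  and self_adjoint_adj_compose: "C \<in> bounded_ops \<Longrightarrow> self_adjoint (adj C o\<^sub>L C)"
  by (auto simp: self_adjoint_def adj_simps)

text \<open>With S = T - Re z, the product of T - cnj z and T - z is S^2 + (Im z)^2, which is
  coercive for nonzero Im z; its commuting factor T - z is then invertible.\<close>

lemma self_adjoint_spectrum_real:
  fixes T :: "'a::complex_hilbert op"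
  assumes T: "self_adjoint T" and z: "z \<in> op_spectrum T"
  shows "Im z = 0"
proof (rule ccontr)
  assume im: "Im z \<noteq> 0"
  note sa = self_adjointD[OF T]
  define S where "S = T - Re z *\<^sub>R \<one>\<^sub>o"
  have S: "self_adjoint S" unfolding S_def by (intro self_adjoint_diff self_adjoint_scaleR T) simp
  have zsplit: "w *\<^sub>C x = Re w *\<^sub>R x + Im w *\<^sub>R \<i> *\<^sub>C x" for w and x :: 'a
  proof -
    have "w = of_real (Re w) + of_real (Im w) * \<i>" by (simp add: complex_eq_iff)
    then have "w *\<^sub>C x = (of_real (Re w) + of_real (Im w) * \<i>) *\<^sub>C x" by simp
    then show ?thesis
      by (simp only: scaleC_add_left scaleC_scaleC[symmetric] scaleC_of_real)
  qed
  have A: "blinfun_apply (T - z *\<^sub>o \<one>\<^sub>o) x = S x - Im z *\<^sub>R \<i> *\<^sub>C x" for x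
    by (simp add: S_def blinfun.bilinear_simps zsplit[of z])
  have B: "blinfun_apply (T - cnj z *\<^sub>o \<one>\<^sub>o) x = S x + Im z *\<^sub>R \<i> *\<^sub>C x" for x
    by (simp add: S_def blinfun.bilinear_simps zsplit[of "cnj z"])
  have Si: "S (\<i> *\<^sub>C x) = \<i> *\<^sub>C S x" for x
    using self_adjointD(1)[OF S] by (rule bounded_opsD)
  have "op_invertible ((T - cnj z *\<^sub>o \<one>\<^sub>o) o\<^sub>L (T - z *\<^sub>o \<one>\<^sub>o))"
  proof (rule coercive_imp_invertible)
    show "(Im z)\<^sup>2 > 0" using im by simp
    fix x
    have "blinfun_apply ((T - cnj z *\<^sub>o \<one>\<^sub>o) o\<^sub>L (T - z *\<^sub>o \<one>\<^sub>o)) x = S (S x) + (Im z)\<^sup>2 *\<^sub>R x"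
      by (simp only: blinfun_apply_blinfun_compose A B)
        (simp add: blinfun.bilinear_simps Si scaleC_diff_right scaleC_scaleR scaleC_scaleC
          scaleR_diff_right scaleR_add_right power2_eq_square)
    then show "(Im z)\<^sup>2 * (norm x)\<^sup>2 \<le> blinfun_apply ((T - cnj z *\<^sub>o \<one>\<^sub>o) o\<^sub>L (T - z *\<^sub>o \<one>\<^sub>o)) x \<bullet> x"
      using self_adjointD(3)[OF S, of "S x" x] by (simp add: inner_add_left power2_norm_eq_inner)
  qed
  moreover have "(T - cnj z *\<^sub>o \<one>\<^sub>o) o\<^sub>L (T - z *\<^sub>o \<one>\<^sub>o) = (T - z *\<^sub>o \<one>\<^sub>o) o\<^sub>L (T - cnj z *\<^sub>o \<one>\<^sub>o)"
    by (rule blinfun_eqI) (simp add: blinfun.bilinear_simps bounded_opsD[OF sa(1)] scaleC_diff_right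
        scaleC_scaleC mult.commute)
  ultimately have "op_invertible (T - z *\<^sub>o \<one>\<^sub>o)" by (rule op_invertible_factor[rotated])
  with z show False by (simp add: op_spectrum_iff)
qed

definition real_spectrum :: "'a::complex_hilbert op \<Rightarrow> real set"
  where "real_spectrum T = {x. complex_of_real x \<in> op_spectrum T}"

lemma real_spectrum_subset: "T \<in> bounded_ops \<Longrightarrow> real_spectrum T \<subseteq> {- norm T..norm T}"
  using spectrum_le_norm[of T] by (fastforce simp: real_spectrum_def abs_le_iff)

lemma op_scaleC_of_real: "complex_of_real r *\<^sub>o T = r *\<^sub>R T"
  by (rule blinfun_eqI) (simp add: scaleC_of_real blinfun.bilinear_simps)

lemma real_spectrum_nonneg:
  fixes T :: "'a::complex_hilbert op"
  assumes pos: "\<And>x. 0 \<le> T x \<bullet> x" and x: "x \<in> real_spectrum T"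
  shows "0 \<le> x"
proof (rule ccontr)
  assume "\<not> 0 \<le> x"
  then have "op_invertible (T - x *\<^sub>R \<one>\<^sub>o)"
    using pos by (intro coercive_imp_invertible[of "- x"])
      (auto simp: blinfun.bilinear_simps inner_diff_left power2_norm_eq_inner)
  then show False using x by (simp add: real_spectrum_def op_spectrum_iff op_scaleC_of_real)
qed

subsection \<open>Polynomials in an operator\<close>

lemma op_poly_0 [simp]: "op_poly 0 T = 0"
  by (simp add: op_poly_def)

lemma op_poly_pCons: "op_poly (pCons a p) T = a *\<^sub>R \<one>\<^sub>o + (T o\<^sub>L op_poly p T)"
proof (cases "p = 0")
  case False
  then have "op_poly (pCons a p) T =
    a *\<^sub>R \<one>\<^sub>o + (\<Sum>i\<le>degree p. coeff p i *\<^sub>R (T o\<^sub>L ((\<lambda>S. T o\<^sub>L S) ^^ i) \<one>\<^sub>o))"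
    by (simp add: op_poly_def sum.atMost_Suc_shift del: sum.atMost_Suc)
  also have "\<dots> = a *\<^sub>R \<one>\<^sub>o + (T o\<^sub>L op_poly p T)"
    by (simp add: op_poly_def bounded_bilinear.sum_right[OF bounded_bilinear_blinfun_compose]
        bounded_bilinear.scaleR_right[OF bounded_bilinear_blinfun_compose])
  finally show ?thesis .
qed (simp add: op_poly_def)

lemma op_poly_add: "op_poly (p + q) T = op_poly p T + op_poly q T"
  by (induction p q rule: poly_induct2)
    (auto intro!: blinfun_eqI simp: op_poly_pCons blinfun.bilinear_simps algebra_simps)

lemma op_poly_smult: "op_poly (smult c p) T = c *\<^sub>R op_poly p T"
  by (induction p) (auto intro!: blinfun_eqI simp: op_poly_pCons blinfun.bilinear_simps algebra_simps)

lemma op_poly_diff: "op_poly (p - q) T = op_poly p T - op_poly q T"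
  using op_poly_add[of p "smult (-1) q" T] op_poly_smult[of "-1" q T] by simp

lemma op_poly_mult: "op_poly (p * q) T = op_poly p T o\<^sub>L op_poly q T"
  by (induction p)
    (auto intro!: blinfun_eqI simp: op_poly_pCons op_poly_add op_poly_smult blinfun.bilinear_simps)

lemma op_poly_commute:
  assumes "S o\<^sub>L T = T o\<^sub>L S"
  shows "S o\<^sub>L op_poly p T = op_poly p T o\<^sub>L S"
proof -
  have c: "S (T x) = T (S x)" for x using assms by (metis blinfun_apply_blinfun_compose)
  have "S (op_poly p T x) = op_poly p T (S x)" for x
    by (induction p arbitrary: x) (auto simp: op_poly_pCons blinfun.bilinear_simps c)
  then show ?thesis by (intro blinfun_eqI) simp
qed

lemma op_poly_self_adjoint:
  assumes "self_adjoint T"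
  shows "self_adjoint (op_poly p T)"
proof (induction p)
  case (pCons a p)
  have "self_adjoint (T o\<^sub>L op_poly p T)"
    by (intro self_adjoint_compose assms pCons op_poly_commute) simp
  then show ?case by (simp add: op_poly_pCons self_adjoint_add self_adjoint_scaleR)
qed simp

text \<open>Real polynomials need not split; the complex version lets the fundamental theorem of
  algebra factor them into terms T - z.\<close>

definition op_cpoly :: "complex poly \<Rightarrow> 'a::complex_hilbert op \<Rightarrow> 'a op"
  where "op_cpoly p T = fold_coeffs (\<lambda>a S. a *\<^sub>o \<one>\<^sub>o + (T o\<^sub>L S)) p 0"

lemma op_cpoly_0 [simp]: "op_cpoly 0 T = 0"
  by (simp add: op_cpoly_def)

lemma op_cpoly_pCons: "op_cpoly (pCons a p) T = a *\<^sub>o \<one>\<^sub>o + (T o\<^sub>L op_cpoly p T)"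
proof (cases "p = 0 \<and> a = 0")
  case True
  then show ?thesis by (auto intro!: blinfun_eqI simp: blinfun.bilinear_simps)
qed (auto simp: op_cpoly_def)

lemma op_cpoly_add: "op_cpoly (p + q) T = op_cpoly p T + op_cpoly q T"
  by (induction p q rule: poly_induct2)
    (auto intro!: blinfun_eqI simp: op_cpoly_pCons blinfun.bilinear_simps scaleC_add_left algebra_simps)

lemma op_cpoly_smult:
  assumes "T \<in> bounded_ops"
  shows "op_cpoly (smult c p) T = c *\<^sub>o op_cpoly p T"
  by (induction p) (auto intro!: blinfun_eqI simp: op_cpoly_pCons blinfun.bilinear_simps
      scaleC_add_right scaleC_scaleC bounded_opsD[OF assms])

lemma op_cpoly_linear_factor:
  assumes "T \<in> bounded_ops"
  shows "op_cpoly ([:- z, 1:] * p) T = (T - z *\<^sub>o \<one>\<^sub>o) o\<^sub>L op_cpoly p T"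
  by (auto intro!: blinfun_eqI simp: op_cpoly_add op_cpoly_smult[OF assms] op_cpoly_pCons
      blinfun.bilinear_simps scaleC_minus_left simp del: smult_minus_left)

lemma op_poly_eq_op_cpoly: "op_poly p T = op_cpoly (map_poly of_real p) T"
  by (induction p) (auto simp: op_poly_pCons op_cpoly_pCons map_poly_pCons op_scaleC_of_real)

text \<open>p(T) is a nonzero scalar times a product of factors T - z with z a root of p, each of
  them invertible. The contrapositive turns non-invertibility into a root of p in the
  spectrum.\<close>

lemma op_cpoly_invertible:
  fixes T :: "'a::complex_hilbert op"
  assumes T: "T \<in> bounded_ops" and "p \<noteq> 0" and "\<And>z. poly p z = 0 \<Longrightarrow> z \<notin> op_spectrum T"
  shows "op_invertible (op_cpoly p T)"
  using assms(2,3)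
proof (induction "degree p" arbitrary: p)
  case 0
  then obtain a where a: "p = [:a:]" "a \<noteq> 0"
    by (metis degree_eq_zeroE pCons_0_0)
  show ?case
    unfolding op_invertible_def
    by (rule exI[of _ "inverse a *\<^sub>o \<one>\<^sub>o"])
      (use a in \<open>auto intro!: blinfun_eqI simp: op_cpoly_pCons blinfun.bilinear_simps scaleC_scaleC\<close>)
next
  case (Suc n)
  then have "\<not> constant (poly p)" by (simp add: constant_degree)
  then obtain z where z: "poly p z = 0" using fundamental_theorem_of_algebra by blast
  then obtain r where r: "p = [:- z, 1:] * r" by (metis dvdE poly_eq_0_iff_dvd)
  with Suc.prems have r0: "r \<noteq> 0" by auto
  then have "degree r = n" using Suc.hyps(2) unfolding r by (subst (asm) degree_mult_eq) auto
  then have "op_invertible (op_cpoly r T)"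
    using Suc.prems(2) r0 by (intro Suc.hyps(1)) (auto simp: r)
  moreover have "op_invertible (T - z *\<^sub>o \<one>\<^sub>o)"
    using Suc.prems(2)[OF z] by (simp add: op_spectrum_iff)
  ultimately show ?case
    by (simp only: r op_cpoly_linear_factor[OF T] op_invertible_compose)
qed

text \<open>The squared norm is an approximate eigenvalue of K^2: an inverse S would keep
  \<open>K (K x) - m\<^sup>2 *\<^sub>R x\<close> away from 0, and this would push the norm of K
  strictly below itself.\<close>

lemma norm_power2_not_invertible:
  fixes K :: "'a::complex_hilbert op"
  assumes K: "self_adjoint K" and "K \<noteq> 0"
  shows "\<not> op_invertible ((K o\<^sub>L K) - (norm K)\<^sup>2 *\<^sub>R \<one>\<^sub>o)"
proof
  define m where "m = norm K"
  have m: "m > 0" using assms by (simp add: m_def)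
  assume "op_invertible ((K o\<^sub>L K) - (norm K)\<^sup>2 *\<^sub>R \<one>\<^sub>o)"
  then obtain S where "S o\<^sub>L ((K o\<^sub>L K) - m\<^sup>2 *\<^sub>R \<one>\<^sub>o) = \<one>\<^sub>o"
    unfolding op_invertible_def m_def by blast
  then have S: "S (K (K x) - m\<^sup>2 *\<^sub>R x) = x" for x
    by (drule_tac arg_cong[where f = "\<lambda>T. blinfun_apply T x"]) (simp add: blinfun.bilinear_simps)
  have S0: "norm S > 0"
  proof (rule ccontr)
    assume "\<not> norm S > 0"
    then have "S = 0" by simp
    then have "x = 0" for x :: 'a using S[of x] by simp
    then have "K = 0" by (intro blinfun_eqI) metis
    with assms show False by simp
  qed
  \<comment> \<open>The amount by which the lower bound supplied by S improves m^2 in the estimate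
    of the squared norm of K x.\<close>
  define \<delta> where "\<delta> = 1 / ((norm S)\<^sup>2 * m\<^sup>2)"
  have \<delta>: "\<delta> > 0" using S0 m by (simp add: \<delta>_def)
  have *: "(norm (K x))\<^sup>2 \<le> (m\<^sup>2 - \<delta>) * (norm x)\<^sup>2" for x
  proof -
    have "norm (K (K x)) \<le> m * norm (K x)" unfolding m_def by (rule norm_blinfun)
    then have n: "(norm (K (K x)))\<^sup>2 \<le> m\<^sup>2 * (norm (K x))\<^sup>2"
      by (metis norm_ge_zero power_mono power_mult_distrib)
    have "(norm (K (K x) - m\<^sup>2 *\<^sub>R x))\<^sup>2 =
      (norm (K (K x)))\<^sup>2 - 2 * m\<^sup>2 * (K (K x) \<bullet> x) + m\<^sup>2 * m\<^sup>2 * (norm x)\<^sup>2"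
      by (simp add: power2_norm_eq_inner algebra_simps inner_commute)
    also have "K (K x) \<bullet> x = (norm (K x))\<^sup>2"
      by (simp add: self_adjointD(3)[OF K] power2_norm_eq_inner)
    finally have e: "(norm (K (K x) - m\<^sup>2 *\<^sub>R x))\<^sup>2 \<le> m\<^sup>2 * (m\<^sup>2 * (norm x)\<^sup>2 - (norm (K x))\<^sup>2)"
      using n by (simp add: algebra_simps)
    have "norm x \<le> norm S * norm (K (K x) - m\<^sup>2 *\<^sub>R x)" using norm_blinfun[of S] S by metis
    then have "(norm x)\<^sup>2 \<le> (norm S)\<^sup>2 * (norm (K (K x) - m\<^sup>2 *\<^sub>R x))\<^sup>2"
      by (metis norm_ge_zero power_mono power_mult_distrib)
    also have "\<dots> \<le> (norm S)\<^sup>2 * (m\<^sup>2 * (m\<^sup>2 * (norm x)\<^sup>2 - (norm (K x))\<^sup>2))"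
      by (intro mult_left_mono e) simp
    finally have "(norm x)\<^sup>2 / ((norm S)\<^sup>2 * m\<^sup>2) \<le> m\<^sup>2 * (norm x)\<^sup>2 - (norm (K x))\<^sup>2"
      using S0 m by (simp add: divide_le_eq mult_ac)
    then show ?thesis by (simp add: \<delta>_def algebra_simps)
  qed
  have md: "m\<^sup>2 - \<delta> \<ge> 0"
  proof (rule ccontr)
    assume neg: "\<not> ?thesis"
    have "K x = 0" for x
    proof -
      have "(m\<^sup>2 - \<delta>) * (norm x)\<^sup>2 \<le> 0" using neg by (simp add: mult_nonpos_nonneg)
      with *[of x] have "(norm (K x))\<^sup>2 \<le> 0" by linarith
      then show ?thesis by simp
    qed
    then show False using \<open>K \<noteq> 0\<close> by (metis blinfun.zero_left blinfun_eqI)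
  qed
  have "norm K \<le> sqrt (m\<^sup>2 - \<delta>)"
  proof (rule norm_blinfun_bound)
    show "norm (K x) \<le> sqrt (m\<^sup>2 - \<delta>) * norm x" for x
      by (rule power2_le_imp_le) (use * md in \<open>auto simp: power_mult_distrib\<close>)
  qed (use md in simp)
  also have "\<dots> < sqrt (m\<^sup>2)" using \<delta> by (simp only: real_sqrt_less_iff)
  also have "\<dots> = m" using m by simp
  finally show False by (simp add: m_def)
qed

text \<open>By non-invertibility at the squared norm m^2 of q(T), the polynomial q^2 - m^2 must
  vanish somewhere on the spectrum, which is real.\<close>

lemma op_poly_norm_attained:
  assumes T: "self_adjoint T" and nz: "op_poly q T \<noteq> 0"
  shows "\<exists>x\<in>real_spectrum T. \<bar>poly q x\<bar> = norm (op_poly q T)"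
proof -
  define m where "m = norm (op_poly q T)"
  define r where "r = q * q - [:m\<^sup>2:]"
  have "\<not> op_invertible (op_poly r T)"
    using norm_power2_not_invertible[OF op_poly_self_adjoint[OF T] nz]
    by (simp add: r_def op_poly_diff op_poly_mult op_poly_pCons m_def)
  then have ni: "\<not> op_invertible (op_cpoly (map_poly of_real r) T)"
    using op_poly_eq_op_cpoly[of r T] by metis
  have "\<exists>z. z \<in> op_spectrum T \<and> poly (map_poly of_real r) z = 0"
  proof (cases "r = 0")
    case False
    then have "map_poly complex_of_real r \<noteq> 0" by (simp add: map_poly_eq_0_iff)
    then show ?thesis using op_cpoly_invertible[OF self_adjointD(1)[OF T]] ni by blast
  next
    case True
    \<comment> \<open>When q^2 - m^2 is the zero polynomial any spectral point will do, so the
      spectrum must be shown nonempty; the nonzero polynomial X^2 - (norm T)^2 serves for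
      that.\<close>
    have "op_spectrum T \<noteq> {}"
    proof
      assume "op_spectrum T = {}"
      then have "op_invertible (op_cpoly (map_poly of_real ([:0,1:] * [:0,1:] - [:(norm T)\<^sup>2:])) T)"
        using map_poly_eq_0_iff[of complex_of_real "[:0,1:] * [:0,1:] - [:(norm T)\<^sup>2:]"]
        by (intro op_cpoly_invertible self_adjointD[OF T]) auto
      then have inv: "op_invertible ((T o\<^sub>L T) - (norm T)\<^sup>2 *\<^sub>R \<one>\<^sub>o)"
        by (simp only: op_poly_eq_op_cpoly[symmetric] op_poly_diff op_poly_mult) (simp add: op_poly_pCons)
      show False
      proof (cases "T = 0")
        case True
        with inv have "op_invertible (0 :: 'a op)" by simp
        then have "(\<one>\<^sub>o :: 'a op) = 0" by (simp add: op_invertible_def)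
        then have "\<And>x :: 'a. x = 0" by (metis blinfun.zero_left blinfun_apply_id_blinfun)
        then have "op_poly q T = 0" by (metis blinfun_eqI)
        then show False using nz by simp
      qed (use inv norm_power2_not_invertible[OF T] in blast)
    qed
    then show ?thesis using True by auto
  qed
  then obtain z where z: "z \<in> op_spectrum T" "poly (map_poly of_real r) z = 0" by blast
  then have zx: "z = of_real (Re z)"
    using self_adjoint_spectrum_real[OF T] by (simp add: complex_eq_iff)
  have "poly (map_poly of_real s) (of_real x) = complex_of_real (poly s x)" for s x
    by (induction s) (auto simp: map_poly_pCons)
  then have "poly r (Re z) = 0" using z(2) zx by (metis of_real_eq_0_iff)
  then have "(poly q (Re z))\<^sup>2 = m\<^sup>2" by (simp add: r_def power2_eq_square)
  then have "\<bar>poly q (Re z)\<bar> = m" using norm_ge_zero[of "op_poly q T"] unfolding m_def power2_eq_iff by linarith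
  moreover have "Re z \<in> real_spectrum T" using z(1) zx by (simp add: real_spectrum_def)
  ultimately show ?thesis by (auto simp: m_def)
qed

lemma op_poly_norm_le:
  assumes "self_adjoint T" and "\<And>x. x \<in> real_spectrum T \<Longrightarrow> \<bar>poly q x\<bar> \<le> M" and "0 \<le> M"
  shows "norm (op_poly q T) \<le> M"
  using op_poly_norm_attained[OF assms(1), of q] assms(2,3) by fastforce

text \<open>One half of spectral mapping: q - q(x) is divisible by X - x, so q(T) - q(x) is not
  invertible and q(x) lies in the spectrum of q(T).\<close>

lemma op_poly_norm_ge:
  fixes T :: "'a::complex_hilbert op"
  assumes T: "T \<in> bounded_ops" and x: "x \<in> real_spectrum T"
  shows "\<bar>poly q x\<bar> \<le> norm (op_poly q T)"
proof -
  have "poly (q - [:poly q x:]) x = 0" by simp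
  then obtain r where r: "q - [:poly q x:] = [:- x, 1:] * r" by (metis dvdE poly_eq_0_iff_dvd)
  have lin: "op_poly [:- x, 1:] T = T - of_real x *\<^sub>o \<one>\<^sub>o"
    by (auto intro!: blinfun_eqI simp: op_poly_pCons op_scaleC_of_real blinfun.bilinear_simps)
  have comm: "op_poly r T o\<^sub>L op_poly [:- x, 1:] T = op_poly [:- x, 1:] T o\<^sub>L op_poly r T"
    by (simp only: op_poly_mult[symmetric] mult.commute)
  have "\<not> op_invertible (op_poly r T o\<^sub>L op_poly [:- x, 1:] T)"
    using op_invertible_factor[OF comm] x unfolding lin by (auto simp: real_spectrum_def op_spectrum_iff)
  moreover have "op_poly r T o\<^sub>L op_poly [:- x, 1:] T = op_poly q T - of_real (poly q x) *\<^sub>o \<one>\<^sub>o"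
  proof -
    have "op_poly r T o\<^sub>L op_poly [:- x, 1:] T = op_poly ([:- x, 1:] * r) T"
      by (simp only: op_poly_mult comm)
    also have "\<dots> = op_poly (q - [:poly q x:]) T" by (simp only: r)
    finally show ?thesis by (simp add: op_poly_diff op_poly_pCons op_scaleC_of_real)
  qed
  ultimately have "\<not> op_invertible (op_poly q T - of_real (poly q x) *\<^sub>o \<one>\<^sub>o)" by simp
  moreover have "op_poly q T \<in> bounded_ops"
    by (induction q) (auto simp: op_poly_pCons intro!: bounded_ops_intros T)
  ultimately show ?thesis
    using spectrum_le_norm[of "op_poly q T" "of_real (poly q x)"] by (simp add: op_spectrum_iff)
qed

subsection \<open>Existence and algebraic properties of the functional calculus\<close>

lemma real_polynomial_approximation:
  assumes "continuous_on {a..b::real} f"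
  shows "\<exists>q :: nat \<Rightarrow> real poly. uniform_limit {a..b} (\<lambda>n. poly (q n)) f sequentially"
proof -
  have "\<exists>q :: real poly. \<forall>x\<in>{a..b}. \<bar>f x - poly q x\<bar> < inverse (real (Suc n))" for n
  proof -
    obtain g where g: "real_polynomial_function g"
      "\<And>x. x \<in> {a..b} \<Longrightarrow> \<bar>f x - g x\<bar> < inverse (real (Suc n))"
      using Stone_Weierstrass_real_polynomial_function[OF compact_Icc assms, of "inverse (real (Suc n))"]
      by auto
    then obtain c k where "g = (\<lambda>x. \<Sum>i\<le>k. c i * x ^ i)"
      using real_polynomial_function_iff_sum by blast
    then have "poly (\<Sum>i\<le>k. monom (c i) i) = g" by (auto simp: poly_sum poly_monom)
    then show ?thesis using g(2) by metis
  qed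
  then obtain q :: "nat \<Rightarrow> real poly"
    where q: "\<And>n x. x \<in> {a..b} \<Longrightarrow> \<bar>f x - poly (q n) x\<bar> < inverse (real (Suc n))"
    by metis
  have "uniform_limit {a..b} (\<lambda>n. poly (q n)) f sequentially"
  proof (rule uniform_limitI)
    fix e :: real assume "e > 0"
    then obtain k where k: "inverse (real (Suc k)) < e" using reals_Archimedean by blast
    have "dist (poly (q n) x) (f x) < e" if "n \<ge> k" "x \<in> {a..b}" for n x
    proof -
      have "inverse (real (Suc n)) \<le> inverse (real (Suc k))" using that by (simp add: field_simps)
      then show ?thesis using q[OF that(2), of n] k unfolding dist_real_def by linarith
    qed
    then show "\<forall>\<^sub>F n in sequentially. \<forall>x\<in>{a..b}. dist (poly (q n) x) (f x) < e"
      using eventually_at_top_linorder by blast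
  qed
  then show ?thesis by blast
qed

lemma op_poly_tendsto_0:
  assumes T: "self_adjoint T" and q: "uniform_limit (real_spectrum T) (\<lambda>n. poly (q n)) (\<lambda>_. 0) sequentially"
  shows "(\<lambda>n. op_poly (q n) T) \<longlonglongrightarrow> 0"
proof (rule tendstoI)
  fix e :: real assume e: "e > 0"
  have "\<forall>\<^sub>F n in sequentially. \<forall>x\<in>real_spectrum T. dist (poly (q n) x) 0 < e/2"
    using q e by (intro uniform_limitD) auto
  then show "\<forall>\<^sub>F n in sequentially. dist (op_poly (q n) T) 0 < e"
  proof eventually_elim
    case (elim n)
    have "norm (op_poly (q n) T) \<le> e/2"
      using elim e by (intro op_poly_norm_le T) (auto simp: less_imp_le)
    then show ?case using e by simp
  qed
qed

text \<open>The definite description in \<open>cfc\<close> singles out one operator only if an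
  approximating sequence exists; Weierstrass on an interval containing the spectrum supplies
  it.\<close>

lemma spectral_approximation:
  assumes "T \<in> bounded_ops" and "continuous_on UNIV f"
  obtains q :: "nat \<Rightarrow> real poly" where "uniform_limit (real_spectrum T) (\<lambda>n. poly (q n)) f sequentially"
  using real_polynomial_approximation[of "- norm T" "norm T" f] assms
    real_spectrum_subset[OF assms(1)] uniform_limit_on_subset continuous_on_subset
  by (metis subset_UNIV)

text \<open>The norm estimate for polynomials makes the images of an approximating sequence Cauchy
  and the limits of any two sequences equal, so the description defining \<open>cfc\<close> denotes
  that limit.\<close>

lemma cfc_tendsto:
  fixes T :: "'a::complex_hilbert op"
  assumes T: "self_adjoint T" and f: "continuous_on UNIV f"
    and q: "uniform_limit (real_spectrum T) (\<lambda>n. poly (q n)) f sequentially"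
  shows "(\<lambda>n. op_poly (q n) T) \<longlonglongrightarrow> cfc f T"
proof -
  obtain q0 :: "nat \<Rightarrow> real poly"
    where q0: "uniform_limit (real_spectrum T) (\<lambda>n. poly (q0 n)) f sequentially"
    using spectral_approximation[OF self_adjointD(1)[OF T] f] .
  have "Cauchy (\<lambda>n. op_poly (q0 n) T)"
  proof (rule metric_CauchyI)
    fix e :: real assume e: "e > 0"
    have "\<forall>\<^sub>F n in sequentially. \<forall>x\<in>real_spectrum T. dist (poly (q0 n) x) (f x) < e/4"
      using q0 e by (intro uniform_limitD) auto
    then obtain k where k: "\<And>n x. n \<ge> k \<Longrightarrow> x \<in> real_spectrum T \<Longrightarrow> \<bar>poly (q0 n) x - f x\<bar> < e/4"
      unfolding eventually_at_top_linorder dist_real_def by blast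
    have "dist (op_poly (q0 m) T) (op_poly (q0 n) T) < e" if "m \<ge> k" "n \<ge> k" for m n
    proof -
      have "norm (op_poly (q0 m - q0 n) T) \<le> e/2"
      proof (rule op_poly_norm_le[OF T])
        fix x assume x: "x \<in> real_spectrum T"
        show "\<bar>poly (q0 m - q0 n) x\<bar> \<le> e/2"
          using k[OF that(1) x] k[OF that(2) x] unfolding poly_diff by linarith
      qed (use e in simp)
      then show ?thesis using e by (simp add: dist_norm op_poly_diff)
    qed
    then show "\<exists>k. \<forall>m\<ge>k. \<forall>n\<ge>k. dist (op_poly (q0 m) T) (op_poly (q0 n) T) < e" by blast
  qed
  then obtain S where S: "(\<lambda>n. op_poly (q0 n) T) \<longlonglongrightarrow> S"
    using Cauchy_convergent convergent_def by blast
  have lim: "(\<lambda>n. op_poly (r n) T) \<longlonglongrightarrow> S"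
    if r: "uniform_limit (real_spectrum T) (\<lambda>n. poly (r n)) f sequentially" for r
  proof -
    have "uniform_limit (real_spectrum T) (\<lambda>n. poly (r n - q0 n)) (\<lambda>_. 0) sequentially"
      using uniform_limit_minus[OF r q0] by (simp add: uniform_limit_iff dist_real_def)
    then have "(\<lambda>n. op_poly (r n - q0 n) T) \<longlonglongrightarrow> 0" by (rule op_poly_tendsto_0[OF T])
    from tendsto_add[OF this S] show ?thesis by (simp add: op_poly_diff)
  qed
  have "cfc f T = S"
    unfolding cfc_def real_spectrum_def[symmetric]
  proof (rule the_equality)
    fix R assume "\<forall>q. uniform_limit (real_spectrum T) (\<lambda>n. poly (q n)) f sequentially \<longrightarrow>
        (\<lambda>n. op_poly (q n) T) \<longlonglongrightarrow> R"
    then show "R = S" using q0 S LIMSEQ_unique by blast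
  qed (use lim in blast)
  with lim[OF q] show ?thesis by simp
qed

lemma cfc_cong:
  assumes "\<And>x. x \<in> real_spectrum T \<Longrightarrow> f x = g x"
  shows "cfc f T = cfc g T"
proof -
  have "uniform_limit (real_spectrum T) (\<lambda>n. poly (q n)) f sequentially \<longleftrightarrow>
      uniform_limit (real_spectrum T) (\<lambda>n. poly (q n)) g sequentially" for q :: "nat \<Rightarrow> real poly"
    using assms by (intro uniform_limit_cong') auto
  then show ?thesis by (simp add: cfc_def real_spectrum_def)
qed

lemma cfc_poly:
  assumes "self_adjoint T"
  shows "cfc (poly q) T = op_poly q T"
proof -
  have "(\<lambda>n :: nat. op_poly q T) \<longlonglongrightarrow> cfc (poly q) T"
    using assms by (intro cfc_tendsto uniform_limit_const continuous_intros) auto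
  then show ?thesis by (simp add: LIMSEQ_const_iff)
qed

lemma cfc_const: "self_adjoint T \<Longrightarrow> cfc (\<lambda>_. c) T = c *\<^sub>R \<one>\<^sub>o"
  using cfc_poly[of T "[:c:]"] cfc_cong[of T "poly [:c:]" "\<lambda>_. c"] by (simp add: op_poly_pCons)

lemma cfc_ident: "self_adjoint T \<Longrightarrow> cfc (\<lambda>x. x) T = T"
  using cfc_poly[of T "[:0, 1:]"] cfc_cong[of T "poly [:0, 1:]" "\<lambda>x. x"] by (simp add: op_poly_pCons)

lemma continuous_bounded_on_spectrum:
  assumes "T \<in> bounded_ops" and "continuous_on UNIV (f :: real \<Rightarrow> real)"
  shows "bounded (f ` real_spectrum T)"
proof (rule bounded_subset)
  show "bounded (f ` {- norm T..norm T})"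
    by (intro compact_imp_bounded compact_continuous_image continuous_on_subset[OF assms(2)]) auto
qed (use real_spectrum_subset[OF assms(1)] in blast)

section \<open>Algebraic rules, norm bounds and composition for the calculus\<close>

lemma cfc_add:
  assumes T: "self_adjoint T" and f: "continuous_on UNIV f" and g: "continuous_on UNIV g"
  shows "cfc (\<lambda>x. f x + g x) T = cfc f T + cfc g T"
proof -
  obtain p q :: "nat \<Rightarrow> real poly"
    where p: "uniform_limit (real_spectrum T) (\<lambda>n. poly (p n)) f sequentially"
      and q: "uniform_limit (real_spectrum T) (\<lambda>n. poly (q n)) g sequentially"
    using spectral_approximation[OF self_adjointD(1)[OF T]] f g by metis
  have "(\<lambda>n. op_poly (p n + q n) T) \<longlonglongrightarrow> cfc (\<lambda>x. f x + g x) T"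
    using uniform_limit_add[OF p q] by (intro cfc_tendsto T continuous_intros f g) (simp add: uniform_limit_iff)
  moreover have "(\<lambda>n. op_poly (p n + q n) T) \<longlonglongrightarrow> cfc f T + cfc g T"
    unfolding op_poly_add by (intro tendsto_add cfc_tendsto T f g p q)
  ultimately show ?thesis using LIMSEQ_unique by blast
qed

lemma cfc_mult:
  assumes T: "self_adjoint T" and f: "continuous_on UNIV f" and g: "continuous_on UNIV g"
  shows "cfc (\<lambda>x. f x * g x) T = cfc f T o\<^sub>L cfc g T"
proof -
  obtain p q :: "nat \<Rightarrow> real poly"
    where p: "uniform_limit (real_spectrum T) (\<lambda>n. poly (p n)) f sequentially"
      and q: "uniform_limit (real_spectrum T) (\<lambda>n. poly (q n)) g sequentially"
    using spectral_approximation[OF self_adjointD(1)[OF T]] f g by metis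
  have "(\<lambda>n. op_poly (p n * q n) T) \<longlonglongrightarrow> cfc (\<lambda>x. f x * g x) T"
    using uniform_lim_mult[OF p q continuous_bounded_on_spectrum continuous_bounded_on_spectrum]
      self_adjointD(1)[OF T] f g
    by (intro cfc_tendsto T continuous_intros f g) (simp add: uniform_limit_iff)
  moreover have "(\<lambda>n. op_poly (p n * q n) T) \<longlonglongrightarrow> (cfc f T o\<^sub>L cfc g T)"
    unfolding op_poly_mult
    by (intro bounded_bilinear.tendsto[OF bounded_bilinear_blinfun_compose] cfc_tendsto T f g p q)
  ultimately show ?thesis using LIMSEQ_unique by blast
qed

lemma cfc_cmult:
  assumes T: "self_adjoint T" and f: "continuous_on UNIV f"
  shows "cfc (\<lambda>x. c * f x) T = c *\<^sub>R cfc f T"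
  using cfc_mult[OF T continuous_on_const f, of c] cfc_const[OF T]
  by (auto intro!: blinfun_eqI simp: blinfun.bilinear_simps)

lemma cfc_diff:
  assumes T: "self_adjoint T" and f: "continuous_on UNIV f" and g: "continuous_on UNIV g"
  shows "cfc (\<lambda>x. f x - g x) T = cfc f T - cfc g T"
proof -
  have "continuous_on UNIV (\<lambda>x. (-1) * g x)" by (intro continuous_intros g)
  then show ?thesis
    using cfc_add[OF T f, of "\<lambda>x. (-1) * g x"] cfc_cmult[OF T g, of "-1"] by simp
qed

lemma cfc_commute:
  assumes T: "self_adjoint T" and f: "continuous_on UNIV f" and S: "S o\<^sub>L T = T o\<^sub>L S"
  shows "S o\<^sub>L cfc f T = cfc f T o\<^sub>L S"
proof -
  obtain q :: "nat \<Rightarrow> real poly"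
    where q: "uniform_limit (real_spectrum T) (\<lambda>n. poly (q n)) f sequentially"
    using spectral_approximation[OF self_adjointD(1)[OF T] f] .
  note lim = cfc_tendsto[OF T f q]
  have "(\<lambda>n. S o\<^sub>L op_poly (q n) T) \<longlonglongrightarrow> (S o\<^sub>L cfc f T)"
    by (intro bounded_bilinear.tendsto[OF bounded_bilinear_blinfun_compose] lim tendsto_const)
  moreover have "(\<lambda>n. S o\<^sub>L op_poly (q n) T) \<longlonglongrightarrow> (cfc f T o\<^sub>L S)"
    unfolding op_poly_commute[OF S]
    by (intro bounded_bilinear.tendsto[OF bounded_bilinear_blinfun_compose] lim tendsto_const)
  ultimately show ?thesis using LIMSEQ_unique by blast
qed

lemma cfc_self_adjoint:
  assumes T: "self_adjoint T" and f: "continuous_on UNIV f"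
  shows "self_adjoint (cfc f T)"
proof -
  obtain q :: "nat \<Rightarrow> real poly"
    where q: "uniform_limit (real_spectrum T) (\<lambda>n. poly (q n)) f sequentially"
    using spectral_approximation[OF self_adjointD(1)[OF T] f] .
  have lim: "(\<lambda>n. blinfun_apply (op_poly (q n) T) x) \<longlonglongrightarrow> blinfun_apply (cfc f T) x" for x
    by (intro blinfun.tendsto cfc_tendsto[OF T f q] tendsto_const)
  note sa = self_adjointD[OF op_poly_self_adjoint[OF T]]
  show ?thesis
  proof (rule self_adjointI)
    show "cfc f T \<in> bounded_ops"
      unfolding bounded_ops_def
    proof safe
      fix c x
      have "(\<lambda>n. c *\<^sub>C blinfun_apply (op_poly (q n) T) x) \<longlonglongrightarrow> c *\<^sub>C blinfun_apply (cfc f T) x"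
        by (intro bounded_linear.tendsto[OF bounded_linear_scaleC] lim)
      then have "(\<lambda>n. blinfun_apply (op_poly (q n) T) (c *\<^sub>C x)) \<longlonglongrightarrow> c *\<^sub>C blinfun_apply (cfc f T) x"
        by (simp add: bounded_opsD[OF sa(1)])
      then show "blinfun_apply (cfc f T) (c *\<^sub>C x) = c *\<^sub>C blinfun_apply (cfc f T) x"
        using lim LIMSEQ_unique by blast
    qed
    fix x y
    have "(\<lambda>n. blinfun_apply (op_poly (q n) T) x \<bullet> y) \<longlonglongrightarrow> blinfun_apply (cfc f T) x \<bullet> y"
      by (intro tendsto_intros lim)
    moreover have "(\<lambda>n. blinfun_apply (op_poly (q n) T) x \<bullet> y) \<longlonglongrightarrow> x \<bullet> blinfun_apply (cfc f T) y"
      unfolding sa(3) by (intro tendsto_intros lim)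
    ultimately show "blinfun_apply (cfc f T) x \<bullet> y = x \<bullet> blinfun_apply (cfc f T) y"
      using LIMSEQ_unique by blast
  qed
qed

lemma cfc_norm_le:
  assumes T: "self_adjoint T" and f: "continuous_on UNIV f"
    and M: "\<And>x. x \<in> real_spectrum T \<Longrightarrow> \<bar>f x\<bar> \<le> M" "0 \<le> M"
  shows "norm (cfc f T) \<le> M"
proof (rule field_le_epsilon)
  fix e :: real assume e: "e > 0"
  obtain q :: "nat \<Rightarrow> real poly"
    where q: "uniform_limit (real_spectrum T) (\<lambda>n. poly (q n)) f sequentially"
    using spectral_approximation[OF self_adjointD(1)[OF T] f] .
  have "\<forall>\<^sub>F n in sequentially. \<forall>x\<in>real_spectrum T. dist (poly (q n) x) (f x) < e"
    using q e by (rule uniform_limitD)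
  then have "\<forall>\<^sub>F n in sequentially. norm (op_poly (q n) T) \<le> M + e"
  proof eventually_elim
    case (elim n)
    show ?case
    proof (rule op_poly_norm_le[OF T])
      fix x assume "x \<in> real_spectrum T"
      then show "\<bar>poly (q n) x\<bar> \<le> M + e" using elim M(1)[of x] by (fastforce simp: dist_real_def)
    qed (use e M in simp)
  qed
  then show "norm (cfc f T) \<le> M + e"
    using tendsto_norm[OF cfc_tendsto[OF T f q]] by (intro tendsto_upperbound) auto
qed

text \<open>Together with the upper bound this makes the calculus isometric for the supremum over
  the spectrum; in particular \<open>cfc f T = 0\<close> forces f to vanish there.\<close>

lemma cfc_norm_ge:
  assumes T: "self_adjoint T" and f: "continuous_on UNIV f" and x: "x \<in> real_spectrum T"
  shows "\<bar>f x\<bar> \<le> norm (cfc f T)"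
proof -
  obtain q :: "nat \<Rightarrow> real poly"
    where q: "uniform_limit (real_spectrum T) (\<lambda>n. poly (q n)) f sequentially"
    using spectral_approximation[OF self_adjointD(1)[OF T] f] .
  have "(\<lambda>n. \<bar>poly (q n) x\<bar>) \<longlonglongrightarrow> \<bar>f x\<bar>"
    by (intro tendsto_rabs tendsto_uniform_limitI[OF q x])
  then show ?thesis
    using tendsto_norm[OF cfc_tendsto[OF T f q]] op_poly_norm_ge[OF self_adjointD(1)[OF T] x]
    by (intro LIMSEQ_le) auto
qed

lemma op_poly_cfc:
  assumes T: "self_adjoint T" and g: "continuous_on UNIV g"
  shows "op_poly p (cfc g T) = cfc (\<lambda>x. poly p (g x)) T"
proof (induction p)
  case 0
  then show ?case using cfc_const[OF T, of 0] by simp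
next
  case (pCons a p)
  have c: "continuous_on UNIV (\<lambda>x. poly p (g x))" by (intro continuous_intros g)
  have "cfc (\<lambda>x. a + g x * poly p (g x)) T = cfc (\<lambda>_. a) T + (cfc g T o\<^sub>L cfc (\<lambda>x. poly p (g x)) T)"
    by (subst cfc_add; (intro T continuous_intros c g)?) (simp add: cfc_mult T g c)
  then show ?case using pCons by (simp add: op_poly_pCons cfc_const[OF T])
qed

text \<open>One interval [-M, M] contains both the spectrum of g(T) and the values of g on the
  spectrum of T, so a single polynomial sequence approximates f for both sides.\<close>

lemma cfc_compose:
  assumes T: "self_adjoint T" and f: "continuous_on UNIV f" and g: "continuous_on UNIV g"
  shows "cfc f (cfc g T) = cfc (\<lambda>x. f (g x)) T"
proof -
  obtain M0 where M0: "\<And>x. x \<in> real_spectrum T \<Longrightarrow> \<bar>g x\<bar> \<le> M0"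
    using continuous_bounded_on_spectrum[OF self_adjointD(1)[OF T] g] by (auto simp: bounded_iff)
  define M where "M = max M0 (norm (cfc g T))"
  have fg: "continuous_on UNIV (\<lambda>x. f (g x))"
    using continuous_on_compose2[OF f g] by simp
  obtain q :: "nat \<Rightarrow> real poly" where q: "uniform_limit {-M..M} (\<lambda>n. poly (q n)) f sequentially"
    using real_polynomial_approximation continuous_on_subset[OF f] by blast
  note sg = cfc_self_adjoint[OF T g]
  have "real_spectrum (cfc g T) \<subseteq> {-M..M}"
    using real_spectrum_subset[OF self_adjointD(1)[OF sg]] by (force simp: M_def)
  then have 1: "(\<lambda>n. op_poly (q n) (cfc g T)) \<longlonglongrightarrow> cfc f (cfc g T)"
    by (intro cfc_tendsto sg f uniform_limit_on_subset[OF q])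
  have "(\<lambda>n. op_poly (q n) (cfc g T)) \<longlonglongrightarrow> cfc (\<lambda>x. f (g x)) T"
  proof (rule tendstoI)
    fix e :: real assume e: "e > 0"
    have "\<forall>\<^sub>F n in sequentially. \<forall>x\<in>{-M..M}. dist (poly (q n) x) (f x) < e/2"
      using q e by (intro uniform_limitD) auto
    then show "\<forall>\<^sub>F n in sequentially. dist (op_poly (q n) (cfc g T)) (cfc (\<lambda>x. f (g x)) T) < e"
    proof eventually_elim
      case (elim n)
      have c: "continuous_on UNIV (\<lambda>x. poly (q n) (g x))" by (intro continuous_intros g)
      have "norm (cfc (\<lambda>x. poly (q n) (g x) - f (g x)) T) \<le> e/2"
      proof (rule cfc_norm_le[OF T])
        fix x assume "x \<in> real_spectrum T"
        then have "g x \<in> {-M..M}" using M0[of x] by (auto simp: M_def abs_le_iff)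
        then show "\<bar>poly (q n) (g x) - f (g x)\<bar> \<le> e/2"
          using elim by (fastforce simp: dist_real_def)
      qed (use e in \<open>auto intro!: continuous_intros c fg\<close>)
      then show ?case using e by (simp add: op_poly_cfc[OF T g] dist_norm cfc_diff[OF T c fg])
    qed
  qed
  with 1 show ?thesis using LIMSEQ_unique by blast
qed

text \<open>P reduces A and B, so a polynomial of D acts blockwise, as that of A on the range of P
  and that of B on its complement; limits inherit this.\<close>

lemma cfc_direct_sum:
  fixes A B P :: "'a::complex_hilbert op"
  assumes A: "self_adjoint A" and B: "self_adjoint B" and f: "continuous_on UNIV f"
    and P: "P \<in> bounded_ops" "adj P = P" "P o\<^sub>L P = P" "P o\<^sub>L A = A o\<^sub>L P" "P o\<^sub>L B = B o\<^sub>L P"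
  defines "D \<equiv> (A o\<^sub>L P) + (B o\<^sub>L (\<one>\<^sub>o - P))"
  shows "cfc f D = (cfc f A o\<^sub>L P) + (cfc f B o\<^sub>L (\<one>\<^sub>o - P))"
proof -
  have Px: "P (P x) = P x" "P (A x) = A (P x)" "P (B x) = B (P x)" for x
    using P(3-5) by (metis blinfun_apply_blinfun_compose)+
  have sP: "self_adjoint P" "self_adjoint (\<one>\<^sub>o - P)"
    using P by (auto simp: self_adjoint_def adj_simps)
  have sD: "self_adjoint D"
    unfolding D_def
    by (intro self_adjoint_add self_adjoint_compose A B sP)
      (auto intro!: blinfun_eqI simp: Px blinfun.bilinear_simps)
  have poly: "op_poly p D = (op_poly p A o\<^sub>L P) + (op_poly p B o\<^sub>L (\<one>\<^sub>o - P))" for p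
  proof (induction p)
    case (pCons a p)
    have "P (op_poly p A x) = op_poly p A (P x)" "P (op_poly p B x) = op_poly p B (P x)" for x
      using op_poly_commute[OF P(4), of p] op_poly_commute[OF P(5), of p]
      by (metis blinfun_apply_blinfun_compose)+
    then show ?case
      using pCons
      by (auto intro!: blinfun_eqI simp: op_poly_pCons D_def Px blinfun.bilinear_simps algebra_simps)
  qed simp
  \<comment> \<open>Large enough for one polynomial sequence to approximate f on all three
    spectra.\<close>
  define M where "M = max (norm D) (max (norm A) (norm B))"
  obtain q :: "nat \<Rightarrow> real poly" where q: "uniform_limit {-M..M} (\<lambda>n. poly (q n)) f sequentially"
    using real_polynomial_approximation continuous_on_subset[OF f] by blast
  have lim: "(\<lambda>n. op_poly (q n) T) \<longlonglongrightarrow> cfc f T" if "self_adjoint T" "norm T \<le> M" for T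
    using real_spectrum_subset[OF self_adjointD(1)[OF that(1)]] that
    by (intro cfc_tendsto f uniform_limit_on_subset[OF q]) auto
  have "(\<lambda>n. op_poly (q n) D) \<longlonglongrightarrow> (cfc f A o\<^sub>L P) + (cfc f B o\<^sub>L (\<one>\<^sub>o - P))"
    unfolding poly
    by (intro tendsto_intros bounded_bilinear.tendsto[OF bounded_bilinear_blinfun_compose] lim A B)
      (auto simp: M_def)
  moreover have "(\<lambda>n. op_poly (q n) D) \<longlonglongrightarrow> cfc f D"
    by (intro lim sD) (simp add: M_def)
  ultimately show ?thesis using LIMSEQ_unique by blast
qed

section \<open>Powers of the absolute value\<close>

lemma real_powr_even: "\<bar>x\<bar> powr p = x powr (p::real)"
  by (simp add: abs_if uminus_powr_eq)

text \<open>Evenness of \<open>powr\<close> in a real base gives continuity on the whole line, which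
  is the form of continuity the rules of the calculus ask for.\<close>

lemma continuous_real_powr:
  assumes "0 < (p::real)"
  shows "continuous_on UNIV (\<lambda>x::real. x powr p)"
proof -
  have "continuous_on UNIV (\<lambda>x::real. \<bar>x\<bar> powr p)"
    using assms by (intro continuous_on_powr' continuous_intros) auto
  then show ?thesis by (simp add: real_powr_even)
qed

text \<open>Two nested calculi collapse into one. The underlying identity of functions holds at
  negative arguments too, because \<open>sqrt\<close> is odd and \<open>powr\<close> is
  even.\<close>

lemma op_powr_op_abs:
  fixes A :: "'a::complex_hilbert op"
  assumes A: "A \<in> bounded_ops" and p: "0 < p"
  shows "op_powr (op_abs A) p = cfc (\<lambda>x. x powr (p / 2)) (adj A o\<^sub>L A)"
proof -
  have "(sqrt x) powr p = x powr (p / 2)" for x :: real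
  proof -
    have "(sqrt x) powr p = \<bar>sqrt x\<bar> powr p" by (simp add: real_powr_even)
    also have "\<dots> = sqrt \<bar>x\<bar> powr p" by (simp add: real_sqrt_abs2 abs_if real_sqrt_minus)
    also have "\<dots> = (\<bar>x\<bar> powr (1/2)) powr p" by (simp add: powr_half_sqrt)
    also have "\<dots> = x powr (p / 2)" by (simp add: powr_powr real_powr_even)
    finally show ?thesis .
  qed
  then show ?thesis
    unfolding op_powr_def op_abs_def
    using cfc_compose[OF self_adjoint_adj_compose[OF A] continuous_real_powr[OF p], of sqrt]
    by (simp add: continuous_intros)
qed

section \<open>Projections and partial isometries in a von Neumann algebra\<close>

lemma compose_apply: "A o\<^sub>L B = C \<Longrightarrow> blinfun_apply A (blinfun_apply B x) = blinfun_apply C x"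
  by (metis blinfun_apply_blinfun_compose)

locale von_neumann =
  fixes N :: "'a::complex_hilbert op set"
  assumes vN: "von_neumann_algebra N"
begin

lemma in_bounded: "A \<in> N \<Longrightarrow> A \<in> bounded_ops"
  using vN by (auto simp: von_neumann_algebra_def)

lemma adj_closed: "A \<in> N \<Longrightarrow> adj A \<in> N"
  using vN by (auto simp: von_neumann_algebra_def)

lemma memI:
  assumes "T \<in> bounded_ops" "\<And>B. B \<in> commutant N \<Longrightarrow> B o\<^sub>L T = T o\<^sub>L B"
  shows "T \<in> N"
proof -
  have "T \<in> commutant (commutant N)" using assms by (simp add: commutant_def[of "commutant N"])
  then show ?thesis using vN by (simp add: von_neumann_algebra_def)
qed

lemma commutantD:
  assumes "B \<in> commutant N"
  shows "B \<in> bounded_ops" "A \<in> N \<Longrightarrow> A o\<^sub>L B = B o\<^sub>L A"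
  using assms by (auto simp: commutant_def)

lemma commutant_apply: "B \<in> commutant N \<Longrightarrow> A \<in> N \<Longrightarrow> A (B x) = B (A x)"
  using commutantD(2) by (metis blinfun_apply_blinfun_compose)

lemma commutant_adj:
  assumes B: "B \<in> commutant N"
  shows "adj B \<in> commutant N"
proof -
  have "A o\<^sub>L adj B = adj B o\<^sub>L A" if A: "A \<in> N" for A
  proof -
    have "adj (B o\<^sub>L adj A) = adj (adj A o\<^sub>L B)"
      using commutantD(2)[OF B adj_closed[OF A]] by simp
    then show ?thesis
      using A B by (simp add: adj_simps in_bounded commutantD)
  qed
  then show ?thesis using commutantD(1)[OF B] by (simp add: commutant_def adj_bounded_ops)
qed

lemma id_closed: "\<one>\<^sub>o \<in> N"
  and zero_closed: "0 \<in> N"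
  and add_closed: "A \<in> N \<Longrightarrow> C \<in> N \<Longrightarrow> A + C \<in> N"
  and diff_closed: "A \<in> N \<Longrightarrow> C \<in> N \<Longrightarrow> A - C \<in> N"
  and compose_closed: "A \<in> N \<Longrightarrow> C \<in> N \<Longrightarrow> A o\<^sub>L C \<in> N"
  and scaleC_closed: "A \<in> N \<Longrightarrow> c *\<^sub>o A \<in> N"
  and scaleR_closed: "A \<in> N \<Longrightarrow> r *\<^sub>R A \<in> N"
  by (rule memI; (intro bounded_ops_intros in_bounded)?;
      auto intro!: blinfun_eqI simp: blinfun.bilinear_simps commutant_apply
        bounded_opsD[OF commutantD(1)])+

lemmas closed = id_closed zero_closed add_closed diff_closed compose_closed scaleC_closed
  scaleR_closed adj_closed

lemma cfc_closed:
  assumes "T \<in> N" "self_adjoint T" "continuous_on UNIV f"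
  shows "cfc f T \<in> N"
proof (rule memI)
  show "cfc f T \<in> bounded_ops" using cfc_self_adjoint assms self_adjointD by blast
  show "B o\<^sub>L cfc f T = cfc f T o\<^sub>L B" if "B \<in> commutant N" for B
    using cfc_commute[OF assms(2,3)] commutantD(2)[OF that assms(1)] by metis
qed

lemma projectionD:
  assumes "P \<in> projections N"
  shows "P \<in> N" "adj P = P" "P o\<^sub>L P = P" "self_adjoint P" "P (P x) = P x" "P x \<bullet> y = x \<bullet> P y"
proof -
  show P: "P \<in> N" "adj P = P" "P o\<^sub>L P = P" using assms by (auto simp: projections_def)
  show sa: "self_adjoint P" using P in_bounded by (simp add: self_adjoint_def)
  show "P (P x) = P x" using P(3) by (rule compose_apply)
  show "P x \<bullet> y = x \<bullet> P y" using sa by (rule self_adjointD)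
qed

lemma projectionI:
  assumes "P \<in> N" "adj P = P" "\<And>x. P (P x) = P x"
  shows "P \<in> projections N"
  using assms by (auto simp: projections_def intro!: blinfun_eqI)

lemma complement_projection:
  assumes "P \<in> projections N"
  shows "\<one>\<^sub>o - P \<in> projections N"
  using projectionD[OF assms]
  by (intro projectionI) (auto simp: adj_simps closed in_bounded blinfun.bilinear_simps)

lemma subprojection_sym:
  assumes P: "P \<in> projections N" and Q: "Q \<in> projections N" and "P o\<^sub>L Q = Q"
  shows "Q o\<^sub>L P = Q"
proof -
  have "adj (P o\<^sub>L Q) = adj Q" using assms(3) by simp
  then show ?thesis using projectionD[OF P] projectionD[OF Q] by (simp add: adj_simps in_bounded)
qed

lemma diff_projection:
  assumes P: "P \<in> projections N" and Q: "Q \<in> projections N" and "P o\<^sub>L Q = Q"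
  shows "P - Q \<in> projections N"
  using projectionD[OF P] projectionD[OF Q] compose_apply[OF assms(3)]
    compose_apply[OF subprojection_sym[OF assms]]
  by (intro projectionI) (auto simp: adj_simps closed in_bounded blinfun.bilinear_simps)

text \<open>E is the complement of the projection onto the kernel of K. That kernel is invariant
  under the commutant, and under whatever commutes, along with its adjoint, with K; hence membership
  in N and the last clause.\<close>

lemma support_projection:
  assumes K: "K \<in> N" "self_adjoint K"
  obtains E where "E \<in> projections N" "K o\<^sub>L E = K" "E o\<^sub>L K = K"
    "\<And>L :: 'a op. K o\<^sub>L L = 0 \<Longrightarrow> E o\<^sub>L L = 0"
    "\<And>S. S \<in> N \<Longrightarrow> S o\<^sub>L K = K o\<^sub>L S \<Longrightarrow> adj S o\<^sub>L K = K o\<^sub>L adj S \<Longrightarrow> S o\<^sub>L E = E o\<^sub>L S"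
proof -
  define M where "M = {x. K x = 0}"
  note Kb = in_bounded[OF K(1)]
  have "subspace M" by (auto simp: M_def subspace_def blinfun.bilinear_simps)
  moreover have "closed M" unfolding M_def by (intro closed_Collect_eq continuous_intros)
  moreover have "c *\<^sub>C x \<in> M" if "x \<in> M" for c x
    using that by (simp add: M_def bounded_opsD[OF Kb])
  ultimately obtain P :: "'a op" where P: "P \<in> bounded_ops" "adj P = P" "P o\<^sub>L P = P"
    "\<And>x. P x \<in> M" "\<And>x. x \<in> M \<Longrightarrow> P x = x"
    "\<And>T. T \<in> bounded_ops \<Longrightarrow> (\<And>x. x \<in> M \<Longrightarrow> blinfun_apply T x \<in> M) \<Longrightarrow>
      (\<And>x. x \<in> M \<Longrightarrow> blinfun_apply (adj T) x \<in> M) \<Longrightarrow> T o\<^sub>L P = P o\<^sub>L T"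
    using exists_projection_onto[of M] by metis
  have comm: "S o\<^sub>L P = P o\<^sub>L S"
    if S: "S \<in> bounded_ops" "S o\<^sub>L K = K o\<^sub>L S" "adj S o\<^sub>L K = K o\<^sub>L adj S" for S
  proof (rule P(6)[OF S(1)])
    show "S x \<in> M" "adj S x \<in> M" if "x \<in> M" for x
      using that S(2,3)[THEN arg_cong, of "\<lambda>T. blinfun_apply T x"] by (auto simp: M_def blinfun.bilinear_simps)
  qed
  have PN: "P \<in> N"
  proof (rule memI[OF P(1)])
    fix B assume B: "B \<in> commutant N"
    show "B o\<^sub>L P = P o\<^sub>L B"
      using comm commutantD[OF B] commutantD[OF commutant_adj[OF B]] K(1) by metis
  qed
  then have Pp: "P \<in> projections N" using P(2,3) by (simp add: projections_def)
  have KP: "K (P x) = 0" for x using P(4) by (simp add: M_def)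
  show ?thesis
  proof (rule that[of "\<one>\<^sub>o - P"])
    show "\<one>\<^sub>o - P \<in> projections N" by (rule complement_projection[OF Pp])
    show KE: "K o\<^sub>L (\<one>\<^sub>o - P) = K" by (rule blinfun_eqI) (simp add: blinfun.bilinear_simps KP)
    have "adj (K o\<^sub>L (\<one>\<^sub>o - P)) = adj K" by (simp only: KE)
    then show "(\<one>\<^sub>o - P) o\<^sub>L K = K"
      using Kb P(1,2) self_adjointD(2)[OF K(2)] by (simp add: adj_simps)
    show "(\<one>\<^sub>o - P) o\<^sub>L L = 0" if "K o\<^sub>L L = 0" for L :: "'a op"
    proof (rule blinfun_eqI)
      fix x
      have "L x \<in> M" using compose_apply[OF that, of x] by (simp add: M_def)
      then show "blinfun_apply ((\<one>\<^sub>o - P) o\<^sub>L L) x = blinfun_apply 0 x"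
        using P(5) by (simp add: blinfun.bilinear_simps)
    qed
    show "S o\<^sub>L (\<one>\<^sub>o - P) = (\<one>\<^sub>o - P) o\<^sub>L S"
      if "S \<in> N" "S o\<^sub>L K = K o\<^sub>L S" "adj S o\<^sub>L K = K o\<^sub>L adj S" for S
      using comm[OF in_bounded[OF that(1)] that(2,3), THEN compose_apply]
      by (auto intro!: blinfun_eqI simp: blinfun.bilinear_simps)
  qed
qed

text \<open>E stands in for the spectral projection of K above \<epsilon>: it is the support of the
  positive part of K - \<epsilon>, and the last clause turns annihilation by that positive part into
  annihilation by E.\<close>

lemma spectral_cut:
  assumes K: "K \<in> N" "self_adjoint K" "\<And>x. 0 \<le> K x \<bullet> x" "K \<noteq> 0"
  obtains \<epsilon> E where "0 < \<epsilon>" "E \<in> projections N" "E \<noteq> 0" "E o\<^sub>L K = K o\<^sub>L E"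
    "cfc (\<lambda>t. max (t - \<epsilon>) 0) K o\<^sub>L E = cfc (\<lambda>t. max (t - \<epsilon>) 0) K"
    "\<And>L :: 'a op. cfc (\<lambda>t. max (t - \<epsilon>) 0) K o\<^sub>L L = 0 \<Longrightarrow> E o\<^sub>L L = 0"
proof -
  \<comment> \<open>Any number strictly between 0 and the norm would do: a positive K has its norm
    as a spectral point, where the truncated function is then nonzero.\<close>
  define \<epsilon> where "\<epsilon> = norm K / 2"
  define f where "f = (\<lambda>t. max (t - \<epsilon>) 0)"
  have f: "continuous_on UNIV f" unfolding f_def by (intro continuous_intros)
  have \<epsilon>: "\<epsilon> > 0" using K by (simp add: \<epsilon>_def)
  obtain E where E: "E \<in> projections N" "cfc f K o\<^sub>L E = cfc f K"
    "\<And>L :: 'a op. cfc f K o\<^sub>L L = 0 \<Longrightarrow> E o\<^sub>L L = 0"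
    "\<And>S. S \<in> N \<Longrightarrow> S o\<^sub>L cfc f K = cfc f K o\<^sub>L S \<Longrightarrow> adj S o\<^sub>L cfc f K = cfc f K o\<^sub>L adj S \<Longrightarrow>
      S o\<^sub>L E = E o\<^sub>L S"
    using support_projection[OF cfc_closed[OF K(1,2) f] cfc_self_adjoint[OF K(2) f]] by metis
  have lin: "op_poly [:0, 1:] K = K" by (simp add: op_poly_pCons)
  obtain x where x: "x \<in> real_spectrum K" "\<bar>x\<bar> = norm K"
    using op_poly_norm_attained[OF K(2), of "[:0, 1:]"] K(4) by (auto simp: lin)
  have "0 \<le> x" using real_spectrum_nonneg[OF K(3) x(1)] .
  then have "f x > 0" using x \<epsilon> by (simp add: f_def \<epsilon>_def)
  then have "cfc f K \<noteq> 0" using cfc_norm_ge[OF K(2) f x(1)] by auto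
  then have "E \<noteq> 0" using E(2) by auto
  moreover have "E o\<^sub>L K = K o\<^sub>L E"
    using E(4)[OF K(1)] cfc_commute[OF K(2) f, of K] self_adjointD(2)[OF K(2)] by simp
  ultimately show ?thesis
    using E(2,3) unfolding f_def by (intro that[OF \<epsilon> E(1)])
qed

section \<open>Partial isometries and their weak sums\<close>

definition partial_isometry :: "'a op \<Rightarrow> bool"
  where "partial_isometry V \<longleftrightarrow> V \<in> N \<and> V o\<^sub>L (adj V o\<^sub>L V) = V"

lemma partial_isometryD:
  assumes "partial_isometry V"
  shows "V \<in> N" "V (adj V (V x)) = V x" "adj V (V (adj V x)) = adj V x"
    "adj V o\<^sub>L V \<in> projections N" "V o\<^sub>L adj V \<in> projections N"
proof -
  show V: "V \<in> N" using assms by (simp add: partial_isometry_def)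
  have VV: "V o\<^sub>L (adj V o\<^sub>L V) = V" using assms by (simp add: partial_isometry_def)
  then have "adj (V o\<^sub>L (adj V o\<^sub>L V)) = adj V" by simp
  then have VV': "(adj V o\<^sub>L V) o\<^sub>L adj V = adj V" using V by (simp add: adj_simps in_bounded)
  show 1: "V (adj V (V x)) = V x" for x using compose_apply[OF VV] by simp
  show 2: "adj V (V (adj V x)) = adj V x" for x using compose_apply[OF VV'] by simp
  show "adj V o\<^sub>L V \<in> projections N" "V o\<^sub>L adj V \<in> projections N"
    using V 1 2 by (auto intro!: projectionI simp: closed adj_simps in_bounded)
qed

text \<open>A truncated polar decomposition: with \<open>K = T\<^sup>*T\<close> and \<open>E\<close> the support of \<open>max (K - \<epsilon>) 0\<close>, the
  continuous function \<open>1 / sqrt (max t \<epsilon>)\<close> inverts \<open>|T|\<close> on the range of \<open>E\<close>.\<close>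

lemma partial_isometry_exists:
  assumes T: "T \<in> N" "T \<noteq> 0"
  obtains V where "partial_isometry V" "V \<noteq> 0"
    "\<And>S. S o\<^sub>L T = T \<Longrightarrow> S o\<^sub>L V = V" "\<And>S. T o\<^sub>L S = T \<Longrightarrow> V o\<^sub>L S = V"
proof -
  note Tb = in_bounded[OF T(1)]
  define K where "K = adj T o\<^sub>L T"
  have K: "K \<in> N" "self_adjoint K" "K \<noteq> 0" "0 \<le> K x \<bullet> x" for x
    using T Tb adj_compose_self_eq_0[OF Tb]
    by (auto simp: K_def closed self_adjoint_adj_compose adj_inner')
  obtain \<epsilon> E where \<epsilon>: "0 < \<epsilon>" and E: "E \<in> projections N" "E \<noteq> 0" "E o\<^sub>L K = K o\<^sub>L E"
    "\<And>L :: 'a op. cfc (\<lambda>t. max (t - \<epsilon>) 0) K o\<^sub>L L = 0 \<Longrightarrow> E o\<^sub>L L = 0"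
    using spectral_cut[OF K(1,2,4,3)] by metis
  note Ep = projectionD[OF E(1)]
  define f where "f = (\<lambda>t. 1 / sqrt (max t \<epsilon>))"
  have f: "continuous_on UNIV f"
    unfolding f_def using \<epsilon> by (intro continuous_intros) (auto simp: max_def)
  \<comment> \<open>h is 1 from \<epsilon> upwards, so h(K) acts as the identity under E; the
    product of \<open>adj V\<close> and V reduces to it.\<close>
  define h where "h = (\<lambda>t. t * (f t * f t))"
  have h: "continuous_on UNIV h" unfolding h_def by (intro continuous_intros f)
  have hval: "h t = t / max t \<epsilon>" for t
    using \<epsilon> by (simp add: h_def f_def field_simps real_sqrt_mult_self abs_of_pos max_def)
  have pos: "continuous_on UNIV (\<lambda>t. max (t - \<epsilon>) 0)" by (intro continuous_intros)
  have hK: "cfc h K = K o\<^sub>L (cfc f K o\<^sub>L cfc f K)"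
    unfolding h_def
    by (subst cfc_mult; (intro K continuous_intros f)?) (simp add: cfc_mult cfc_ident K f)
  have Eh: "E o\<^sub>L cfc h K = E"
  proof -
    have "cfc (\<lambda>t. max (t - \<epsilon>) 0) K o\<^sub>L cfc (\<lambda>t. 1 - h t) K = cfc (\<lambda>t. max (t - \<epsilon>) 0 * (1 - h t)) K"
      by (rule cfc_mult[symmetric]) (intro K continuous_intros h)+
    also have "(\<lambda>t. max (t - \<epsilon>) 0 * (1 - h t)) = (\<lambda>_. 0)"
      using \<epsilon> by (auto simp: hval max_def fun_eq_iff)
    finally have "E o\<^sub>L cfc (\<lambda>t. 1 - h t) K = 0"
      using cfc_const[OF K(2), of 0] by (intro E(4)) simp
    moreover have "cfc (\<lambda>t. 1 - h t) K = \<one>\<^sub>o - cfc h K"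
      by (subst cfc_diff) (auto intro!: K continuous_intros h simp: cfc_const K)
    ultimately have "E o\<^sub>L (\<one>\<^sub>o - cfc h K) = 0" by simp
    from compose_apply[OF this] show ?thesis
      by (intro blinfun_eqI) (simp add: blinfun.bilinear_simps)
  qed
  define V where "V = T o\<^sub>L (cfc f K o\<^sub>L E)"
  have fN: "cfc f K \<in> N" "adj (cfc f K) = cfc f K"
    using cfc_closed[OF K(1,2) f] cfc_self_adjoint[OF K(2) f] by (auto simp: self_adjoint_def)
  have VN: "V \<in> N" unfolding V_def by (intro closed T fN Ep)
  have fK: "K (cfc f K x) = cfc f K (K x)" for x
    using cfc_commute[OF K(2) f, of K] by (metis blinfun_apply_blinfun_compose)
  have VV: "adj V o\<^sub>L V = E"
  proof (rule blinfun_eqI)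
    fix x
    have "adj V = E o\<^sub>L (cfc f K o\<^sub>L adj T)"
      unfolding V_def using fN Ep(1,2) Tb
      by (auto intro!: blinfun_eqI simp: adj_simps in_bounded)
    then have "(adj V o\<^sub>L V) x = E (cfc f K (K (cfc f K (E x))))"
      by (simp add: V_def K_def)
    also have "\<dots> = E (cfc h K (E x))" by (simp add: hK fK)
    also have "\<dots> = E x" using compose_apply[OF Eh] Ep(5) by simp
    finally show "(adj V o\<^sub>L V) x = E x" .
  qed
  have VE: "V o\<^sub>L E = V" unfolding V_def by (rule blinfun_eqI) (simp add: Ep)
  show ?thesis
  proof (rule that[of V])
    show "partial_isometry V" using VN VV VE by (simp add: partial_isometry_def)
    show "V \<noteq> 0" using VV E(2) by auto
    show "S o\<^sub>L V = V" if "S o\<^sub>L T = T" for S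
      unfolding V_def by (rule blinfun_eqI) (simp add: compose_apply[OF that])
    fix S assume S: "T o\<^sub>L S = T"
    \<comment> \<open>Divides the truncated function by t continuously, so the relation T S = T
      passes to the positive part of K - \<epsilon> and from there to its support E.\<close>
    define k where "k = (\<lambda>t. max (t - \<epsilon>) 0 / max t \<epsilon>)"
    have k: "continuous_on UNIV k"
      unfolding k_def using \<epsilon> by (intro continuous_intros) (auto simp: max_def)
    have "max (t - \<epsilon>) 0 = k t * t" for t using \<epsilon> by (auto simp: k_def max_def)
    then have "cfc (\<lambda>t. max (t - \<epsilon>) 0) K = cfc k K o\<^sub>L K"
      using cfc_mult[OF K(2) k continuous_on_id] by (simp add: cfc_ident K id_def)
    then have "cfc (\<lambda>t. max (t - \<epsilon>) 0) K o\<^sub>L (\<one>\<^sub>o - S) = 0"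
      using compose_apply[OF S] by (auto intro!: blinfun_eqI simp: K_def blinfun.bilinear_simps)
    then have "E o\<^sub>L (\<one>\<^sub>o - S) = 0" by (rule E(4))
    from compose_apply[OF this] have "E (S x) = E x" for x by (simp add: blinfun.bilinear_simps)
    then show "V o\<^sub>L S = V" unfolding V_def by (intro blinfun_eqI) simp
  qed
qed

lemma partial_isometry_adj:
  assumes "partial_isometry V"
  shows "partial_isometry (adj V)"
  using partial_isometryD[OF assms]
  by (auto intro!: blinfun_eqI simp: partial_isometry_def closed adj_simps in_bounded)

text \<open>The vectors \<open>adj (V i) (V i x)\<close> are pairwise orthogonal; s is their sum,
  and expanding the squared norm of x - s gives the bound.\<close>

lemma partial_isometry_Bessel:
  fixes V :: "'i \<Rightarrow> 'a op"
  assumes F: "finite F" and V: "\<And>i. i \<in> F \<Longrightarrow> partial_isometry (V i)"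
    and orth: "\<And>i j. i \<in> F \<Longrightarrow> j \<in> F \<Longrightarrow> i \<noteq> j \<Longrightarrow> V i o\<^sub>L adj (V j) = 0"
  shows "(\<Sum>i\<in>F. (norm (V i x))\<^sup>2) \<le> (norm x)\<^sup>2"
proof -
  define s where "s = (\<Sum>i\<in>F. adj (V i) (V i x))"
  note b = in_bounded[OF partial_isometryD(1)[OF V]]
  have inner_ij: "adj (V i) (V i x) \<bullet> adj (V j) (V j x) = (if i = j then (norm (V i x))\<^sup>2 else 0)"
    if "i \<in> F" "j \<in> F" for i j
  proof (cases "i = j")
    case True
    then show ?thesis
      using partial_isometryD(2)[OF V[OF that(1)]] adj_inner'[OF b[OF that(1)]]
      by (simp add: power2_norm_eq_inner)
  next
    case False
    then show ?thesis
      using compose_apply[OF orth[OF that]] adj_inner'[OF b[OF that(1)]] by simp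
  qed
  have "s \<bullet> s = (\<Sum>i\<in>F. \<Sum>j\<in>F. if i = j then (norm (V i x))\<^sup>2 else 0)"
    unfolding s_def inner_sum_left inner_sum_right by (intro sum.cong refl) (auto simp: inner_ij)
  also have "\<dots> = (\<Sum>i\<in>F. (norm (V i x))\<^sup>2)" using F by simp
  finally have ss: "s \<bullet> s = (\<Sum>i\<in>F. (norm (V i x))\<^sup>2)" .
  have "s \<bullet> x = (\<Sum>i\<in>F. (norm (V i x))\<^sup>2)"
    unfolding s_def inner_sum_left
    by (intro sum.cong refl) (simp add: adj_inner' b power2_norm_eq_inner)
  moreover have "0 \<le> (norm (x - s))\<^sup>2" by simp
  ultimately show ?thesis
    using ss by (simp add: power2_norm_eq_inner inner_diff_left inner_diff_right inner_commute)
qed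

text \<open>W exists weakly: Cauchy-Schwarz with Bessel, for the V i and for their adjoints, yields
  a bounded bilinear form. On the initial space of V i, W sees a single term, and so does
  \<open>adj W\<close> on the final space.\<close>

lemma partial_isometry_sum:
  fixes V :: "'i \<Rightarrow> 'a op"
  assumes V: "\<And>i. i \<in> I \<Longrightarrow> partial_isometry (V i)"
    and orth: "\<And>i j. i \<in> I \<Longrightarrow> j \<in> I \<Longrightarrow> i \<noteq> j \<Longrightarrow> adj (V i) o\<^sub>L V j = 0"
      "\<And>i j. i \<in> I \<Longrightarrow> j \<in> I \<Longrightarrow> i \<noteq> j \<Longrightarrow> V i o\<^sub>L adj (V j) = 0"
  obtains W where "partial_isometry W" "\<And>x y. ((\<lambda>i. V i x \<bullet> y) has_sum (W x \<bullet> y)) I"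
    "\<And>i. i \<in> I \<Longrightarrow> W o\<^sub>L adj (V i) = V i o\<^sub>L adj (V i)"
    "\<And>i. i \<in> I \<Longrightarrow> adj W o\<^sub>L V i = adj (V i) o\<^sub>L V i"
proof -
  note b = in_bounded[OF partial_isometryD(1)[OF V]]
  have fin: "(\<Sum>i\<in>F. \<bar>V i x \<bullet> y\<bar>) \<le> norm x * norm y" if "finite F" "F \<subseteq> I" for F x y
  proof -
    have "(\<Sum>i\<in>F. \<bar>V i x \<bullet> y\<bar>) \<le> (\<Sum>i\<in>F. \<bar>norm (V i x)\<bar> * \<bar>norm (adj (V i) y)\<bar>)"
    proof (rule sum_mono)
      fix i assume "i \<in> F"
      then have i: "i \<in> I" using that by blast
      note p = partial_isometryD[OF V[OF i]]
      \<comment> \<open>Inserting the initial projection of V i puts one factor V i on x and one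
        adjoint on y, so that both Bessel inequalities apply.\<close>
      have "V i x \<bullet> y = adj (V i) (V i x) \<bullet> adj (V i) y"
        using p(2)[of x] adj_inner[OF b[OF i], of "adj (V i) (V i x)" y] by simp
      moreover have "(norm (adj (V i) (V i x)))\<^sup>2 = (norm (V i x))\<^sup>2"
        using p(2)[of x] adj_inner'[OF b[OF i]] by (simp add: power2_norm_eq_inner)
      then have "norm (adj (V i) (V i x)) = norm (V i x)" by simp
      ultimately show "\<bar>V i x \<bullet> y\<bar> \<le> \<bar>norm (V i x)\<bar> * \<bar>norm (adj (V i) y)\<bar>"
        using Cauchy_Schwarz_ineq2[of "adj (V i) (V i x)" "adj (V i) y"] by simp
    qed
    also have "\<dots> \<le> L2_set (\<lambda>i. norm (V i x)) F * L2_set (\<lambda>i. norm (adj (V i) y)) F"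
      by (rule L2_set_mult_ineq)
    also have "\<dots> \<le> norm x * norm y"
    proof (intro mult_mono)
      have "(\<Sum>i\<in>F. (norm (V i x))\<^sup>2) \<le> (norm x)\<^sup>2"
        using that by (intro partial_isometry_Bessel V orth(2)) auto
      then show "L2_set (\<lambda>i. norm (V i x)) F \<le> norm x"
        by (simp add: L2_set_def real_le_lsqrt sum_nonneg)
      have "(\<Sum>i\<in>F. (norm (adj (V i) y))\<^sup>2) \<le> (norm y)\<^sup>2"
      proof (rule partial_isometry_Bessel[OF that(1)])
        fix i j assume i: "i \<in> F"
        then show "partial_isometry (adj (V i))" using that by (intro partial_isometry_adj V) auto
        assume "j \<in> F" "i \<noteq> j"
        with i that show "adj (V i) o\<^sub>L adj (adj (V j)) = 0"
          using orth(1)[of i j] adj_adj[OF b[of j]] by (metis subsetD)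
      qed
      then show "L2_set (\<lambda>i. norm (adj (V i) y)) F \<le> norm y"
        by (simp add: L2_set_def real_le_lsqrt sum_nonneg)
    qed (auto simp: L2_set_nonneg)
    finally show ?thesis .
  qed
  define w where "w x y = infsum (\<lambda>i. V i x \<bullet> y) I" for x y
  have abs: "(\<lambda>i. norm (V i x \<bullet> y)) summable_on I" for x y
  proof (rule nonneg_bdd_above_summable_on)
    show "bdd_above (sum (\<lambda>i. norm (V i x \<bullet> y)) ` {F. F \<subseteq> I \<and> finite F})"
      using fin by (intro bdd_aboveI[of _ "norm x * norm y"]) auto
  qed simp
  have w: "((\<lambda>i. V i x \<bullet> y) has_sum w x y) I" for x y
    unfolding w_def using abs_summable_summable[OF abs] by simp
  have "bounded_bilinear w"
  proof
    fix a a' c c' :: 'a and r :: real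
    show "w (a + a') c = w a c + w a' c"
      using has_sum_add[OF w[of a c] w[of a' c]] w[of "a + a'" c] has_sum_unique
      by (auto simp: blinfun.bilinear_simps inner_add_left)
    show "w a (c + c') = w a c + w a c'"
      using has_sum_add[OF w[of a c] w[of a c']] w[of a "c + c'"] has_sum_unique
      by (auto simp: inner_add_right)
    show "w (r *\<^sub>R a) c = r *\<^sub>R w a c"
      using has_sum_cmult_right[OF w[of a c], of r] w[of "r *\<^sub>R a" c] has_sum_unique
      by (auto simp: blinfun.bilinear_simps)
    show "w a (r *\<^sub>R c) = r *\<^sub>R w a c"
      using has_sum_cmult_right[OF w[of a c], of r] w[of a "r *\<^sub>R c"] has_sum_unique by auto
    show "\<exists>K. \<forall>a b. norm (w a b) \<le> norm a * norm b * K"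
    proof (intro exI[of _ 1] allI)
      fix a c
      have "norm (w a c) \<le> infsum (\<lambda>i. norm (V i a \<bullet> c)) I"
        unfolding w_def by (rule norm_infsum_bound[OF abs])
      also have "\<dots> \<le> norm a * norm c"
        using fin by (intro infsum_le_finite_sums abs) auto
      finally show "norm (w a c) \<le> norm a * norm c * 1" by simp
    qed
  qed
  then obtain W :: "'a op" where "\<forall>x y. w x y = W x \<bullet> y"
    using bounded_bilinear_form_op by blast
  then have W: "((\<lambda>i. V i x \<bullet> y) has_sum (W x \<bullet> y)) I" for x y using w[of x y] by simp
  have eqI: "S = S'" if "\<And>x y. \<exists>f. (f has_sum (S x \<bullet> y)) I \<and> (f has_sum (S' x \<bullet> y)) I"
    for S S' :: "'a op"
    by (rule blinfun_eqI, rule vector_eq_rdot[THEN iffD1]) (use that has_sum_unique in blast)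
  have Wb: "W \<in> bounded_ops"
    unfolding bounded_ops_def
  proof safe
    fix c x
    show "W (c *\<^sub>C x) = c *\<^sub>C W x"
    proof (rule vector_eq_rdot[THEN iffD1], rule allI)
      fix y
      have "((\<lambda>i. V i (c *\<^sub>C x) \<bullet> y) has_sum (W x \<bullet> (cnj c *\<^sub>C y))) I"
        using W[of x "cnj c *\<^sub>C y"]
        by (rule has_sum_cong[THEN iffD1, rotated]) (simp add: bounded_opsD[OF b] inner_scaleC_left)
      from has_sum_unique[OF W this] show "W (c *\<^sub>C x) \<bullet> y = (c *\<^sub>C W x) \<bullet> y"
        by (simp add: inner_scaleC_left)
    qed
  qed
  have WN: "W \<in> N"
  proof (rule memI[OF Wb])
    fix B assume B: "B \<in> commutant N"
    have h: "((\<lambda>i. V i (B x) \<bullet> y) has_sum (W x \<bullet> adj B y)) I" for x y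
      using W[of x "adj B y"]
      by (rule has_sum_cong[THEN iffD1, rotated])
        (simp add: adj_inner[OF commutantD(1)[OF B], symmetric]
          commutant_apply[OF B partial_isometryD(1)[OF V]])
    show "B o\<^sub>L W = W o\<^sub>L B"
    proof (rule eqI)
      fix x y
      have "B (W x) \<bullet> y = W x \<bullet> adj B y" by (rule adj_inner[OF commutantD(1)[OF B]])
      then show "\<exists>f. (f has_sum ((B o\<^sub>L W) x \<bullet> y)) I \<and> (f has_sum ((W o\<^sub>L B) x \<bullet> y)) I"
        using h[of x y] W[of "B x" y] by (metis blinfun_apply_blinfun_compose)
    qed
  qed
  have WV: "W o\<^sub>L adj (V i) = V i o\<^sub>L adj (V i)" if i: "i \<in> I" for i
  proof (rule eqI)
    fix x y
    have "((\<lambda>j. V j (adj (V i) x) \<bullet> y) has_sum (V i (adj (V i) x) \<bullet> y)) I"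
    proof (rule has_sum_finite_neutralI[where B = "{i}"])
      show "V j (adj (V i) x) \<bullet> y = 0" if "j \<in> I - {i}" for j
        using compose_apply[OF orth(2), of j i x] that i by auto
    qed (use i in auto)
    then show "\<exists>f. (f has_sum ((W o\<^sub>L adj (V i)) x \<bullet> y)) I \<and> (f has_sum ((V i o\<^sub>L adj (V i)) x \<bullet> y)) I"
      using W[of "adj (V i) x" y] by auto
  qed
  have VW: "adj W o\<^sub>L V i = adj (V i) o\<^sub>L V i" if i: "i \<in> I" for i
  proof (rule eqI)
    fix x y
    have "((\<lambda>j. V j y \<bullet> V i x) has_sum (V i y \<bullet> V i x)) I"
    proof (rule has_sum_finite_neutralI[where B = "{i}"])
      show "V j y \<bullet> V i x = 0" if "j \<in> I - {i}" for j
        using compose_apply[OF orth(1), of j i x] that i adj_inner[OF b, of j y "V i x"] by auto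
    qed (use i in auto)
    moreover have "V i y \<bullet> V i x = (adj (V i) o\<^sub>L V i) x \<bullet> y"
      using adj_inner'[OF b[OF i], of "V i x" y] by (simp add: inner_commute)
    moreover have "W y \<bullet> V i x = (adj W o\<^sub>L V i) x \<bullet> y"
      using adj_inner'[OF Wb, of "V i x" y] by (simp add: inner_commute)
    ultimately show
      "\<exists>f. (f has_sum ((adj W o\<^sub>L V i) x \<bullet> y)) I \<and> (f has_sum ((adj (V i) o\<^sub>L V i) x \<bullet> y)) I"
      using W[of y "V i x"] by metis
  qed
  have sumE: "((\<lambda>i. adj (V i) (V i x) \<bullet> y) has_sum ((adj W o\<^sub>L W) x \<bullet> y)) I" for x y
  proof -
    have "((\<lambda>i. V i x \<bullet> W y) has_sum (W x \<bullet> W y)) I" by (rule W)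
    moreover have "W x \<bullet> W y = (adj W o\<^sub>L W) x \<bullet> y" by (simp add: adj_inner'[OF Wb])
    moreover have "V i x \<bullet> W y = adj (V i) (V i x) \<bullet> y" if "i \<in> I" for i
      using adj_inner'[OF Wb, of "V i x" y] compose_apply[OF VW[OF that], of x] by simp
    ultimately show ?thesis by (metis (no_types, lifting) has_sum_cong)
  qed
  have pW: "partial_isometry W"
    unfolding partial_isometry_def
  proof (intro conjI WN eqI)
    fix x y
    have "adj (V i) (V i x) \<bullet> adj W y = V i x \<bullet> y" if i: "i \<in> I" for i
      using adj_inner[OF Wb, of "adj (V i) (V i x)" y] compose_apply[OF WV[OF i], of "V i x"]
        partial_isometryD(2)[OF V[OF i]] by simp
    with sumE[of x "adj W y"] have "((\<lambda>i. V i x \<bullet> y) has_sum ((adj W o\<^sub>L W) x \<bullet> adj W y)) I"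
      by (rule has_sum_cong[THEN iffD1, rotated])
    moreover have "(adj W o\<^sub>L W) x \<bullet> adj W y = (W o\<^sub>L (adj W o\<^sub>L W)) x \<bullet> y"
      by (simp add: adj_inner[OF Wb])
    ultimately have "((\<lambda>i. V i x \<bullet> y) has_sum ((W o\<^sub>L (adj W o\<^sub>L W)) x \<bullet> y)) I" by simp
    then show "\<exists>f. (f has_sum ((W o\<^sub>L (adj W o\<^sub>L W)) x \<bullet> y)) I \<and> (f has_sum (W x \<bullet> y)) I"
      using W by blast
  qed
  show ?thesis using that[OF pW W WV VW] .
qed

text \<open>A fixed S may be multiplied termwise into a weak sum: on the left it moves to y as
  \<open>adj S\<close>, on the right it only changes x.\<close>

lemma weak_sum_compose:
  fixes V :: "'i \<Rightarrow> 'a op" and W S :: "'a op"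
  assumes W: "\<And>x y. ((\<lambda>i. V i x \<bullet> y) has_sum (W x \<bullet> y)) I" and S: "S \<in> bounded_ops"
  shows "(\<And>i. i \<in> I \<Longrightarrow> S o\<^sub>L V i = V i) \<Longrightarrow> S o\<^sub>L W = W"
    and "(\<And>i. i \<in> I \<Longrightarrow> S o\<^sub>L V i = 0) \<Longrightarrow> S o\<^sub>L W = 0"
    and "(\<And>i. i \<in> I \<Longrightarrow> V i o\<^sub>L S = V i) \<Longrightarrow> W o\<^sub>L S = W"
proof -
  have left: "((\<lambda>i. S (V i x) \<bullet> y) has_sum (S (W x) \<bullet> y)) I" for x y
    using W[of x "adj S y"] by (simp add: adj_inner[OF S])
  show "S o\<^sub>L W = W" if "\<And>i. i \<in> I \<Longrightarrow> S o\<^sub>L V i = V i"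
  proof (rule blinfun_eqI, rule vector_eq_rdot[THEN iffD1], rule allI)
    fix x y
    have "((\<lambda>i. V i x \<bullet> y) has_sum (S (W x) \<bullet> y)) I"
      using left by (rule has_sum_cong[THEN iffD1, rotated]) (simp add: compose_apply[OF that])
    from has_sum_unique[OF this W] show "(S o\<^sub>L W) x \<bullet> y = W x \<bullet> y" by simp
  qed
  show "S o\<^sub>L W = 0" if "\<And>i. i \<in> I \<Longrightarrow> S o\<^sub>L V i = 0"
  proof (rule blinfun_eqI, rule vector_eq_rdot[THEN iffD1], rule allI)
    fix x y
    have "((\<lambda>i. 0) has_sum (S (W x) \<bullet> y)) I"
      using left by (rule has_sum_cong[THEN iffD1, rotated]) (simp add: compose_apply[OF that])
    from has_sum_unique[OF this has_sum_0] show "(S o\<^sub>L W) x \<bullet> y = blinfun_apply 0 x \<bullet> y" by simp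
  qed
  show "W o\<^sub>L S = W" if "\<And>i. i \<in> I \<Longrightarrow> V i o\<^sub>L S = V i"
  proof (rule blinfun_eqI, rule vector_eq_rdot[THEN iffD1], rule allI)
    fix x y
    have "((\<lambda>i. V i x \<bullet> y) has_sum (W (S x) \<bullet> y)) I"
      using W[of "S x" y] by (rule has_sum_cong[THEN iffD1, rotated]) (simp add: compose_apply[OF that])
    from has_sum_unique[OF this W] show "(W o\<^sub>L S) x \<bullet> y = W x \<bullet> y" by simp
  qed
qed

end

section \<open>Finite factors and faithfulness of the trace\<close>

locale vn_factor = von_neumann +
  assumes center: "N \<inter> commutant N = range (\<lambda>c. c *\<^sub>o \<one>\<^sub>o)"
begin

text \<open>The vectors killed by \<open>F A\<close> for all \<open>A\<close> in the algebra form a subspace invariant under the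
  algebra and its commutant, so the projection onto it is a scalar.\<close>

lemma projections_linked:
  assumes E: "E \<in> projections N" "E \<noteq> 0" and F: "F \<in> projections N" "F \<noteq> 0"
  shows "\<exists>A\<in>N. F o\<^sub>L (A o\<^sub>L E) \<noteq> 0"
proof (rule ccontr)
  assume "\<not> ?thesis"
  then have FAE: "F (blinfun_apply A (E x)) = 0" if "A \<in> N" for A x
    using that by (metis blinfun_apply_blinfun_compose blinfun.zero_left)
  define M where "M = (\<Inter>A\<in>N. {y. F (blinfun_apply A y) = 0})"
  note Fb = in_bounded[OF projectionD(1)[OF F(1)]]
  have MI: "y \<in> M \<longleftrightarrow> (\<forall>A\<in>N. F (blinfun_apply A y) = 0)" for y by (auto simp: M_def)
  have "subspace M" by (auto simp: MI subspace_def blinfun.bilinear_simps)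
  moreover have "closed M"
    unfolding M_def by (intro closed_INT ballI closed_Collect_eq continuous_intros)
  moreover have "c *\<^sub>C x \<in> M" if "x \<in> M" for c x
    using that by (auto simp: MI bounded_opsD[OF in_bounded] bounded_opsD[OF Fb])
  ultimately obtain P :: "'a op" where P: "P \<in> bounded_ops"
    "\<And>x. P x \<in> M" "\<And>x. x \<in> M \<Longrightarrow> P x = x"
    "\<And>T. T \<in> bounded_ops \<Longrightarrow> (\<And>x. x \<in> M \<Longrightarrow> blinfun_apply T x \<in> M) \<Longrightarrow>
      (\<And>x. x \<in> M \<Longrightarrow> blinfun_apply (adj T) x \<in> M) \<Longrightarrow> T o\<^sub>L P = P o\<^sub>L T"
    using exists_projection_onto[of M] by metis
  have inv: "B y \<in> M" if "B \<in> N" "y \<in> M" for B y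
    unfolding MI
  proof
    fix A assume "A \<in> N"
    then have "F ((A o\<^sub>L B) y) = 0" using that compose_closed MI by blast
    then show "F (A (B y)) = 0" by simp
  qed
  have inv': "B y \<in> M" if "B \<in> commutant N" "y \<in> M" for B y
    unfolding MI
  proof
    fix A assume "A \<in> N"
    then show "F (A (B y)) = 0"
      using that commutant_apply[OF that(1)] projectionD(1)[OF F(1)] by (simp add: MI)
  qed
  have "P \<in> N"
    by (rule memI[OF P(1)]) (intro P(4) inv' commutantD(1) commutant_adj)
  moreover have "P \<in> commutant N"
    using P(1) P(4)[OF in_bounded inv inv[OF adj_closed]] by (auto simp: commutant_def)
  ultimately obtain c where c: "P = c *\<^sub>o \<one>\<^sub>o" using center by blast
  \<comment> \<open>A nonzero vector in the range of E lies in M, so the scalar is 1 and M is the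
    whole space; taking A to be the identity then kills F.\<close>
  obtain x where x: "E x \<noteq> 0" using E(2) by (metis blinfun.zero_left blinfun_eqI)
  have "c *\<^sub>C E x = E x" using P(3)[of "E x"] FAE by (simp add: MI c)
  then have "norm ((c - 1) *\<^sub>C E x) = 0" by (simp add: scaleC_diff_left)
  then have "c = 1" using x by (simp add: norm_scaleC)
  then have "y \<in> M" for y using P(2)[of y] c by simp
  then have "F (\<one>\<^sub>o y) = 0" for y using MI id_closed by blast
  then have "F = 0" by (intro blinfun_eqI) simp
  with F show False by simp
qed

text \<open>The comparison theorem for factors. A maximal orthogonal family of partial isometries
  from P into R sums to W; if something remained of both P and R, the remainders would be linked by
  the algebra and the family could be enlarged.\<close>

lemma projection_comparison:
  assumes P: "P \<in> projections N" and R: "R \<in> projections N"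
  obtains W where "partial_isometry W" "adj W o\<^sub>L W = P" "R o\<^sub>L W = W"
  | W where "partial_isometry W" "W o\<^sub>L adj W = R" "W o\<^sub>L P = W"
proof -
  note Pp = projectionD[OF P] and Rp = projectionD[OF R]
  define \<A> where "\<A> = {F. (\<forall>V\<in>F. partial_isometry V \<and> V \<noteq> 0 \<and> V o\<^sub>L P = V \<and> R o\<^sub>L V = V) \<and>
    (\<forall>V\<in>F. \<forall>V'\<in>F. V \<noteq> V' \<longrightarrow> adj V o\<^sub>L V' = 0 \<and> V o\<^sub>L adj V' = 0)}"
  have "\<exists>M\<in>\<A>. \<forall>X\<in>\<A>. M \<subseteq> X \<longrightarrow> X = M"
  proof (rule subset_Zorn')
    fix C assume "subset.chain \<A> C"
    then have C: "C \<subseteq> \<A>" "\<And>X Y. X \<in> C \<Longrightarrow> Y \<in> C \<Longrightarrow> X \<subseteq> Y \<or> Y \<subseteq> X"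
      by (auto simp: subset_chain_def)
    have "adj V o\<^sub>L V' = 0 \<and> V o\<^sub>L adj V' = 0" if "V \<in> \<Union>C" "V' \<in> \<Union>C" "V \<noteq> V'" for V V'
    proof -
      obtain X where "X \<in> C" "V \<in> X" "V' \<in> X" using C(2) \<open>V \<in> \<Union>C\<close> \<open>V' \<in> \<Union>C\<close> by blast
      then show ?thesis using C(1) \<open>V \<noteq> V'\<close> unfolding \<A>_def by blast
    qed
    then show "\<Union>C \<in> \<A>" using C(1) unfolding \<A>_def by blast
  qed
  then obtain F where F: "F \<in> \<A>" "\<And>X. X \<in> \<A> \<Longrightarrow> F \<subseteq> X \<Longrightarrow> X = F" by blast
  have FD: "partial_isometry V" "V o\<^sub>L P = V" "R o\<^sub>L V = V" "V \<noteq> 0" if "V \<in> F" for V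
    using F(1) that unfolding \<A>_def by blast+
  have Forth: "adj V o\<^sub>L V' = 0" "V o\<^sub>L adj V' = 0" if "V \<in> F" "V' \<in> F" "V \<noteq> V'" for V V'
    using F(1) that unfolding \<A>_def by blast+
  obtain W where W: "partial_isometry W" "\<And>x y. ((\<lambda>V. blinfun_apply V x \<bullet> y) has_sum (W x \<bullet> y)) F"
    "\<And>V. V \<in> F \<Longrightarrow> W o\<^sub>L adj V = V o\<^sub>L adj V" "\<And>V. V \<in> F \<Longrightarrow> adj W o\<^sub>L V = adj V o\<^sub>L V"
    using partial_isometry_sum[where I = F and V = "\<lambda>V. V", OF FD(1) Forth] by blast
  note Wp = partial_isometryD[OF W(1)]
  note Wb = in_bounded[OF Wp(1)]
  have WP: "W o\<^sub>L P = W"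
    by (rule weak_sum_compose(3)[OF W(2) in_bounded[OF Pp(1)]]) (rule FD)
  have RW: "R o\<^sub>L W = W"
    by (rule weak_sum_compose(1)[OF W(2) in_bounded[OF Rp(1)]]) (rule FD)
  have "adj (W o\<^sub>L P) = adj W" "adj (R o\<^sub>L W) = adj W" using WP RW by simp_all
  then have PW: "P o\<^sub>L adj W = adj W" "adj W o\<^sub>L R = adj W"
    using Wb Pp(1,2) Rp(1,2) by (simp_all add: adj_simps in_bounded)
  note app = compose_apply[OF WP] compose_apply[OF RW] compose_apply[OF PW(1)] compose_apply[OF PW(2)]
  have "P = adj W o\<^sub>L W \<or> R = W o\<^sub>L adj W"
  proof (rule ccontr)
    assume neq: "\<not> ?thesis"
    define E where "E = P - (adj W o\<^sub>L W)"
    define G where "G = R - (W o\<^sub>L adj W)"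
    have E: "E \<in> projections N" "E \<noteq> 0"
      unfolding E_def using neq
      by (auto intro!: diff_projection P Wp blinfun_eqI simp: app)
    have G: "G \<in> projections N" "G \<noteq> 0"
      unfolding G_def using neq
      by (auto intro!: diff_projection R Wp blinfun_eqI simp: app)
    obtain A where A: "A \<in> N" "G o\<^sub>L (A o\<^sub>L E) \<noteq> 0" using projections_linked[OF E G] by blast
    note Ep = projectionD[OF E(1)] and Gp = projectionD[OF G(1)]
    have "G o\<^sub>L (A o\<^sub>L E) \<in> N" by (intro closed A Ep Gp)
    \<comment> \<open>A linking operator need not be a partial isometry; its truncated polar part is
      one and obeys the same constraints on both sides.\<close>
    then obtain V where V: "partial_isometry V" "V \<noteq> 0"
      "\<And>S. S o\<^sub>L (G o\<^sub>L (A o\<^sub>L E)) = G o\<^sub>L (A o\<^sub>L E) \<Longrightarrow> S o\<^sub>L V = V"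
      "\<And>S. (G o\<^sub>L (A o\<^sub>L E)) o\<^sub>L S = G o\<^sub>L (A o\<^sub>L E) \<Longrightarrow> V o\<^sub>L S = V"
      using partial_isometry_exists A(2) by metis
    note Vp = partial_isometryD[OF V(1)]
    note Vb = in_bounded[OF Vp(1)]
    have GV: "G o\<^sub>L V = V" by (rule V(3)) (auto intro!: blinfun_eqI simp: Gp)
    have VE: "V o\<^sub>L E = V" by (rule V(4)) (auto intro!: blinfun_eqI simp: Ep)
    have PE: "E (P x) = E x" "R (G x) = G x" "W (E x) = 0" "adj W (G x) = 0" for x
      using Pp Rp Wp by (simp_all add: E_def G_def blinfun.bilinear_simps app)
    have VP: "V o\<^sub>L P = V"
    proof (rule blinfun_eqI)
      fix x show "(V o\<^sub>L P) x = V x"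
        using compose_apply[OF VE, of "P x"] compose_apply[OF VE, of x] by (simp add: PE)
    qed
    have RV: "R o\<^sub>L V = V"
    proof (rule blinfun_eqI)
      fix x show "(R o\<^sub>L V) x = V x"
        using PE(2)[of "V x"] compose_apply[OF GV, of x] by simp
    qed
    have WV: "adj W (V x) = 0" for x
      using PE(4)[of "V x"] compose_apply[OF GV, of x] by simp
    have EV: "E o\<^sub>L adj V = adj V"
    proof -
      have "adj (V o\<^sub>L E) = adj V" using VE by simp
      then show ?thesis using Vb Ep(1,2) by (simp add: adj_simps in_bounded)
    qed
    have WV': "W (adj V x) = 0" for x
      using PE(3)[of "adj V x"] compose_apply[OF EV, of x] by simp
    \<comment> \<open>The final space of V' lies in the range of W, and \<open>adj W\<close> kills
      the range of V, so the two are orthogonal; the initial spaces are treated symmetrically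
      through \<open>adj W\<close>.\<close>
    have o1: "adj V' o\<^sub>L V = 0" "adj V o\<^sub>L V' = 0" "V' o\<^sub>L adj V = 0" "V o\<^sub>L adj V' = 0"
      if V': "V' \<in> F" for V'
    proof -
      note p' = partial_isometryD[OF FD(1)[OF V']]
      note b' = in_bounded[OF p'(1)]
      have a: "W (adj V' (V' x)) = V' x" for x
        using compose_apply[OF W(3)[OF V'], of "V' x"] p' by simp
      have a': "adj W (V' (adj V' x)) = adj V' x" for x
        using compose_apply[OF W(4)[OF V'], of "adj V' x"] p' by simp
      have "V' x \<bullet> V y = 0" for x y
        using adj_inner[OF Wb, of "adj V' (V' x)" "V y"] by (simp add: a WV)
      then have "x \<bullet> adj V' (V y) = 0" "adj V (V' x) \<bullet> y = 0" for x y
        by (simp_all add: adj_inner[OF b', symmetric] adj_inner'[OF Vb])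
      then show "adj V' o\<^sub>L V = 0" "adj V o\<^sub>L V' = 0"
        by (metis blinfun_eqI blinfun.zero_left blinfun_apply_blinfun_compose inner_eq_zero_iff)+
      have "adj V' x \<bullet> adj V y = 0" for x y
        using adj_inner'[OF Wb, of "V' (adj V' x)" "adj V y"] by (simp add: a' WV')
      then have "x \<bullet> V' (adj V y) = 0" "V (adj V' x) \<bullet> y = 0" for x y
        by (simp_all add: adj_inner'[OF b', symmetric] adj_inner[OF Vb])
      then show "V' o\<^sub>L adj V = 0" "V o\<^sub>L adj V' = 0"
        by (metis blinfun_eqI blinfun.zero_left blinfun_apply_blinfun_compose inner_eq_zero_iff)+
    qed
    have "insert V F \<in> \<A>"
      unfolding \<A>_def
    proof (rule CollectI, intro conjI)
      show "\<forall>V\<in>insert V F. partial_isometry V \<and> V \<noteq> 0 \<and> V o\<^sub>L P = V \<and> R o\<^sub>L V = V"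
        using FD V(1,2) VP RV by auto
      show "\<forall>V1\<in>insert V F. \<forall>V2\<in>insert V F. V1 \<noteq> V2 \<longrightarrow> adj V1 o\<^sub>L V2 = 0 \<and> V1 o\<^sub>L adj V2 = 0"
        using Forth o1 by auto
    qed
    \<comment> \<open>By maximality V is already in the family, so W agrees with V on the initial
      space of V; but W was seen to kill that space.\<close>
    then have "V \<in> F" using F(2)[of "insert V F"] by blast
    then have "W (adj V (V x)) = V x" for x
      using compose_apply[OF W(3), of V "V x"] Vp by simp
    then have "V x = 0" for x using WV' by simp
    then show False using V(2) by (metis blinfun.zero_left blinfun_eqI)
  qed
  then show thesis using that W(1) WP RW by metis
qed

end

locale tracial_factor = vn_factor +
  fixes \<tau> :: "'a op \<Rightarrow> complex"
  assumes finite_id: "finite_projection N \<one>\<^sub>o"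
    and tracial: "tracial_state N \<tau>"
begin

lemma trace_add: "A \<in> N \<Longrightarrow> B \<in> N \<Longrightarrow> \<tau> (A + B) = \<tau> A + \<tau> B"
  and trace_scaleC: "A \<in> N \<Longrightarrow> \<tau> (c *\<^sub>o A) = c * \<tau> A"
  and trace_id: "\<tau> \<one>\<^sub>o = 1"
  and trace_comm: "A \<in> N \<Longrightarrow> B \<in> N \<Longrightarrow> \<tau> (A o\<^sub>L B) = \<tau> (B o\<^sub>L A)"
  using tracial by (auto simp: tracial_state_def)

lemma trace_nonneg:
  assumes "A \<in> N"
  shows "0 \<le> Re (\<tau> (adj A o\<^sub>L A))" "Im (\<tau> (adj A o\<^sub>L A)) = 0"
  using tracial assms by (auto simp: tracial_state_def complex_nonneg_Reals_iff)

lemma trace_scaleR: "A \<in> N \<Longrightarrow> \<tau> (r *\<^sub>R A) = of_real r * \<tau> A"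
  using trace_scaleC[of A "of_real r"] by (simp add: op_scaleC_of_real)

lemma trace_diff:
  assumes "A \<in> N" "B \<in> N"
  shows "\<tau> (A - B) = \<tau> A - \<tau> B"
proof -
  have "A - B = A + (-1) *\<^sub>R B" by simp
  then show ?thesis
    using trace_add[OF assms(1) scaleR_closed[OF assms(2)], of "-1"] trace_scaleR[OF assms(2), of "-1"]
    by simp
qed

lemma trace_zero: "\<tau> 0 = 0"
  using trace_diff[OF id_closed id_closed] by simp

lemma trace_projection:
  assumes "P \<in> projections N"
  shows "0 \<le> Re (\<tau> P)" "Im (\<tau> P) = 0"
  using trace_nonneg[of P] projectionD[OF assms] by auto

text \<open>P is compared with the complement of D. If instead that complement embedded in P, its
  trace 1 would be at most the trace 0 of P.\<close>

lemma null_projection_step: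
  assumes P: "P \<in> projections N" "\<tau> P = 0" and D: "D \<in> projections N" "\<tau> D = 0"
  obtains V where "partial_isometry V" "adj V o\<^sub>L V = P" "D o\<^sub>L V = 0"
proof (rule projection_comparison[OF P(1) complement_projection[OF D(1)]])
  fix W assume W: "partial_isometry W" "adj W o\<^sub>L W = P" "(\<one>\<^sub>o - D) o\<^sub>L W = W"
  have "D o\<^sub>L W = 0"
    using compose_apply[OF W(3)] by (intro blinfun_eqI) (simp add: blinfun.bilinear_simps)
  then show thesis using that W by blast
next
  fix W assume W: "partial_isometry W" "W o\<^sub>L adj W = \<one>\<^sub>o - D" "W o\<^sub>L P = W"
  note Wp = partial_isometryD[OF W(1)]
  have "adj (W o\<^sub>L P) = adj W" using W(3) by simp
  then have "P o\<^sub>L adj W = adj W"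
    using Wp(1) projectionD[OF P(1)] by (simp add: adj_simps in_bounded)
  then have "P o\<^sub>L (adj W o\<^sub>L W) = adj W o\<^sub>L W"
    using compose_apply by (intro blinfun_eqI) fastforce
  then have "P - (adj W o\<^sub>L W) \<in> projections N" by (intro diff_projection P Wp)
  from trace_projection(1)[OF this] have "Re (\<tau> (adj W o\<^sub>L W)) \<le> 0"
    using P(2) projectionD(1)[OF P(1)] projectionD(1)[OF Wp(4)] by (simp add: trace_diff)
  then have "Re (\<tau> (\<one>\<^sub>o - D)) \<le> 0"
    using trace_comm[OF Wp(1) adj_closed[OF Wp(1)]] W(2) by simp
  then show thesis
    using projectionD(1)[OF D(1)] D(2) by (simp add: trace_diff id_closed trace_id)
qed

text \<open>A nonzero projection \<open>P\<close> of trace zero could be copied infinitely often below the identity; the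
  shift along the copies is an isometry that is not surjective, contradicting finiteness.\<close>

lemma trace_projection_eq_0:
  assumes P: "P \<in> projections N" "\<tau> P = 0"
  shows "P = 0"
proof (rule ccontr)
  assume P0: "P \<noteq> 0"
  note Pp = projectionD[OF P(1)]
  \<comment> \<open>D collects the copies made so far and V is the next one, orthogonal to D; a copy
    has the trace of P, so D keeps trace zero and the construction never stops.\<close>
  define good where "good = (\<lambda>(D, V). D \<in> projections N \<and> \<tau> D = 0 \<and> partial_isometry V \<and>
    adj V o\<^sub>L V = P \<and> D o\<^sub>L V = 0)"
  have next_copy: "\<exists>V. good (D, V)" if D: "D \<in> projections N" "\<tau> D = 0" for D
  proof -
    obtain V where "partial_isometry V" "adj V o\<^sub>L V = P" "D o\<^sub>L V = 0"
      using null_projection_step[OF P D] by blast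
    then show ?thesis using D by (auto simp: good_def)
  qed
  have "\<exists>f. \<forall>n. good (f n) \<and> fst (f (Suc n)) = fst (f n) + (snd (f n) o\<^sub>L adj (snd (f n)))"
  proof (rule dependent_nat_choice)
    have "0 \<in> projections N" by (simp add: projections_def zero_closed)
    then show "\<exists>x. good x" using next_copy trace_zero by blast
  next
    fix x and n :: nat assume "good x"
    moreover obtain D V where x: "x = (D, V)" by force
    ultimately have D: "D \<in> projections N" "\<tau> D = 0" and V: "partial_isometry V"
      "adj V o\<^sub>L V = P" "D o\<^sub>L V = 0" by (auto simp: good_def)
    note Dp = projectionD[OF D(1)] and Vp = partial_isometryD[OF V(1)]
    note Vb = in_bounded[OF Vp(1)]
    have "adj (D o\<^sub>L V) = adj 0" using V(3) by simp
    then have VD: "adj V o\<^sub>L D = 0" using Vb Dp(1,2) by (simp add: adj_simps in_bounded)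
    have "D + (V o\<^sub>L adj V) \<in> projections N"
      using Dp Vp compose_apply[OF V(3)] compose_apply[OF VD]
      by (intro projectionI) (auto simp: closed adj_simps in_bounded blinfun.bilinear_simps)
    moreover have "\<tau> (D + (V o\<^sub>L adj V)) = 0"
      using D(2) P(2) V(2) Dp(1) Vp(1) trace_comm[OF Vp(1) adj_closed[OF Vp(1)]]
      by (simp add: trace_add closed)
    ultimately show "\<exists>y. good y \<and> fst y = fst x + (snd x o\<^sub>L adj (snd x))"
      using next_copy x by (metis fst_conv snd_conv)
  qed
  then obtain f where f: "\<And>n. good (f n)"
    "\<And>n. fst (f (Suc n)) = fst (f n) + (snd (f n) o\<^sub>L adj (snd (f n)))" by blast
  define D where "D n = fst (f n)" for n
  define V where "V n = snd (f n)" for n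
  have V: "partial_isometry (V n)" "adj (V n) o\<^sub>L V n = P" "D n o\<^sub>L V n = 0"
    and Dproj: "D n \<in> projections N" for n
    using f(1)[of n] by (auto simp: D_def V_def good_def case_prod_beta)
  have D_Suc: "D (Suc n) = D n + (V n o\<^sub>L adj (V n))" for n
    using f(2) by (simp add: D_def V_def)
  note Vp = partial_isometryD[OF V(1)]
  note Vb = in_bounded[OF Vp(1)]
  have VD: "adj (V n) (D n x) = 0" for n x
  proof -
    have "adj (D n o\<^sub>L V n) = adj 0" using V(3) by simp
    then have "adj (V n) o\<^sub>L D n = 0"
      using Vb projectionD(1,2)[OF Dproj] by (simp add: adj_simps in_bounded)
    then show ?thesis using compose_apply by fastforce
  qed
  have DV: "D n (V m x) = V m x" if "m < n" for m n x
    using that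
  proof (induction n)
    case (Suc n)
    show ?case
    proof (cases "m = n")
      case True
      then show ?thesis
        using compose_apply[OF V(3)[of n], of x] Vp(2) by (simp add: D_Suc blinfun.bilinear_simps)
    next
      case False
      then have "D n (V m x) = V m x" using Suc by simp
      moreover from this have "adj (V n) (V m x) = 0" using VD[of n "V m x"] by simp
      ultimately show ?thesis by (simp add: D_Suc blinfun.bilinear_simps)
    qed
  qed simp
  have orth: "adj (V n) (V m x) = 0" if "m \<noteq> n" for m n x
  proof (cases "m < n")
    case True
    then show ?thesis using VD[of n "V m x"] DV[OF True] by simp
  next
    case False
    then have "n < m" using that by simp
    then have "adj (V m) (V n y) = 0" for y using VD[of m "V n y"] DV by simp
    then have "adj (V n) (V m x) \<bullet> y = 0" for y
      using adj_inner'[OF Vb, of n "V m x" y] adj_inner[OF Vb, of m x "V n y"] by simp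
    then show ?thesis by (metis inner_eq_zero_iff)
  qed
  have VP: "V n (P x) = V n x" "P (adj (V n) x) = adj (V n) x" for n x
    using Vp(2)[of n x] Vp(3)[of n x] compose_apply[OF V(2)[of n]] by simp_all
  have VVP: "adj (V n) (V n x) = P x" for n x using compose_apply[OF V(2)[of n]] .
  \<comment> \<open>Carries copy n onto copy n + 1; the weak sum W of these is the shift.\<close>
  define A where "A n = V (Suc n) o\<^sub>L adj (V n)" for n
  have A_N: "A n \<in> N" for n by (simp add: A_def closed Vp)
  have A_adj: "adj (A n) = V n o\<^sub>L adj (V (Suc n))" for n
    by (simp add: A_def adj_simps Vb)
  have A_iso: "partial_isometry (A n)" for n
    using A_N by (auto simp: partial_isometry_def A_adj intro!: blinfun_eqI) (simp add: A_def VVP VP)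
  have A_orth: "adj (A m) o\<^sub>L A n = 0" "A m o\<^sub>L adj (A n) = 0" if "m \<noteq> n" for m n
    using that by (auto intro!: blinfun_eqI simp: A_adj) (simp_all add: A_def orth blinfun.bilinear_simps)
  have "\<exists>W. partial_isometry W \<and> (\<forall>x y. ((\<lambda>i. A i x \<bullet> y) has_sum (W x \<bullet> y)) UNIV) \<and>
    (\<forall>i. W o\<^sub>L adj (A i) = A i o\<^sub>L adj (A i)) \<and> (\<forall>i. adj W o\<^sub>L A i = adj (A i) o\<^sub>L A i)"
  proof (rule partial_isometry_sum[of UNIV A], goal_cases)
    case (4 W)
    then show ?case by (intro exI[of _ W]) simp
  qed (use A_iso A_orth in simp_all)
  then obtain W where W: "partial_isometry W"
    "\<And>x y. ((\<lambda>i. A i x \<bullet> y) has_sum (W x \<bullet> y)) UNIV"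
    "\<And>i. W o\<^sub>L adj (A i) = A i o\<^sub>L adj (A i)" "\<And>i. adj W o\<^sub>L A i = adj (A i) o\<^sub>L A i"
    by auto
  note Wp = partial_isometryD[OF W(1)]
  note Wb = in_bounded[OF Wp(1)]
  define E where "E = adj W o\<^sub>L W"
  have E: "E \<in> projections N" using Wp by (simp add: E_def)
  note Ep = projectionD[OF E]
  have EQ: "E (V n (adj (V n) x)) = V n (adj (V n) x)" for n x
  proof -
    have "W (adj (A n) (A n x)) = A n x"
      using compose_apply[OF W(3)[of n], of "A n x"] partial_isometryD(2)[OF A_iso[of n]] by simp
    moreover have "adj W (A n x) = adj (A n) (A n x)" using compose_apply[OF W(4)[of n]] by simp
    moreover have "adj (A n) (A n x) = V n (adj (V n) x)"
      by (simp add: A_adj) (simp add: A_def VVP VP)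
    ultimately show ?thesis by (simp add: E_def)
  qed
  have EW: "E o\<^sub>L W = W"
  proof (rule weak_sum_compose(1)[OF W(2) in_bounded[OF Ep(1)]])
    fix n show "E o\<^sub>L A n = A n"
    proof (rule blinfun_eqI)
      fix x show "(E o\<^sub>L A n) x = A n x"
        using EQ[of "Suc n" "A n x"] by (simp add: A_def VVP VP)
    qed
  qed
  have QW: "(V 0 o\<^sub>L adj (V 0)) o\<^sub>L W = 0"
    by (rule weak_sum_compose(2)[OF W(2)])
      (auto intro!: bounded_ops_intros Vb blinfun_eqI simp: A_def orth)
  have "adj (E o\<^sub>L W) = adj W" using EW by simp
  then have WE: "adj W o\<^sub>L E = adj W" using Wb Ep(1,2) by (simp add: adj_simps in_bounded)
  \<comment> \<open>The shift extended by the identity off the copies, an isometry of the whole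
    space.\<close>
  define Z where "Z = W + (\<one>\<^sub>o - E)"
  have ZN: "Z \<in> N" unfolding Z_def by (intro closed Wp Ep)
  have Z_adj: "adj Z = adj W + (\<one>\<^sub>o - E)"
    using Wb Ep(1,2) by (simp add: Z_def adj_simps in_bounded)
  have Zx: "Z x = W x + (x - E x)" "adj Z x = adj W x + (x - E x)" for x
    unfolding Z_adj by (simp_all add: Z_def blinfun.bilinear_simps)
  have WE': "W (E x) = W x" for x using Wp(2) by (simp add: E_def)
  have ZZ: "adj Z o\<^sub>L Z = \<one>\<^sub>o"
  proof (rule blinfun_eqI)
    fix x
    have "adj W (W x) = E x" by (simp add: E_def)
    then show "(adj Z o\<^sub>L Z) x = \<one>\<^sub>o x"
      using compose_apply[OF WE, of x] compose_apply[OF EW, of x] Ep(5)[of x]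
      by (simp add: Zx blinfun.bilinear_simps)
  qed
  have ZZ': "Z o\<^sub>L adj Z = (\<one>\<^sub>o - E) + (W o\<^sub>L adj W)"
  proof (rule blinfun_eqI)
    fix x
    have "E (adj W x) = adj W x" using Wp(3) by (simp add: E_def)
    then show "(Z o\<^sub>L adj Z) x = ((\<one>\<^sub>o - E) + (W o\<^sub>L adj W)) x"
      using WE' Ep(5)[of x] by (simp add: Zx blinfun.bilinear_simps)
  qed
  have "partial_isometry Z" using ZN ZZ by (simp add: partial_isometry_def)
  then have "Z o\<^sub>L adj Z \<in> projections N" by (rule partial_isometryD)
  moreover have "mvn_equiv N \<one>\<^sub>o (Z o\<^sub>L adj Z)" using ZN ZZ by (auto simp: mvn_equiv_def)
  ultimately have "Z o\<^sub>L adj Z = \<one>\<^sub>o"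
    using finite_id by (simp add: finite_projection_def subprojection_def)
  \<comment> \<open>Finiteness makes Z unitary, so the initial and final projections of W coincide;
    yet copy 0 lies under the former and is orthogonal to the latter.\<close>
  then have EF: "E x = W (adj W x)" for x
    using ZZ'[THEN arg_cong, of "\<lambda>T. blinfun_apply T x"] by (simp add: blinfun.bilinear_simps)
  have "V 0 (adj (V 0) x) = 0" for x
  proof -
    have "(V 0 o\<^sub>L adj (V 0)) (E y) = 0" for y
      using compose_apply[OF QW, of "adj W y"] by (simp add: EF)
    then have "V 0 (adj (V 0) (E (V 0 (adj (V 0) x)))) = 0" by simp
    then show ?thesis using EQ[of 0 x] Vp(2) by simp
  qed
  then have "V 0 y = 0" for y using Vp(2)[of 0 y] by simp
  then have "P x = 0" for x using VVP[of 0 x] by simp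
  then show False using P0 by (metis blinfun.zero_left blinfun_eqI)
qed

text \<open>K is at least \<epsilon> on the range of a spectral cut E, so the trace of K E is at
  least \<epsilon> \<tau>(E). It is also nonpositive, because K has trace zero and K - K E is a
  product of \<open>adj B\<close> and B. So \<tau>(E) = 0, and E = 0.\<close>

lemma trace_faithful:
  assumes A: "A \<in> N" and t0: "\<tau> (adj A o\<^sub>L A) = 0"
  shows "A = 0"
proof (rule ccontr)
  assume A0: "A \<noteq> 0"
  note Ab = in_bounded[OF A]
  define K where "K = adj A o\<^sub>L A"
  have K: "K \<in> N" "self_adjoint K" "K \<noteq> 0" "0 \<le> K x \<bullet> x" for x
    using A A0 Ab adj_compose_self_eq_0[OF Ab]
    by (auto simp: K_def closed self_adjoint_adj_compose adj_inner')
  obtain \<epsilon> E where \<epsilon>: "0 < \<epsilon>" and E: "E \<in> projections N" "E \<noteq> 0" "E o\<^sub>L K = K o\<^sub>L E"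
    "cfc (\<lambda>t. max (t - \<epsilon>) 0) K o\<^sub>L E = cfc (\<lambda>t. max (t - \<epsilon>) 0) K"
    "\<And>L :: 'a op. cfc (\<lambda>t. max (t - \<epsilon>) 0) K o\<^sub>L L = 0 \<Longrightarrow> E o\<^sub>L L = 0"
    using spectral_cut[OF K(1,2,4,3)] by metis
  note Ep = projectionD[OF E(1)]
  have cont: "continuous_on UNIV (\<lambda>t. max (t - \<epsilon>) 0)" "continuous_on UNIV (\<lambda>t. max (\<epsilon> - t) 0)"
    "continuous_on UNIV (\<lambda>t. sqrt (max (t - \<epsilon>) 0))"
    by (intro continuous_intros)+
  define X where "X = cfc (\<lambda>t. max (t - \<epsilon>) 0) K"
  define Y where "Y = cfc (\<lambda>t. max (\<epsilon> - t) 0) K"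
  define M where "M = cfc (\<lambda>t. sqrt (max (t - \<epsilon>) 0)) K"
  have XY: "K - \<epsilon> *\<^sub>R \<one>\<^sub>o = X - Y"
  proof -
    have "X - Y = cfc (\<lambda>t. max (t - \<epsilon>) 0 - max (\<epsilon> - t) 0) K"
      unfolding X_def Y_def by (rule cfc_diff[symmetric, OF K(2) cont(1,2)])
    also have "\<dots> = cfc (\<lambda>t. t - \<epsilon>) K" by (rule cfc_cong) auto
    also have "\<dots> = K - \<epsilon> *\<^sub>R \<one>\<^sub>o"
      by (subst cfc_diff) (auto intro!: K continuous_intros simp: cfc_ident cfc_const K)
    finally show ?thesis by simp
  qed
  have "X o\<^sub>L Y = cfc (\<lambda>t. max (t - \<epsilon>) 0 * max (\<epsilon> - t) 0) K"
    unfolding X_def Y_def by (rule cfc_mult[symmetric, OF K(2) cont(1,2)])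
  also have "\<dots> = cfc (\<lambda>_. 0) K" by (rule cfc_cong) auto
  also have "\<dots> = 0" by (simp add: cfc_const K)
  finally have "E o\<^sub>L Y = 0" unfolding X_def by (rule E(5))
  moreover have "E o\<^sub>L Y = Y o\<^sub>L E" unfolding Y_def by (rule cfc_commute[OF K(2) cont(2) E(3)])
  ultimately have YE: "Y (E x) = 0" for x by (metis compose_apply blinfun.zero_left)
  have XE: "X (E x) = X x" for x using compose_apply[OF E(4)] by (simp add: X_def)
  \<comment> \<open>E kills the negative part Y of K - \<epsilon>, leaving the positive part X,
    which is already supported on E.\<close>
  have KX: "K o\<^sub>L E = X + \<epsilon> *\<^sub>R E"
  proof (rule blinfun_eqI)
    fix x
    have "(K - \<epsilon> *\<^sub>R \<one>\<^sub>o) (E x) = (X - Y) (E x)" by (simp only: XY)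
    then show "(K o\<^sub>L E) x = (X + \<epsilon> *\<^sub>R E) x" by (simp add: blinfun.bilinear_simps YE XE algebra_simps)
  qed
  have XN: "X \<in> N" unfolding X_def by (intro cfc_closed K cont)
  have MM: "X = adj M o\<^sub>L M" "M \<in> N"
  proof -
    have sM: "adj M = M" unfolding M_def by (intro self_adjointD cfc_self_adjoint K cont)
    have "M o\<^sub>L M = cfc (\<lambda>t. sqrt (max (t - \<epsilon>) 0) * sqrt (max (t - \<epsilon>) 0)) K"
      unfolding M_def by (rule cfc_mult[symmetric, OF K(2) cont(3,3)])
    also have "\<dots> = X" unfolding X_def by (rule cfc_cong) simp
    finally show "X = adj M o\<^sub>L M" using sM by simp
    show "M \<in> N" unfolding M_def by (intro cfc_closed K cont)
  qed
  define B where "B = A o\<^sub>L (\<one>\<^sub>o - E)"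
  have BN: "B \<in> N" unfolding B_def by (intro closed A Ep)
  have BB: "adj B o\<^sub>L B = K - (K o\<^sub>L E)"
  proof (rule blinfun_eqI)
    fix x
    have "adj B = (\<one>\<^sub>o - E) o\<^sub>L adj A" using Ab Ep(1,2) by (simp add: B_def adj_simps in_bounded)
    then have "(adj B o\<^sub>L B) x = (\<one>\<^sub>o - E) (K (x - E x))"
      by (simp add: B_def K_def blinfun.bilinear_simps)
    also have "\<dots> = K (x - E x) - K (E (x - E x))"
      by (simp add: compose_apply[OF E(3)] blinfun.bilinear_simps)
    also have "E (x - E x) = 0" using Ep(5) by (simp add: blinfun.bilinear_simps)
    finally show "(adj B o\<^sub>L B) x = (K - (K o\<^sub>L E)) x" by (simp add: blinfun.bilinear_simps)
  qed
  have "0 \<le> Re (\<tau> (K - (K o\<^sub>L E)))" using trace_nonneg(1)[OF BN] BB by simp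
  then have "Re (\<tau> (K o\<^sub>L E)) \<le> 0" using t0 K(1) Ep(1) by (simp add: trace_diff closed K_def)
  moreover have "Re (\<tau> (K o\<^sub>L E)) = Re (\<tau> X) + \<epsilon> * Re (\<tau> E)"
    unfolding KX using XN Ep(1) by (simp add: trace_add trace_scaleR closed)
  moreover have "0 \<le> Re (\<tau> X)" using trace_nonneg(1)[OF MM(2)] MM(1) by simp
  ultimately have "\<epsilon> * Re (\<tau> E) \<le> 0" by simp
  then have "Re (\<tau> E) \<le> 0" using \<epsilon> by (simp add: mult_le_0_iff)
  then have "\<tau> E = 0" using trace_projection[OF E(1)] by (simp add: complex_eq_iff)
  then show False using trace_projection_eq_0[OF E(1)] E(2) by simp
qed

text \<open>The trace condition is asked only of P commuting with whatever commutes, along with its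
  adjoint, with C. Supports of functions of C qualify, and in the application such P commute with
  U.\<close>

lemma cfc_eq_0_by_trace:
  assumes C: "C \<in> N" "self_adjoint C" and g: "continuous_on UNIV g"
    and tr: "\<And>P. P \<in> projections N \<Longrightarrow>
      (\<And>S. S \<in> N \<Longrightarrow> S o\<^sub>L C = C o\<^sub>L S \<Longrightarrow> adj S o\<^sub>L C = C o\<^sub>L adj S \<Longrightarrow> S o\<^sub>L P = P o\<^sub>L S) \<Longrightarrow>
      \<tau> (cfc g C o\<^sub>L P) = 0"
  shows "cfc g C = 0"
proof -
  \<comment> \<open>One sign at a time: with P the support of the positive part X of h(C), the
    product h(C) P is X, so X has trace zero; X is the square of M, and faithfulness kills
    M.\<close>
  have half: "cfc (\<lambda>t. max (h t) 0) C = 0"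
    if h: "continuous_on UNIV h" and
      trh: "\<And>P. P \<in> projections N \<Longrightarrow>
      (\<And>S. S \<in> N \<Longrightarrow> S o\<^sub>L C = C o\<^sub>L S \<Longrightarrow> adj S o\<^sub>L C = C o\<^sub>L adj S \<Longrightarrow> S o\<^sub>L P = P o\<^sub>L S) \<Longrightarrow>
      \<tau> (cfc h C o\<^sub>L P) = 0" for h
  proof -
    define X where "X = cfc (\<lambda>t. max (h t) 0) C"
    define Y where "Y = cfc (\<lambda>t. max (- h t) 0) C"
    define M where "M = cfc (\<lambda>t. sqrt (max (h t) 0)) C"
    have cont: "continuous_on UNIV (\<lambda>t. max (h t) 0)" "continuous_on UNIV (\<lambda>t. max (- h t) 0)"
      "continuous_on UNIV (\<lambda>t. sqrt (max (h t) 0))"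
      by (intro continuous_intros h)+
    have X: "X \<in> N" "self_adjoint X"
      unfolding X_def by (intro cfc_closed cfc_self_adjoint C cont)+
    obtain P where P: "P \<in> projections N" "X o\<^sub>L P = X"
      "\<And>L :: 'a op. X o\<^sub>L L = 0 \<Longrightarrow> P o\<^sub>L L = 0"
      "\<And>S. S \<in> N \<Longrightarrow> S o\<^sub>L X = X o\<^sub>L S \<Longrightarrow> adj S o\<^sub>L X = X o\<^sub>L adj S \<Longrightarrow> S o\<^sub>L P = P o\<^sub>L S"
      using support_projection[OF X] by metis
    note Pp = projectionD[OF P(1)]
    have "X o\<^sub>L Y = cfc (\<lambda>t. max (h t) 0 * max (- h t) 0) C"
      unfolding X_def Y_def by (rule cfc_mult[symmetric, OF C(2) cont(1,2)])
    also have "\<dots> = cfc (\<lambda>_. 0) C" by (rule cfc_cong) auto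
    also have "\<dots> = 0" by (simp add: cfc_const C)
    finally have "P o\<^sub>L Y = 0" by (rule P(3))
    then have "adj (P o\<^sub>L Y) = 0" by simp
    moreover have Y: "self_adjoint Y" unfolding Y_def by (intro cfc_self_adjoint C cont)
    ultimately have YP: "Y o\<^sub>L P = 0"
      using Pp(1,2) self_adjointD(1,2)[OF Y] by (simp add: adj_simps in_bounded)
    have "cfc h C = cfc (\<lambda>t. max (h t) 0 - max (- h t) 0) C" by (rule cfc_cong) auto
    also have "\<dots> = X - Y" unfolding X_def Y_def by (rule cfc_diff[OF C(2) cont(1,2)])
    finally have "cfc h C o\<^sub>L P = X"
      using compose_apply[OF P(2)] compose_apply[OF YP]
      by (intro blinfun_eqI) (simp add: blinfun.bilinear_simps)
    moreover have "\<tau> (cfc h C o\<^sub>L P) = 0"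
    proof (rule trh[OF P(1)])
      fix S assume S: "S \<in> N" "S o\<^sub>L C = C o\<^sub>L S" "adj S o\<^sub>L C = C o\<^sub>L adj S"
      show "S o\<^sub>L P = P o\<^sub>L S"
        using S(1) cfc_commute[OF C(2) cont(1) S(2)] cfc_commute[OF C(2) cont(1) S(3)]
        by (intro P(4)) (simp_all add: X_def)
    qed
    ultimately have tX: "\<tau> X = 0" by simp
    have sM: "adj M = M" unfolding M_def by (intro self_adjointD cfc_self_adjoint C cont)
    have "M o\<^sub>L M = cfc (\<lambda>t. sqrt (max (h t) 0) * sqrt (max (h t) 0)) C"
      unfolding M_def by (rule cfc_mult[symmetric, OF C(2) cont(3,3)])
    also have "\<dots> = X" unfolding X_def by (rule cfc_cong) simp
    finally have MM: "adj M o\<^sub>L M = X" using sM by simp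
    moreover have "M \<in> N" unfolding M_def by (intro cfc_closed C cont)
    ultimately have "M = 0" using trace_faithful tX by metis
    then show ?thesis using MM by (simp add: X_def)
  qed
  have "cfc (\<lambda>t. max (- g t) 0) C = 0"
  proof (rule half)
    show "continuous_on UNIV (\<lambda>t. - g t)" by (intro continuous_intros g)
    fix P assume P: "P \<in> projections N"
      "\<And>S. S \<in> N \<Longrightarrow> S o\<^sub>L C = C o\<^sub>L S \<Longrightarrow> adj S o\<^sub>L C = C o\<^sub>L adj S \<Longrightarrow> S o\<^sub>L P = P o\<^sub>L S"
    have "cfc (\<lambda>t. - g t) C = (-1) *\<^sub>R cfc g C" using cfc_cmult[OF C(2) g, of "-1"] by simp
    then have "cfc (\<lambda>t. - g t) C o\<^sub>L P = (-1) *\<^sub>R (cfc g C o\<^sub>L P)"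
      by (intro blinfun_eqI) (simp add: blinfun.bilinear_simps)
    moreover have "\<tau> (cfc g C o\<^sub>L P) = 0" by (rule tr[OF P(1)]) (rule P(2))
    moreover have "cfc g C o\<^sub>L P \<in> N" by (intro closed cfc_closed C g projectionD(1)[OF P(1)])
    ultimately show "\<tau> (cfc (\<lambda>t. - g t) C o\<^sub>L P) = 0" by (simp only: trace_scaleR) simp
  qed
  moreover have "cfc (\<lambda>t. max (g t) 0) C = 0"
    by (rule half[OF g]) (rule tr)
  moreover have "cfc g C = cfc (\<lambda>t. max (g t) 0 - max (- g t) 0) C" by (rule cfc_cong) auto
  moreover have "\<dots> = cfc (\<lambda>t. max (g t) 0) C - cfc (\<lambda>t. max (- g t) 0) C"
    by (rule cfc_diff[OF C(2)]) (intro continuous_intros g)+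
  ultimately show ?thesis by simp
qed

end

section \<open>The norm identity\<close>

text \<open>After scaling to u + v = 1, each of u powr q and v powr q is strictly above its base for
  q < 1 and strictly below it for q > 1, so the sum is not 1.\<close>

lemma sum_powr_neq:
  fixes x y q :: real
  assumes "0 < x" "0 < y" "0 < q" "q \<noteq> 1"
  shows "x powr q + y powr q \<noteq> (x + y) powr q"
proof -
  define u where "u = x / (x + y)"
  define v where "v = y / (x + y)"
  have uv: "0 < u" "u < 1" "0 < v" "v < 1" "u + v = 1"
    using assms by (auto simp: u_def v_def simp flip: add_divide_distrib)
  have "u powr q + v powr q \<noteq> 1"
  proof (cases "q < 1")
    case True
    then have "u powr 1 < u powr q" "v powr 1 < v powr q"
      using uv powr_less_mono'[of u q 1] powr_less_mono'[of v q 1] by simp_all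
    then show ?thesis using uv by simp
  next
    case False
    then have "u powr q < u powr 1" "v powr q < v powr 1"
      using uv assms powr_less_mono'[of u 1 q] powr_less_mono'[of v 1 q] by simp_all
    then show ?thesis using uv by simp
  qed
  moreover have "x powr q + y powr q = (x + y) powr q * (u powr q + v powr q)"
    using assms by (simp add: u_def v_def powr_divide field_simps)
  ultimately show ?thesis using assms by auto
qed

lemma powr_difference_inj:
  fixes s t q :: real
  assumes "0 < q" "-1 \<le> s" "s \<le> 1" "-1 \<le> t" "t \<le> 1"
    and eq: "(2 - 2 * s) powr q - (2 + 2 * s) powr q = (2 - 2 * t) powr q - (2 + 2 * t) powr q"
  shows "s = t"
proof -
  have "(2 - 2 * v) powr q - (2 + 2 * v) powr q < (2 - 2 * u) powr q - (2 + 2 * u) powr q"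
    if "u < v" "-1 \<le> u" "v \<le> 1" for u v
    using that assms(1) powr_less_mono2[of q "2 - 2 * v" "2 - 2 * u"]
      powr_less_mono2[of q "2 + 2 * u" "2 + 2 * v"] by simp
  then show ?thesis using assms by (metis linorder_neq_iff less_irrefl)
qed

lemma cfc_scalar:
  assumes "continuous_on UNIV f"
  shows "cfc f (r *\<^sub>R \<one>\<^sub>o) = f r *\<^sub>R (\<one>\<^sub>o :: 'a::complex_hilbert op)"
  using cfc_compose[of "\<one>\<^sub>o :: 'a op" f "\<lambda>_. r"] assms by (simp add: cfc_const)

context tracial_factor
begin

lemma unitaryD:
  assumes "U \<in> unitaries N"
  shows "U \<in> N" "adj U (U x) = x" "U (adj U x) = x"
  using assms compose_apply[of "adj U" U "\<one>\<^sub>o" x] compose_apply[of U "adj U" "\<one>\<^sub>o" x]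
  by (auto simp: unitaries_def)

text \<open>The root, the power and the real part in \<open>Lp_norm\<close> cancel because the trace
  of |A|^p is real and nonnegative.\<close>

lemma Lp_norm_powr:
  assumes A: "A \<in> N" and p: "0 < p"
  shows "complex_of_real (Lp_norm \<tau> p A powr p) = \<tau> (cfc (\<lambda>t. t powr (p / 2)) (adj A o\<^sub>L A))"
proof -
  define K where "K = adj A o\<^sub>L A"
  have K: "K \<in> N" "self_adjoint K"
    using A by (auto simp: K_def closed self_adjoint_adj_compose in_bounded)
  \<comment> \<open>Half of the exponent p/2, so the product of \<open>adj M\<close> and M is the
    required power and positivity of the trace applies.\<close>
  define M where "M = cfc (\<lambda>t. t powr (p / 4)) K"
  have c: "continuous_on UNIV (\<lambda>t::real. t powr (p / 4))" using p by (intro continuous_real_powr) simp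
  have M: "M \<in> N" "adj M = M"
    unfolding M_def by (intro cfc_closed self_adjointD cfc_self_adjoint K c)+
  have "M o\<^sub>L M = cfc (\<lambda>t. t powr (p / 4) * t powr (p / 4)) K"
    unfolding M_def by (rule cfc_mult[symmetric, OF K(2) c c])
  also have "(\<lambda>t::real. t powr (p / 4) * t powr (p / 4)) = (\<lambda>t. t powr (p / 2))"
    by (simp add: fun_eq_iff flip: powr_add)
  finally have MM: "adj M o\<^sub>L M = cfc (\<lambda>t. t powr (p / 2)) K" using M by simp
  define r where "r = Re (\<tau> (cfc (\<lambda>t. t powr (p / 2)) K))"
  have "0 \<le> r" "\<tau> (cfc (\<lambda>t. t powr (p / 2)) K) = of_real r"
    using trace_nonneg[OF M(1)] MM by (auto simp: r_def complex_eq_iff)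
  moreover have "Lp_norm \<tau> p A = r powr (1 / p)"
    unfolding Lp_norm_def op_powr_op_abs[OF in_bounded[OF A] p] by (simp add: r_def K_def)
  ultimately show ?thesis using p by (simp add: K_def powr_powr)
qed

text \<open>A is U - I on the range of P and U + I on its complement; as U is unitary, the squared
  absolute values there are 2 - 2C and 2 + 2C.\<close>

lemma cfc_commuting_reflection:
  fixes U P :: "'a op"
  assumes U: "U \<in> unitaries N" and P: "P \<in> projections N" and comm: "U o\<^sub>L P = P o\<^sub>L U"
    and f: "continuous_on UNIV f"
  defines "C \<equiv> (1/2) *\<^sub>R (U + adj U)" and "A \<equiv> U - 2 *\<^sub>R P + \<one>\<^sub>o"
  shows "cfc f (adj A o\<^sub>L A) = (cfc (\<lambda>t. f (2 - 2 * t)) C o\<^sub>L P) + (cfc (\<lambda>t. f (2 + 2 * t)) C o\<^sub>L (\<one>\<^sub>o - P))"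
proof -
  note Up = unitaryD[OF U] and Pp = projectionD[OF P]
  note Ub = in_bounded[OF Up(1)] and Pb = in_bounded[OF Pp(1)]
  have "adj (U o\<^sub>L P) = adj (P o\<^sub>L U)" using comm by simp
  then have comm': "adj U o\<^sub>L P = P o\<^sub>L adj U" using Ub Pb Pp(2) by (simp add: adj_simps)
  have PU: "P (U x) = U (P x)" "P (adj U x) = adj U (P x)" for x
    using compose_apply[OF comm, of x] compose_apply[OF comm', of x] by simp_all
  have C: "C \<in> N" "self_adjoint C"
    unfolding C_def using Up(1) Ub by (auto intro!: closed simp: self_adjoint_def adj_simps add.commute)
  have X: "cfc (\<lambda>t. 2 - 2 * t) C = 2 *\<^sub>R \<one>\<^sub>o - 2 *\<^sub>R C"
    by (subst cfc_diff; (intro C continuous_intros)?) (simp add: cfc_const cfc_cmult cfc_ident C)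
  have Y: "cfc (\<lambda>t. 2 + 2 * t) C = 2 *\<^sub>R \<one>\<^sub>o + 2 *\<^sub>R C"
    by (subst cfc_add; (intro C continuous_intros)?) (simp add: cfc_const cfc_cmult cfc_ident C)
  have A_adj: "adj A = adj U - 2 *\<^sub>R P + \<one>\<^sub>o" unfolding A_def using Ub Pb Pp(2) by (simp add: adj_simps)
  have AA: "adj A o\<^sub>L A = ((2 *\<^sub>R \<one>\<^sub>o - 2 *\<^sub>R C) o\<^sub>L P) + ((2 *\<^sub>R \<one>\<^sub>o + 2 *\<^sub>R C) o\<^sub>L (\<one>\<^sub>o - P))"
  proof (rule blinfun_eqI)
    fix x
    have twice: "2 *\<^sub>R y = y + y" for y :: 'a by (rule scaleR_2)
    show "(adj A o\<^sub>L A) x = (((2 *\<^sub>R \<one>\<^sub>o - 2 *\<^sub>R C) o\<^sub>L P) + ((2 *\<^sub>R \<one>\<^sub>o + 2 *\<^sub>R C) o\<^sub>L (\<one>\<^sub>o - P))) x"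
      unfolding A_adj
      by (simp add: A_def C_def blinfun.bilinear_simps PU Up Pp(5) twice algebra_simps)
  qed
  have c: "continuous_on UNIV (\<lambda>t::real. 2 - 2 * t)" "continuous_on UNIV (\<lambda>t::real. 2 + 2 * t)"
    by (intro continuous_intros)+
  have XY: "cfc f (2 *\<^sub>R \<one>\<^sub>o - 2 *\<^sub>R C) = cfc (\<lambda>t. f (2 - 2 * t)) C"
    "cfc f (2 *\<^sub>R \<one>\<^sub>o + 2 *\<^sub>R C) = cfc (\<lambda>t. f (2 + 2 * t)) C"
    unfolding X[symmetric] Y[symmetric] by (intro cfc_compose C f c)+
  show ?thesis
    unfolding AA XY[symmetric]
  proof (rule cfc_direct_sum)
    show "self_adjoint (2 *\<^sub>R \<one>\<^sub>o - 2 *\<^sub>R C)" "self_adjoint (2 *\<^sub>R \<one>\<^sub>o + 2 *\<^sub>R C)"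
      by (intro self_adjoint_diff self_adjoint_add self_adjoint_scaleR self_adjoint_id C)+
    show "P o\<^sub>L (2 *\<^sub>R \<one>\<^sub>o - 2 *\<^sub>R C) = (2 *\<^sub>R \<one>\<^sub>o - 2 *\<^sub>R C) o\<^sub>L P"
      "P o\<^sub>L (2 *\<^sub>R \<one>\<^sub>o + 2 *\<^sub>R C) = (2 *\<^sub>R \<one>\<^sub>o + 2 *\<^sub>R C) o\<^sub>L P"
      by (auto intro!: blinfun_eqI simp: C_def blinfun.bilinear_simps PU)
  qed (fact f Pb Pp)+
qed

definition norm_identity :: "real \<Rightarrow> real \<Rightarrow> 'a op \<Rightarrow> 'a op \<Rightarrow> bool"
  where "norm_identity p \<theta> U P \<longleftrightarrow>
    complex_of_real (Lp_norm \<tau> p (U - 2 *\<^sub>R P + \<one>\<^sub>o) powr p) =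
      \<tau> P * complex_of_real ((2 - 2 * cos \<theta>) powr (p / 2)) +
      \<tau> (\<one>\<^sub>o - P) * complex_of_real ((2 + 2 * cos \<theta>) powr (p / 2))"

lemma norm_identity_iff:
  assumes U: "U \<in> unitaries N" and P: "P \<in> projections N" and p: "0 < p"
  shows "norm_identity p \<theta> U P \<longleftrightarrow>
    \<tau> (cfc (\<lambda>t. t powr (p / 2)) (adj (U - 2 *\<^sub>R P + \<one>\<^sub>o) o\<^sub>L (U - 2 *\<^sub>R P + \<one>\<^sub>o))) =
      \<tau> P * complex_of_real ((2 - 2 * cos \<theta>) powr (p / 2)) +
      (1 - \<tau> P) * complex_of_real ((2 + 2 * cos \<theta>) powr (p / 2))"
proof -
  have "U - 2 *\<^sub>R P + \<one>\<^sub>o \<in> N" by (intro closed unitaryD[OF U] projectionD[OF P])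
  then show ?thesis
    unfolding norm_identity_def
    by (simp add: Lp_norm_powr[OF _ p] trace_diff trace_id id_closed projectionD[OF P])
qed

text \<open>A scalar U commutes with every P and has scalar C. Only the real part of z matters, so
  one argument covers both signs of the exponent.\<close>

lemma norm_identity_scalar:
  assumes U: "U \<in> unitaries N" "U = z *\<^sub>o \<one>\<^sub>o" and z: "Re z = cos \<theta>"
    and P: "P \<in> projections N" and p: "0 < p"
  shows "norm_identity p \<theta> U P"
proof -
  note Pp = projectionD[OF P]
  define f where "f = (\<lambda>t::real. t powr (p / 2))"
  have f: "continuous_on UNIV f" using p unfolding f_def by (intro continuous_real_powr) simp
  have comm: "U o\<^sub>L P = P o\<^sub>L U"
    by (auto intro!: blinfun_eqI simp: U bounded_opsD[OF in_bounded[OF Pp(1)]])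
  have "(1/2) *\<^sub>R (U + adj U) = (1/2) *\<^sub>o (z *\<^sub>o \<one>\<^sub>o + cnj z *\<^sub>o \<one>\<^sub>o)"
    using op_scaleC_of_real[of "1/2" "U + adj U"] by (simp add: U(2) adj_simps)
  also have "\<dots> = complex_of_real (cos \<theta>) *\<^sub>o \<one>\<^sub>o"
    by (rule blinfun_eqI) (simp add: blinfun.bilinear_simps scaleC_scaleC flip: scaleC_add_left add: z complex_add_cnj)
  finally have C: "(1/2) *\<^sub>R (U + adj U) = cos \<theta> *\<^sub>R \<one>\<^sub>o" by (simp add: op_scaleC_of_real)
  have "continuous_on UNIV (\<lambda>t. f (2 - 2 * t))" "continuous_on UNIV (\<lambda>t. f (2 + 2 * t))"
    by (intro continuous_on_compose2[OF f] continuous_intros; simp)+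
  then have "cfc f (adj (U - 2 *\<^sub>R P + \<one>\<^sub>o) o\<^sub>L (U - 2 *\<^sub>R P + \<one>\<^sub>o)) =
    f (2 - 2 * cos \<theta>) *\<^sub>R P + f (2 + 2 * cos \<theta>) *\<^sub>R (\<one>\<^sub>o - P)"
    unfolding cfc_commuting_reflection[OF U(1) P comm f] C
    by (auto intro!: blinfun_eqI simp: cfc_scalar blinfun.bilinear_simps scaleR_diff_right)
  then show ?thesis
    unfolding norm_identity_iff[OF U(1) P p] f_def[symmetric]
    by (simp add: f_def[THEN fun_cong, symmetric] trace_add trace_scaleR trace_diff trace_id closed Pp mult.commute)
qed

text \<open>The identity is exploited only at projections commuting with U, where its left side is
  the trace of an expression affine in P.\<close>

lemma real_part_of_norm_identity:
  assumes U: "U \<in> unitaries N" and p: "0 < p"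
    and id: "\<And>P. P \<in> projections N \<Longrightarrow> norm_identity p \<theta> U P"
  shows "(1/2) *\<^sub>R (U + adj U) = cos \<theta> *\<^sub>R \<one>\<^sub>o"
proof -
  note Up = unitaryD[OF U]
  note Ub = in_bounded[OF Up(1)]
  define C where "C = (1/2) *\<^sub>R (U + adj U)"
  have C: "C \<in> N" "self_adjoint C"
    unfolding C_def using Up(1) Ub by (auto intro!: closed simp: self_adjoint_def adj_simps add.commute)
  define f where "f = (\<lambda>t::real. t powr (p / 2))"
  define a where "a = f (2 - 2 * cos \<theta>)"
  define b where "b = f (2 + 2 * cos \<theta>)"
  have f: "continuous_on UNIV f" using p unfolding f_def by (intro continuous_real_powr) simp
  have cX: "continuous_on UNIV (\<lambda>t. f (2 - 2 * t))" and cY: "continuous_on UNIV (\<lambda>t. f (2 + 2 * t))"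
    by (intro continuous_on_compose2[OF f] continuous_intros; simp)+
  define X where "X = cfc (\<lambda>t. f (2 - 2 * t)) C"
  define Y where "Y = cfc (\<lambda>t. f (2 + 2 * t)) C"
  have XN: "X \<in> N" and YN: "Y \<in> N" unfolding X_def Y_def by (intro cfc_closed C cX cY)+
  have key: "\<tau> (X o\<^sub>L P) + \<tau> (Y o\<^sub>L (\<one>\<^sub>o - P)) = \<tau> P * of_real a + (1 - \<tau> P) * of_real b"
    if P: "P \<in> projections N" "U o\<^sub>L P = P o\<^sub>L U" for P
  proof -
    have "\<tau> ((X o\<^sub>L P) + (Y o\<^sub>L (\<one>\<^sub>o - P))) = \<tau> P * of_real a + (1 - \<tau> P) * of_real b"
      using id[OF P(1)] cfc_commuting_reflection[OF U P f]
      unfolding norm_identity_iff[OF U P(1) p] f_def[symmetric] a_def b_def X_def Y_def C_def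
      by (simp add: f_def)
    then show ?thesis using P(1) XN YN by (subst (asm) trace_add) (auto intro!: closed simp: projectionD(1))
  qed
  \<comment> \<open>The case P = 0, subtracted from the general one below so that only terms
    containing P remain.\<close>
  have tY: "\<tau> Y = of_real b"
    using key[of 0] by (simp add: projections_def zero_closed trace_zero)
  define g where "g = (\<lambda>t. (f (2 - 2 * t) - f (2 + 2 * t)) - (a - b))"
  have g: "continuous_on UNIV g" unfolding g_def by (intro continuous_intros cX cY)
  have gC: "cfc g C = (X - Y) - (a - b) *\<^sub>R \<one>\<^sub>o"
    unfolding g_def X_def Y_def
    by (subst cfc_diff; (intro C continuous_intros cX cY)?) (simp add: cfc_diff C cX cY cfc_const[OF C(2), of "a - b", simplified] flip: scaleR_diff_left)
  have "cfc g C = 0"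
  proof (rule cfc_eq_0_by_trace[OF C g])
    fix P assume P: "P \<in> projections N"
      "\<And>S. S \<in> N \<Longrightarrow> S o\<^sub>L C = C o\<^sub>L S \<Longrightarrow> adj S o\<^sub>L C = C o\<^sub>L adj S \<Longrightarrow> S o\<^sub>L P = P o\<^sub>L S"
    \<comment> \<open>U and its adjoint commute with C because U is unitary, so the commutation
      property of P applies to U itself.\<close>
    have UP: "U o\<^sub>L P = P o\<^sub>L U"
      by (rule P(2)[OF Up(1)]) (auto intro!: blinfun_eqI simp: C_def blinfun.bilinear_simps Up)
    note PN = projectionD(1)[OF P(1)]
    have "Y o\<^sub>L (\<one>\<^sub>o - P) = Y - (Y o\<^sub>L P)"
      by (rule blinfun_eqI) (simp add: blinfun.bilinear_simps)
    then have "\<tau> (Y o\<^sub>L (\<one>\<^sub>o - P)) = of_real b - \<tau> (Y o\<^sub>L P)"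
      using YN PN tY by (simp add: trace_diff closed)
    with key[OF P(1) UP] have *: "\<tau> (X o\<^sub>L P) - \<tau> (Y o\<^sub>L P) - of_real (a - b) * \<tau> P = 0"
      by (simp add: algebra_simps)
    have "cfc g C o\<^sub>L P = ((X o\<^sub>L P) - (Y o\<^sub>L P)) - (a - b) *\<^sub>R P"
      unfolding gC by (rule blinfun_eqI) (simp add: blinfun.bilinear_simps)
    then show "\<tau> (cfc g C o\<^sub>L P) = 0"
      using * XN YN PN by (simp add: trace_diff trace_scaleR closed)
  qed
  have norm_U: "norm (T x) = norm x" if "T = U \<or> T = adj U" for T x
  proof -
    have "U x \<bullet> U x = x \<bullet> x" "adj U x \<bullet> adj U x = x \<bullet> x"
      using adj_inner[OF Ub, of x "U x"] adj_inner'[OF Ub, of x "adj U x"] Up by simp_all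
    then show ?thesis using that by (auto simp: norm_eq_sqrt_inner)
  qed
  \<comment> \<open>Confines the spectrum of C to [-1, 1], where the difference of powers is
    injective.\<close>
  have "norm C \<le> 1"
  proof (rule norm_blinfun_bound)
    fix x
    have "norm (U x + adj U x) \<le> norm x + norm x"
      using norm_triangle_ineq[of "U x" "adj U x"] norm_U by simp
    then show "norm (C x) \<le> 1 * norm x" by (simp add: C_def blinfun.bilinear_simps)
  qed simp
  have "x = cos \<theta>" if x: "x \<in> real_spectrum C" for x
  proof -
    have "g x = 0" using cfc_norm_ge[OF C(2) g x] \<open>cfc g C = 0\<close> by simp
    moreover have "x \<in> {-1..1}"
      using real_spectrum_subset[OF self_adjointD(1)[OF C(2)]] x \<open>norm C \<le> 1\<close> by force
    ultimately show ?thesis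
      using p powr_difference_inj[of "p / 2" x "cos \<theta>"] by (simp add: g_def f_def a_def b_def)
  qed
  then have "cfc (\<lambda>t. t) C = cfc (\<lambda>_. cos \<theta>) C" by (rule cfc_cong)
  then show ?thesis using C(2) by (simp add: cfc_ident cfc_const flip: C_def)
qed

text \<open>With \<open>E = V\<^sup>*V + VV\<^sup>*\<close> and \<open>P = (E + V + V\<^sup>*) / 2\<close>, the operator \<open>|U - 2P + I|\<^sup>2\<close> is
  \<open>(2 + 2 cos \<theta>) (I - E) + 4 F\<close> for a projection \<open>F \<le> E\<close> of trace \<open>\<tau>(E) / 2\<close>.\<close>

lemma norm_identity_off_diagonal:
  fixes z :: complex
  assumes U: "U \<in> unitaries N" and p: "0 < p" and z: "cmod z = 1" "Re z = cos \<theta>"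
    and V: "partial_isometry V" "V \<noteq> 0" "V o\<^sub>L V = 0"
    and UV: "U o\<^sub>L V = cnj z *\<^sub>o V" "V o\<^sub>L U = z *\<^sub>o V" and C: "U + adj U = (2 * cos \<theta>) *\<^sub>R \<one>\<^sub>o"
    and id: "\<And>P. P \<in> projections N \<Longrightarrow> norm_identity p \<theta> U P"
  shows "(2 - 2 * cos \<theta>) powr (p / 2) + (2 + 2 * cos \<theta>) powr (p / 2) = 4 powr (p / 2)"
proof -
  note Up = unitaryD[OF U] and Vp = partial_isometryD[OF V(1)]
  note Ub = in_bounded[OF Up(1)] and Vb = in_bounded[OF Vp(1)]
  have zz: "z * cnj z = 1" using z(1) complex_norm_square[of z] by simp
  have "adj (V o\<^sub>L V) = adj 0" "adj (U o\<^sub>L V) = adj (cnj z *\<^sub>o V)" "adj (V o\<^sub>L U) = adj (z *\<^sub>o V)"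
    by (simp_all only: V(3) UV)
  then have adjs: "adj V o\<^sub>L adj V = 0" "adj V o\<^sub>L adj U = z *\<^sub>o adj V" "adj U o\<^sub>L adj V = cnj z *\<^sub>o adj V"
    using Ub Vb by (simp_all add: adj_simps)
  note rel = Up(2,3) Vp(2,3) compose_apply[OF V(3), simplified] compose_apply[OF UV(1), simplified]
    compose_apply[OF UV(2), simplified] compose_apply[OF adjs(1), simplified]
    compose_apply[OF adjs(2), simplified] compose_apply[OF adjs(3), simplified]
    bounded_opsD[OF Ub] bounded_opsD[OF Vb] bounded_opsD[OF adj_bounded_ops[OF Ub]]
    bounded_opsD[OF adj_bounded_ops[OF Vb]]
  have adjU: "adj U x = (2 * cos \<theta>) *\<^sub>R x - U x" for x
    using C[THEN arg_cong, of "\<lambda>T. blinfun_apply T x"] by (simp add: blinfun.bilinear_simps algebra_simps)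
  \<comment> \<open>Taking \<open>adj V o\<^sub>L V\<close> as first and
    \<open>V o\<^sub>L adj V\<close> as second diagonal corner, E is the unit of the block, U is
    diag(z, cnj z), and F has diagonal entries 1/2 and off-diagonal entries -z/2 and -cnj z/2: a
    quarter of |U - 2P + I|^2.\<close>
  define E where "E = (adj V o\<^sub>L V) + (V o\<^sub>L adj V)"
  define P where "P = (1/2) *\<^sub>R (E + (V + adj V))"
  define F where "F = (1/2) *\<^sub>R (E - (z *\<^sub>o V + cnj z *\<^sub>o adj V))"
  have E_N: "E \<in> N" and P_N: "P \<in> N" and F_N: "F \<in> N"
    unfolding E_def P_def F_def by (intro closed Vp)+
  have E: "E \<in> projections N"
    using E_N by (rule projectionI) (auto simp: E_def adj_simps Vb blinfun.bilinear_simps rel)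
  have Ex: "E x = adj V (V x) + V (adj V x)" for x by (simp add: E_def blinfun.bilinear_simps)
  have P: "P \<in> projections N"
  proof (rule projectionI[OF P_N])
    show "adj P = P" by (simp add: P_def E_def adj_simps Vb add.commute)
    show "P (P x) = P x" for x
    proof -
      define G where "G = E + (V + adj V)"
      have "G (G x) = 2 *\<^sub>R G x"
        by (simp add: G_def Ex blinfun.bilinear_simps rel scaleR_2 algebra_simps)
      then show ?thesis by (simp add: P_def blinfun.bilinear_simps flip: G_def)
    qed
  qed
  have zzx: "z *\<^sub>C cnj z *\<^sub>C x = x" "cnj z *\<^sub>C z *\<^sub>C x = x" for x :: 'a
    using zz by (simp_all add: scaleC_scaleC mult.commute)
  have F: "F \<in> projections N"
  proof (rule projectionI[OF F_N])
    show "adj F = F" by (simp add: F_def E_def adj_simps Vb add.commute)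
    show "F (F x) = F x" for x
    proof -
      define G where "G = E - (z *\<^sub>o V + cnj z *\<^sub>o adj V)"
      have "G (G x) = 2 *\<^sub>R G x"
        by (simp add: G_def Ex blinfun.bilinear_simps rel scaleC_add_right scaleC_diff_right zzx
            scaleR_2 algebra_simps)
      then show ?thesis by (simp add: F_def blinfun.bilinear_simps flip: G_def)
    qed
  qed
  have FE: "F (E x) = F x" "E (F x) = F x" for x
    by (simp_all add: F_def Ex blinfun.bilinear_simps rel scaleR_add_right scaleR_diff_right)
  define A where "A = U - 2 *\<^sub>R P + \<one>\<^sub>o"
  have Ax: "A x = U x + x - (E x + (V x + adj V x))" for x
    by (simp add: A_def P_def blinfun.bilinear_simps)
  have "adj A = adj U - 2 *\<^sub>R P + \<one>\<^sub>o"
    unfolding A_def using Ub in_bounded[OF P_N] projectionD(2)[OF P] by (simp add: adj_simps)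
  then have Ax': "adj A x = adj U x + x - (E x + (V x + adj V x))" for x
    by (simp add: P_def blinfun.bilinear_simps)
  define y where "y = 2 + 2 * cos \<theta>"
  \<comment> \<open>Off E the projection P vanishes and |U + I|^2 is y. The factor
    \<open>\<one>\<^sub>o - (\<one>\<^sub>o - E)\<close> is left unsimplified to fit the shape of
    \<open>cfc_direct_sum\<close>.\<close>
  have AA: "adj A o\<^sub>L A = ((y *\<^sub>R \<one>\<^sub>o) o\<^sub>L (\<one>\<^sub>o - E)) + ((4 *\<^sub>R F) o\<^sub>L (\<one>\<^sub>o - (\<one>\<^sub>o - E)))"
  proof (rule blinfun_eqI)
    fix x
    \<comment> \<open>The given relations and their adjoints cover half of the products of U, V and
      their adjoints; cancelling the unitary supplies the other half.\<close>
    have UE: "U (adj V y) = z *\<^sub>C adj V y" "adj V (U y) = cnj z *\<^sub>C adj V y"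
      "adj U (V y) = z *\<^sub>C V y" "V (adj U y) = cnj z *\<^sub>C V y" for y
    proof -
      have "U (adj V y) = z *\<^sub>C cnj z *\<^sub>C U (adj V y)" by (simp only: zzx)
      also have "cnj z *\<^sub>C U (adj V y) = U (adj U (adj V y))" by (simp add: rel(10,11))
      finally show "U (adj V y) = z *\<^sub>C adj V y" by (simp only: Up)
      have "adj V (U y) = cnj z *\<^sub>C z *\<^sub>C adj V (U y)" by (simp only: zzx)
      also have "z *\<^sub>C adj V (U y) = adj V (adj U (U y))" by (simp only: rel(9))
      finally show "adj V (U y) = cnj z *\<^sub>C adj V y" by (simp only: Up)
      have "adj U (V y) = z *\<^sub>C cnj z *\<^sub>C adj U (V y)" by (simp only: zzx)
      also have "cnj z *\<^sub>C adj U (V y) = adj U (U (V y))" by (simp only: rel(6,13))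
      finally show "adj U (V y) = z *\<^sub>C V y" by (simp only: Up)
      have "V (adj U y) = cnj z *\<^sub>C z *\<^sub>C V (adj U y)" by (simp only: zzx)
      also have "z *\<^sub>C V (adj U y) = V (U (adj U y))" by (simp only: rel(7))
      finally show "V (adj U y) = cnj z *\<^sub>C V y" by (simp only: Up)
    qed
    have cz: "cnj z *\<^sub>C w = cos \<theta> *\<^sub>R w + cos \<theta> *\<^sub>R w - z *\<^sub>C w" for w :: 'a
    proof -
      have "cnj z = of_real (2 * cos \<theta>) - z" using z(2) by (simp add: complex_eq_iff)
      then have "cnj z *\<^sub>C w = of_real (2 * cos \<theta>) *\<^sub>C w - z *\<^sub>C w" by (simp only: scaleC_diff_left)
      then show ?thesis by (simp only: scaleC_of_real) (simp flip: scaleR_add_left)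
    qed
    have adjU': "adj U x = cos \<theta> *\<^sub>R x + cos \<theta> *\<^sub>R x - U x" using adjU[of x] by (simp flip: scaleR_add_left)
    have F4: "4 *\<^sub>R F w = E w + E w - ((z *\<^sub>C V w + z *\<^sub>C V w) + (cnj z *\<^sub>C adj V w + cnj z *\<^sub>C adj V w))" for w
    proof -
      have "4 *\<^sub>R F w = 2 *\<^sub>R (E w - (z *\<^sub>C V w + cnj z *\<^sub>C adj V w))"
        by (simp add: F_def blinfun.bilinear_simps)
      then show ?thesis by (simp add: scaleR_2)
    qed
    have yR: "y *\<^sub>R w = w + w + (cos \<theta> *\<^sub>R w + cos \<theta> *\<^sub>R w)" for w :: 'a
      by (simp add: y_def scaleR_add_left scaleR_2 flip: scaleR_scaleR)
    show "(adj A o\<^sub>L A) x = (((y *\<^sub>R \<one>\<^sub>o) o\<^sub>L (\<one>\<^sub>o - E)) + ((4 *\<^sub>R F) o\<^sub>L (\<one>\<^sub>o - (\<one>\<^sub>o - E)))) x"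
      by (simp add: Ax Ax' blinfun.bilinear_simps FE yR F4)
        (simp add: Ex blinfun.bilinear_simps rel UE adjU' cz scaleR_add_right algebra_simps)
  qed
  define f where "f = (\<lambda>t::real. t powr (p / 2))"
  have f: "continuous_on UNIV f" using p unfolding f_def by (intro continuous_real_powr) simp
  note Fp = projectionD[OF F] and Ep = projectionD[OF E]
  \<comment> \<open>A block form with scalars 4 and 0; f(0) = 0 then removes the second
    block.\<close>
  have "4 *\<^sub>R F = ((4 *\<^sub>R \<one>\<^sub>o) o\<^sub>L F) + ((0 *\<^sub>R \<one>\<^sub>o) o\<^sub>L (\<one>\<^sub>o - F))"
    by (auto intro!: blinfun_eqI simp: blinfun.bilinear_simps)
  then have "cfc f (4 *\<^sub>R F) = cfc f (((4 *\<^sub>R \<one>\<^sub>o) o\<^sub>L F) + ((0 *\<^sub>R \<one>\<^sub>o) o\<^sub>L (\<one>\<^sub>o - F)))" by simp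
  also have "\<dots> = (cfc f (4 *\<^sub>R \<one>\<^sub>o) o\<^sub>L F) + (cfc f (0 *\<^sub>R \<one>\<^sub>o) o\<^sub>L (\<one>\<^sub>o - F))"
    by (rule cfc_direct_sum)
      (auto intro!: self_adjoint_scaleR f Fp in_bounded blinfun_eqI simp: blinfun.bilinear_simps)
  also have "\<dots> = f 4 *\<^sub>R F"
    unfolding cfc_scalar[OF f] by (rule blinfun_eqI) (simp add: f_def blinfun.bilinear_simps)
  finally have fF: "cfc f (4 *\<^sub>R F) = f 4 *\<^sub>R F" .
  have "cfc f (adj A o\<^sub>L A) =
    (cfc f (y *\<^sub>R \<one>\<^sub>o) o\<^sub>L (\<one>\<^sub>o - E)) + (cfc f (4 *\<^sub>R F) o\<^sub>L (\<one>\<^sub>o - (\<one>\<^sub>o - E)))"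
    unfolding AA using projectionD[OF complement_projection[OF E]]
    by (intro cfc_direct_sum)
      (auto intro!: self_adjoint_scaleR f Fp in_bounded blinfun_eqI simp: blinfun.bilinear_simps FE
        scaleR_diff_right)
  also have "\<dots> = f y *\<^sub>R (\<one>\<^sub>o - E) + f 4 *\<^sub>R F"
    unfolding cfc_scalar[OF f] fF
    by (rule blinfun_eqI) (simp add: blinfun.bilinear_simps FE scaleR_diff_right)
  finally have "\<tau> (cfc f (adj A o\<^sub>L A)) = of_real (f y) * (1 - \<tau> E) + of_real (f 4) * \<tau> F"
    using E_N F_N by (simp add: trace_add trace_scaleR trace_diff trace_id closed)
  \<comment> \<open>V is V times its initial projection, and exchanging the two factors under the
    trace gives 0 because V V = 0. Hence F and P both have trace \<tau>(E)/2.\<close>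
  moreover have tV: "\<tau> V = 0" "\<tau> (adj V) = 0"
  proof -
    have "V o\<^sub>L (adj V o\<^sub>L V) = V" "adj V o\<^sub>L (V o\<^sub>L adj V) = adj V"
      "(adj V o\<^sub>L V) o\<^sub>L V = 0" "(V o\<^sub>L adj V) o\<^sub>L adj V = 0"
      by (auto intro!: blinfun_eqI simp: rel)
    then show "\<tau> V = 0" "\<tau> (adj V) = 0"
      using trace_comm[of V "adj V o\<^sub>L V"] trace_comm[of "adj V" "V o\<^sub>L adj V"] Vp(1)
      by (simp_all add: closed trace_zero)
  qed
  then have "\<tau> F = \<tau> E / 2" "\<tau> P = \<tau> E / 2"
    unfolding F_def P_def using E_N Vp(1)
    by (simp_all add: trace_add trace_scaleR trace_scaleC trace_diff closed)
  moreover have "\<tau> (cfc f (adj A o\<^sub>L A)) =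
    \<tau> P * of_real (f (2 - 2 * cos \<theta>)) + (1 - \<tau> P) * of_real (f y)"
    using id[OF P] unfolding norm_identity_iff[OF U P p] A_def f_def y_def by simp
  ultimately have "of_real (f y) * (1 - \<tau> E) + of_real (f 4) * (\<tau> E / 2) =
    \<tau> E / 2 * of_real (f (2 - 2 * cos \<theta>)) + (1 - \<tau> E / 2) * of_real (f y)" by simp
  moreover have "\<tau> E * of_real (f (2 - 2 * cos \<theta>) + f y - f 4) =
    2 * ((\<tau> E / 2 * of_real (f (2 - 2 * cos \<theta>)) + (1 - \<tau> E / 2) * of_real (f y)) -
      (of_real (f y) * (1 - \<tau> E) + of_real (f 4) * (\<tau> E / 2)))"
    by (simp add: algebra_simps)
  ultimately have "\<tau> E * of_real (f (2 - 2 * cos \<theta>) + f y - f 4) = 0" by simp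
  moreover have "\<tau> E \<noteq> 0"
  proof
    assume "\<tau> E = 0"
    then have "E = 0" by (rule trace_projection_eq_0[OF E])
    then have "V (E x) = 0" for x by (simp add: blinfun.bilinear_simps)
    then have "V x = 0" for x by (simp add: Ex blinfun.bilinear_simps rel)
    then show False using V(2) by (metis blinfun.zero_left blinfun_eqI)
  qed
  ultimately have "f (2 - 2 * cos \<theta>) + f y - f 4 = 0" by (metis mult_eq_0_iff of_real_eq_0_iff)
  then show ?thesis by (simp add: f_def y_def)
qed

text \<open>As C is scalar, U satisfies the quadratic equation (U - z)(U - cnj z) = 0 with z =
  e^{i\<theta>}. For nonreal z, Q is the Lagrange interpolation polynomial in U that is 1 at z and 0
  at cnj z.\<close>

lemma unitary_of_norm_identity:
  assumes U: "U \<in> unitaries N" and p: "0 < p" "p \<noteq> 2"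
    and id: "\<And>P. P \<in> projections N \<Longrightarrow> norm_identity p \<theta> U P"
  shows "U = cis \<theta> *\<^sub>o \<one>\<^sub>o \<or> U = cnj (cis \<theta>) *\<^sub>o \<one>\<^sub>o"
proof -
  note Up = unitaryD[OF U]
  note Ub = in_bounded[OF Up(1)]
  define z where "z = cis \<theta>"
  have z: "cmod z = 1" "Re z = cos \<theta>" "Im z = sin \<theta>" by (simp_all add: z_def)
  have zz: "z * cnj z = 1" using z(1) complex_norm_square[of z] by simp
  have zs: "z + cnj z = of_real (2 * cos \<theta>)" by (simp add: z complex_eq_iff)
  have C: "U + adj U = (2 * cos \<theta>) *\<^sub>R \<one>\<^sub>o"
    using real_part_of_norm_identity[OF U p(1) id, THEN arg_cong, of "\<lambda>T. 2 *\<^sub>R T"] by simp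
  have adjU: "adj U x = z *\<^sub>C x + cnj z *\<^sub>C x - U x" for x
    using C[THEN arg_cong, of "\<lambda>T. blinfun_apply T x"] scaleC_of_real[of "2 * cos \<theta>" x]
    unfolding zs[symmetric] by (simp add: blinfun.bilinear_simps scaleC_add_left algebra_simps)
  have UU: "U (U x) = z *\<^sub>C U x + cnj z *\<^sub>C U x - x" for x
    using adjU[of "U x"] Up(2)[of x] by (simp add: algebra_simps)
  have adjT: "adj (U - cnj z *\<^sub>o \<one>\<^sub>o) = cnj z *\<^sub>o \<one>\<^sub>o - U"
  proof (rule blinfun_eqI)
    fix x
    show "adj (U - cnj z *\<^sub>o \<one>\<^sub>o) x = (cnj z *\<^sub>o \<one>\<^sub>o - U) x"
      using Ub by (simp add: adj_simps blinfun.bilinear_simps adjU)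
  qed
  have T: "(U - z *\<^sub>o \<one>\<^sub>o) ((U - cnj z *\<^sub>o \<one>\<^sub>o) x) = 0" for x
    using zz by (simp add: blinfun.bilinear_simps UU bounded_opsD[OF Ub] scaleC_diff_right scaleC_scaleC
        algebra_simps)
  show ?thesis
  proof (cases "sin \<theta> = 0")
    case True
    then have "cnj z = z" using z by (simp add: complex_eq_iff)
    \<comment> \<open>For real z the operator U - z is skew-adjoint with square zero, so its product
      with its adjoint vanishes.\<close>
    have "adj (U - z *\<^sub>o \<one>\<^sub>o) o\<^sub>L (U - z *\<^sub>o \<one>\<^sub>o) = 0"
    proof (intro blinfun_eqI)
      fix x
      have "adj (U - z *\<^sub>o \<one>\<^sub>o) = - (U - z *\<^sub>o \<one>\<^sub>o)" using adjT \<open>cnj z = z\<close> by simp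
      then show "(adj (U - z *\<^sub>o \<one>\<^sub>o) o\<^sub>L (U - z *\<^sub>o \<one>\<^sub>o)) x = blinfun_apply 0 x"
        using T[of x] \<open>cnj z = z\<close> by (simp only: blinfun_apply_blinfun_compose blinfun.minus_left) simp
    qed
    then have "U - z *\<^sub>o \<one>\<^sub>o = 0"
      by (rule adj_compose_self_eq_0[rotated]) (intro bounded_ops_intros Ub)
    then show ?thesis by (simp add: z_def)
  next
    case False
    define k where "k = 1 / (z - cnj z)"
    have zn: "z - cnj z \<noteq> 0" using False z by (auto simp: complex_eq_iff)
    \<comment> \<open>The factor is purely imaginary; since U - cnj z is skew-adjoint, this makes Q
      self-adjoint.\<close>
    have k: "cnj k = - k" "k * (z - cnj z) = 1"
      using zn by (simp_all add: k_def minus_divide_right)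
    define Q where "Q = k *\<^sub>o (U - cnj z *\<^sub>o \<one>\<^sub>o)"
    have Q_N: "Q \<in> N" unfolding Q_def by (intro closed Up)
    have Qx: "Q x = k *\<^sub>C (U x - cnj z *\<^sub>C x)" for x by (simp add: Q_def blinfun.bilinear_simps)
    have Ux: "U x = (z - cnj z) *\<^sub>C Q x + cnj z *\<^sub>C x" for x
      using k(2) by (simp add: Qx scaleC_scaleC mult.commute)
    have UQ: "U (Q x) = z *\<^sub>C Q x" for x
    proof -
      have "(U - z *\<^sub>o \<one>\<^sub>o) (Q x) = k *\<^sub>C (U - z *\<^sub>o \<one>\<^sub>o) ((U - cnj z *\<^sub>o \<one>\<^sub>o) x)"
        unfolding Q_def op_scaleC_apply by (rule bounded_opsD) (intro bounded_ops_intros Ub)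
      then show ?thesis unfolding T by (simp add: blinfun.bilinear_simps)
    qed
    have QQ: "Q (Q x) = Q x" for x
      using k(2) by (subst Qx) (simp add: UQ scaleC_scaleC flip: scaleC_diff_left)
    have Q: "Q \<in> projections N"
    proof (rule projectionI[OF Q_N _ QQ])
      have "adj Q = cnj k *\<^sub>o adj (U - cnj z *\<^sub>o \<one>\<^sub>o)"
        unfolding Q_def by (rule adj_scaleC) (intro bounded_ops_intros Ub)
      then show "adj Q = Q"
        unfolding adjT k(1) Q_def
        by (auto intro!: blinfun_eqI simp: blinfun.bilinear_simps scaleC_minus_left scaleC_diff_right)
    qed
    have QU: "Q (U x) = z *\<^sub>C Q x" for x
      using UQ[of x] by (simp add: Qx blinfun.bilinear_simps bounded_opsD[OF Ub])
    have "Q = 0 \<or> \<one>\<^sub>o - Q = 0"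
    proof (rule ccontr)
      assume neq: "\<not> ?thesis"
      define R where "R = \<one>\<^sub>o - Q"
      have R: "R \<in> projections N" "R \<noteq> 0"
        using complement_projection[OF Q] neq by (auto simp: R_def)
      obtain A where A: "A \<in> N" "R o\<^sub>L (A o\<^sub>L Q) \<noteq> 0"
        using projections_linked[OF Q _ R] neq by blast
      have "R o\<^sub>L (A o\<^sub>L Q) \<in> N" by (intro closed A Q_N projectionD[OF R(1)])
      then obtain V where V: "partial_isometry V" "V \<noteq> 0"
        "\<And>S. S o\<^sub>L (R o\<^sub>L (A o\<^sub>L Q)) = R o\<^sub>L (A o\<^sub>L Q) \<Longrightarrow> S o\<^sub>L V = V"
        "\<And>S. (R o\<^sub>L (A o\<^sub>L Q)) o\<^sub>L S = R o\<^sub>L (A o\<^sub>L Q) \<Longrightarrow> V o\<^sub>L S = V"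
        using partial_isometry_exists A(2) by metis
      have "R o\<^sub>L V = V" by (rule V(3)) (auto intro!: blinfun_eqI simp: projectionD[OF R(1)])
      from compose_apply[OF this] have QV: "Q (V x) = 0" for x
        by (simp add: R_def blinfun.bilinear_simps)
      have "V o\<^sub>L Q = V" by (rule V(4)) (auto intro!: blinfun_eqI simp: QQ)
      note VQ = compose_apply[OF this]
      note Vb = in_bounded[OF partial_isometryD(1)[OF V(1)]]
      have "(2 - 2 * cos \<theta>) powr (p / 2) + (2 + 2 * cos \<theta>) powr (p / 2) = 4 powr (p / 2)"
      proof (rule norm_identity_off_diagonal[OF U p(1) z(1,2) V(1,2) _ _ _ C id])
        show "V o\<^sub>L V = 0"
          using VQ QV by (intro blinfun_eqI) (metis blinfun.zero_left blinfun.zero_right blinfun_apply_blinfun_compose)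
        show "U o\<^sub>L V = cnj z *\<^sub>o V"
          by (rule blinfun_eqI) (simp add: Ux QV)
        show "V o\<^sub>L U = z *\<^sub>o V"
        proof (rule blinfun_eqI)
          fix x show "(V o\<^sub>L U) x = (z *\<^sub>o V) x"
            using VQ[of "U x"] VQ[of x] by (simp add: QU bounded_opsD[OF Vb])
        qed
      qed
      \<comment> \<open>Strictness makes 2 - 2 cos \<theta> and 2 + 2 cos \<theta> both positive, as
        the failure of additivity requires.\<close>
      moreover have "\<bar>cos \<theta>\<bar> < 1"
      proof -
        have "(cos \<theta>)\<^sup>2 < 1" using False sin_cos_squared_add[of \<theta>] zero_less_power2[of "sin \<theta>"] by linarith
        then show ?thesis by (simp add: abs_square_less_1)
      qed
      ultimately show False
        using sum_powr_neq[of "2 - 2 * cos \<theta>" "2 + 2 * cos \<theta>" "p / 2"] p by (auto simp: abs_less_iff)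
    qed
    then show ?thesis
    proof
      assume "Q = 0"
      then have "U = cnj z *\<^sub>o \<one>\<^sub>o" by (intro blinfun_eqI) (simp add: Ux)
      then show ?thesis by (simp add: z_def)
    next
      assume "\<one>\<^sub>o - Q = 0"
      then have "Q = \<one>\<^sub>o" by simp
      then have "U = z *\<^sub>o \<one>\<^sub>o" by (intro blinfun_eqI) (simp add: Ux scaleC_diff_left)
      then show ?thesis by (simp add: z_def)
    qed
  qed
qed

end

theorem lemma2p5:
  fixes N :: "'a::complex_hilbert op set"
    and \<tau> :: "'a op \<Rightarrow> complex"
    and U :: "'a op"
    and p \<theta> :: real
  assumes "0 < p" and "p \<noteq> 2"
    and "II1_factor N" and "tracial_state N \<tau>"
    and "U \<in> unitaries N"
    and "- pi < \<theta>" and "\<theta> \<le> pi"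
  shows "(\<forall>P\<in>projections N.
            complex_of_real (Lp_norm \<tau> p (U - 2 *\<^sub>R P + \<one>\<^sub>o) powr p) =
              \<tau> P * complex_of_real ((2 - 2 * cos \<theta>) powr (p / 2)) +
              \<tau> (\<one>\<^sub>o - P) * complex_of_real ((2 + 2 * cos \<theta>) powr (p / 2)))
         \<longleftrightarrow> U = exp (\<i> * complex_of_real \<theta>) *\<^sub>o \<one>\<^sub>o \<or>
             U = exp (- \<i> * complex_of_real \<theta>) *\<^sub>o \<one>\<^sub>o"
proof -
  interpret tracial_factor N \<tau>
    using assms(3,4) by unfold_locales (auto simp: II1_factor_def factor_def)
  have e: "exp (\<i> * complex_of_real \<theta>) = cis \<theta>" "exp (- \<i> * complex_of_real \<theta>) = cnj (cis \<theta>)"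
    by (simp add: cis_conv_exp, simp only: cis_cnj) (simp add: cis_conv_exp)
  show ?thesis
    unfolding norm_identity_def[symmetric] e
  proof
    assume "\<forall>P\<in>projections N. norm_identity p \<theta> U P"
    then show "U = cis \<theta> *\<^sub>o \<one>\<^sub>o \<or> U = cnj (cis \<theta>) *\<^sub>o \<one>\<^sub>o"
      by (intro unitary_of_norm_identity[OF assms(5,1,2)]) blast
  next
    assume "U = cis \<theta> *\<^sub>o \<one>\<^sub>o \<or> U = cnj (cis \<theta>) *\<^sub>o \<one>\<^sub>o"
    then obtain z where "U = z *\<^sub>o \<one>\<^sub>o" "Re z = cos \<theta>" by auto
    then show "\<forall>P\<in>projections N. norm_identity p \<theta> U P"
      using norm_identity_scalar[OF assms(5)] assms(1) by blast
  qed
qed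

end
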